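(* Let $s\in\mathbb{R}$ and $\varphi\in\mathcal{M}$. The Hilbert space $H^{s,\varphi}(\Gamma,V)$ does not depend, up to equivalence of norms, on the choice of the atlas $\{\alpha_j\}$ and of the partition of unity $\{\chi_j\}$ on $\Gamma$ and on the choice of the local trivializations $\{\beta_j\}$ of $V$.
   Context: **Class $\mathcal{M}$.** $\mathcal{M}$ is the set of all Borel measurable functions $\varphi:[1,\infty)\to(0,\infty)$ such that (i) $\varphi$ and $1/\varphi$ are bounded on each interval $[1,b]$ with $1<b<\infty$; (ii) $\lim_{t\to\infty}\varphi(\lambda t)/\varphi(t)=1$ for every $\lambda>0$. **Spaces on $\mathbb{R}^n$.** Let $\langle\xi\rangle=(1+|\xi|^2)^{1/2}$. For $s\in\mathbb{R}$, $\varphi\in\mathcal{M}$, $H^{s,\varphi}(\mathbb{R}^n)$ is the Hilbert space of all tempered distributions $w$ on $\mathbb{R}^n$ whose Fourier transform $\widehat w$ is locally integrable and satisfies $\|w\|_{s,\varphi;\mathbb{R}^n}^2:=\int_{\mathbb{R}^n}\langle\xi\rangle^{2s}\varphi^2(\langle\xi\rangle)|\widehat w(\xi)|^2\,d\xi<\infty$. **Spaces on a vector bundle.** $\Gamma$ is a closed (compact, without boundary) infinitely smooth real manifold of dimension $n\ge1$ with a given $C^\infty$-density $dx$, and $\pi:V\to\Gamma$ is an infinitely smooth complex vector bundle of rank $p\ge1$; $C^\infty(\Gamma,V)$ is the space of its smooth sections. Choose a finite atlas of local charts (smooth diffeomorphisms) $\alpha_j:\mathbb{R}^n\leftrightarrow\Gamma_j$,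 $j=1,\dots,\varkappa$, where the open sets $\Gamma_j$ cover $\Gamma$, local trivializations $\beta_j:\pi^{-1}(\Gamma_j)\leftrightarrow\Gamma_j\times\mathbb{C}^p$, and real-valued $\chi_j\in C^\infty(\Gamma)$ with $\mathrm{supp}\,\chi_j\subset\Gamma_j$ forming a partition of unity on $\Gamma$. Let $\Pi_k:(x,a)\mapsto a_k$ for $x\in\Gamma$, $a=(a_1,\dots,a_p)\in\mathbb{C}^p$, and for a section $u$ put $u_{j,k}:=\Pi_k(\beta_j\circ(\chi_ju)\circ\alpha_j)$, a function on $\mathbb{R}^n$. $H^{s,\varphi}(\Gamma,V)$ is the completion of $C^\infty(\Gamma,V)$ in the Hilbert norm $$\|u\|_{s,\varphi;\Gamma,V}:=\Bigl(\sum_{j=1}^{\varkappa}\sum_{k=1}^{p}\|u_{j,k}\|^2_{s,\varphi;\mathbb{R}^n}\Bigr)^{1/2}.$$ Independence "up to equivalence of norms" means: for any two choices of (atlas, partition of unity, local trivializations) as described, the two resulting norms on $C^\infty(\Gamma,V)$ are equivalent, so that the two completions coincide. *)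

theory Defs
  imports "HOL-Analysis.Analysis"
begin

section \<open>Smooth functions between Euclidean spaces\<close>

text \<open>Only used for open \<open>S\<close>.\<close>

primrec Ck_on :: "nat \<Rightarrow> 'a::euclidean_space set \<Rightarrow> ('a \<Rightarrow> 'b::real_normed_vector) \<Rightarrow> bool" where
  "Ck_on 0 S f \<longleftrightarrow> continuous_on S f"
| "Ck_on (Suc k) S f \<longleftrightarrow> (\<forall>x\<in>S. f differentiable at x) \<and>
     (\<forall>v. Ck_on k S (\<lambda>x. frechet_derivative f (at x) v))"

definition smooth_on :: "'a::euclidean_space set \<Rightarrow> ('a \<Rightarrow> 'b::real_normed_vector) \<Rightarrow> bool" where
  "smooth_on S f \<longleftrightarrow> (\<forall>k. Ck_on k S f)"

text \<open>A list of basis vectors plays the role of a multi-index.\<close>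

primrec iter_deriv :: "'a::euclidean_space list \<Rightarrow> ('a \<Rightarrow> 'b::real_normed_vector) \<Rightarrow> 'a \<Rightarrow> 'b" where
  "iter_deriv [] f = f"
| "iter_deriv (v # vs) f = (\<lambda>x. frechet_derivative (iter_deriv vs f) (at x) v)"


section \<open>The spaces on Euclidean space\<close>

definition class_M :: "(real \<Rightarrow> real) set" where
  "class_M = {\<phi>. (\<forall>t\<ge>1. \<phi> t > 0) \<and>
     \<phi> \<in> borel_measurable (restrict_space borel {1..}) \<and>
     (\<forall>b>1. bounded (\<phi> ` {1..b}) \<and> bounded ((\<lambda>t. 1 / \<phi> t) ` {1..b})) \<and>
     (\<forall>c>0. ((\<lambda>t. \<phi> (c * t) / \<phi> t) \<longlongrightarrow> 1) at_top)}"

definition japanese_bracket :: "'a::euclidean_space \<Rightarrow> real" where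
  "japanese_bracket \<xi> = sqrt (1 + (norm \<xi>)\<^sup>2)"

definition schwartz_seminorm :: "nat \<Rightarrow> 'a::euclidean_space list \<Rightarrow> ('a \<Rightarrow> complex) \<Rightarrow> real" where
  "schwartz_seminorm N vs f = (SUP x. (1 + norm x) ^ N * norm (iter_deriv vs f x))"

definition schwartz :: "('a::euclidean_space \<Rightarrow> complex) set" where
  "schwartz = {f. smooth_on UNIV f \<and>
     (\<forall>N vs. set vs \<subseteq> Basis \<longrightarrow> bounded (range (\<lambda>x. (1 + norm x) ^ N * norm (iter_deriv vs f x))))}"

definition test_functions :: "('a::euclidean_space \<Rightarrow> complex) set" where
  "test_functions = {f. smooth_on UNIV f \<and> compact (closure {x. f x \<noteq> 0})}"

text \<open>Distributions are functionals on all functions; to make them determined by their values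
  on the Schwartz space they are required to be \<^const>\<open>extensional\<close>.\<close>

definition tempered_distributions :: "(('a::euclidean_space \<Rightarrow> complex) \<Rightarrow> complex) set" where
  "tempered_distributions = {w. w \<in> extensional schwartz \<and>
     (\<forall>f\<in>schwartz. \<forall>g\<in>schwartz. w (\<lambda>x. f x + g x) = w f + w g) \<and>
     (\<forall>f\<in>schwartz. \<forall>c. w (\<lambda>x. c * f x) = c * w f) \<and>
     (\<exists>C N. \<forall>f\<in>schwartz. norm (w f) \<le>
        C * (\<Sum>vs\<in>{vs. set vs \<subseteq> Basis \<and> length vs \<le> N}. schwartz_seminorm N vs f))}"

definition fourier :: "('a::euclidean_space \<Rightarrow> complex) \<Rightarrow> 'a \<Rightarrow> complex" where
  "fourier f \<xi> = (\<integral>x. cis (- (x \<bullet> \<xi>)) * f x \<partial>lborel)"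

definition fourier_distribution ::
    "(('a::euclidean_space \<Rightarrow> complex) \<Rightarrow> complex) \<Rightarrow> ('a \<Rightarrow> complex) \<Rightarrow> complex" where
  "fourier_distribution w = restrict (\<lambda>g. w (fourier g)) schwartz"

definition regular_distribution ::
    "('a::euclidean_space \<Rightarrow> complex) \<Rightarrow> ('a \<Rightarrow> complex) \<Rightarrow> complex" where
  "regular_distribution f = restrict (\<lambda>g. \<integral>x. f x * g x \<partial>lborel) schwartz"

text \<open>The distribution \<open>w\<close> is the locally integrable function \<open>f\<close>. This is tested on smooth
  functions with compact support only, since \<open>f * g\<close> need not be integrable for an
  arbitrary Schwartz function \<open>g\<close>.\<close>

definition represents ::
    "('a::euclidean_space \<Rightarrow> complex) \<Rightarrow> (('a \<Rightarrow> complex) \<Rightarrow> complex) \<Rightarrow> bool" where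
  "represents f w \<longleftrightarrow> (\<forall>K. compact K \<longrightarrow> set_integrable lborel K f) \<and>
     (\<forall>g\<in>test_functions. w g = (\<integral>x. f x * g x \<partial>lborel))"

text \<open>The function representing the Fourier transform; it is unique almost everywhere.\<close>

definition fourier_density ::
    "(('a::euclidean_space \<Rightarrow> complex) \<Rightarrow> complex) \<Rightarrow> 'a \<Rightarrow> complex" where
  "fourier_density w = (SOME f. represents f (fourier_distribution w))"

definition sobolev_integrand ::
    "real \<Rightarrow> (real \<Rightarrow> real) \<Rightarrow> (('a::euclidean_space \<Rightarrow> complex) \<Rightarrow> complex) \<Rightarrow> 'a \<Rightarrow> real" where
  "sobolev_integrand s \<phi> w \<xi> = japanese_bracket \<xi> powr (2 * s) *
     (\<phi> (japanese_bracket \<xi>))\<^sup>2 * (norm (fourier_density w \<xi>))\<^sup>2"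

definition sobolev_space ::
    "real \<Rightarrow> (real \<Rightarrow> real) \<Rightarrow> (('a::euclidean_space \<Rightarrow> complex) \<Rightarrow> complex) set" where
  "sobolev_space s \<phi> = {w \<in> tempered_distributions.
     (\<exists>f. represents f (fourier_distribution w)) \<and> integrable lborel (sobolev_integrand s \<phi> w)}"

definition sobolev_norm ::
    "real \<Rightarrow> (real \<Rightarrow> real) \<Rightarrow> (('a::euclidean_space \<Rightarrow> complex) \<Rightarrow> complex) \<Rightarrow> real" where
  "sobolev_norm s \<phi> w = sqrt (\<integral>\<xi>. sobolev_integrand s \<phi> w \<xi> \<partial>lborel)"


section \<open>Smooth manifolds\<close>

text \<open>The underlying set of a manifold is a whole type. A smooth structure is given by an atlas,
  not necessarily maximal, of pairs of a chart domain and a coordinate map.\<close>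

type_synonym ('m, 'e) atlas = "('m set \<times> ('m \<Rightarrow> 'e)) set"

definition smooth_atlas :: "('m::topological_space, 'e::euclidean_space) atlas \<Rightarrow> bool" where
  "smooth_atlas A \<longleftrightarrow> (\<Union>(U, x)\<in>A. U) = UNIV \<and>
     (\<forall>(U, x)\<in>A. open U \<and> open (x ` U) \<and> (\<exists>y. homeomorphism U (x ` U) x y)) \<and>
     (\<forall>(U, x)\<in>A. \<forall>(W, y)\<in>A. smooth_on (x ` (U \<inter> W)) (y \<circ> inv_into U x))"

definition euclidean_atlas :: "('e, 'e::euclidean_space) atlas" where
  "euclidean_atlas = {(UNIV, id)}"

definition product_atlas :: "('m, 'e) atlas \<Rightarrow> ('l, 'f) atlas \<Rightarrow> ('m \<times> 'l, 'e \<times> 'f) atlas" where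
  "product_atlas A B = {(U \<times> W, map_prod x y) | U x W y. (U, x) \<in> A \<and> (W, y) \<in> B}"

text \<open>Smoothness on an open set \<open>S\<close>.\<close>

definition smooth_map ::
    "('m::topological_space, 'e::euclidean_space) atlas \<Rightarrow> 'm set \<Rightarrow>
     ('l::topological_space, 'f::euclidean_space) atlas \<Rightarrow> ('m \<Rightarrow> 'l) \<Rightarrow> bool" where
  "smooth_map A S B f \<longleftrightarrow> continuous_on S f \<and>
     (\<forall>(U, x)\<in>A. \<forall>(W, y)\<in>B. smooth_on (x ` (U \<inter> S \<inter> f -` W)) (y \<circ> f \<circ> inv_into U x))"

definition diffeo ::
    "('m::topological_space, 'e::euclidean_space) atlas \<Rightarrow> 'm set \<Rightarrow>
     ('l::topological_space, 'f::euclidean_space) atlas \<Rightarrow> 'l set \<Rightarrow> ('m \<Rightarrow> 'l) \<Rightarrow> bool" where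
  "diffeo A S B T f \<longleftrightarrow> open S \<and> open T \<and> bij_betw f S T \<and>
     smooth_map A S B f \<and> smooth_map B T A (inv_into S f)"

text \<open>A smooth density, regarded as the measure that it defines.\<close>

definition smooth_density :: "('m::topological_space, 'e::euclidean_space) atlas \<Rightarrow> 'm measure \<Rightarrow> bool" where
  "smooth_density A \<mu> \<longleftrightarrow> sets \<mu> = sets borel \<and>
     (\<forall>(U, x)\<in>A. \<exists>\<rho>::'e \<Rightarrow> real. smooth_on (x ` U) \<rho> \<and> (\<forall>y\<in>x ` U. \<rho> y > 0) \<and>
        (\<forall>B\<in>sets borel. B \<subseteq> U \<longrightarrow>
           emeasure \<mu> B = (\<integral>\<^sup>+y. ennreal (\<rho> y) * indicator (x ` B) y \<partial>lborel)))"


section \<open>Smooth complex vector bundles\<close>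

text \<open>The base has type \<open>'m\<close> and dimension \<open>CARD('n)\<close>, the total space has type \<open>'v\<close>, and the
  rank is \<open>CARD('p)\<close>. The operations \<open>fibre_add\<close> and \<open>fibre_scale\<close> are those of the fibres;
  \<open>fibre_add v w\<close> is meaningful only if \<open>v\<close> and \<open>w\<close> lie over the same point.\<close>

record ('m, 'v, 'n, 'p) vbundle =
  base_atlas :: "('m, real^'n) atlas"
  total_atlas :: "('v, (real^'n) \<times> (complex^'p)) atlas"
  proj :: "'v \<Rightarrow> 'm"
  fibre_add :: "'v \<Rightarrow> 'v \<Rightarrow> 'v"
  fibre_scale :: "complex \<Rightarrow> 'v \<Rightarrow> 'v"

definition local_trivialization ::
    "('m::topological_space, 'v::topological_space, 'n::finite, 'p::finite) vbundle \<Rightarrow>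
     'm set \<Rightarrow> ('v \<Rightarrow> 'm \<times> (complex^'p)) \<Rightarrow> bool" where
  "local_trivialization E U \<beta> \<longleftrightarrow> open U \<and>
     diffeo (total_atlas E) (proj E -` U) (product_atlas (base_atlas E) euclidean_atlas) (U \<times> UNIV) \<beta> \<and>
     (\<forall>v\<in>proj E -` U. fst (\<beta> v) = proj E v) \<and>
     (\<forall>v\<in>proj E -` U. \<forall>w\<in>proj E -` U. proj E v = proj E w \<longrightarrow>
        snd (\<beta> (fibre_add E v w)) = snd (\<beta> v) + snd (\<beta> w)) \<and>
     (\<forall>c. \<forall>v\<in>proj E -` U. snd (\<beta> (fibre_scale E c v)) = c *s snd (\<beta> v))"

text \<open>The fibres are vector spaces because the local trivializations map them bijectively and
  compatibly with the operations onto \<open>complex^'p\<close>.\<close>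

definition smooth_vector_bundle ::
    "('m::t2_space, 'v::t2_space, 'n::finite, 'p::finite) vbundle \<Rightarrow> bool" where
  "smooth_vector_bundle E \<longleftrightarrow> smooth_atlas (base_atlas E) \<and> smooth_atlas (total_atlas E) \<and>
     smooth_map (total_atlas E) UNIV (base_atlas E) (proj E) \<and> surj (proj E) \<and>
     (\<forall>v w. proj E v = proj E w \<longrightarrow> proj E (fibre_add E v w) = proj E v) \<and>
     (\<forall>c v. proj E (fibre_scale E c v) = proj E v) \<and>
     (\<forall>x. \<exists>U \<beta>. x \<in> U \<and> local_trivialization E U \<beta>)"

definition smooth_sections ::
    "('m::topological_space, 'v::topological_space, 'n::finite, 'p::finite) vbundle \<Rightarrow> ('m \<Rightarrow> 'v) set" where
  "smooth_sections E = {u. (\<forall>x. proj E (u x) = x) \<and> smooth_map (base_atlas E) UNIV (total_atlas E) u}"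

definition section_diff ::
    "('m, 'v, 'n::finite, 'p::finite) vbundle \<Rightarrow> ('m \<Rightarrow> 'v) \<Rightarrow> ('m \<Rightarrow> 'v) \<Rightarrow> 'm \<Rightarrow> 'v" where
  "section_diff E u w = (\<lambda>x. fibre_add E (u x) (fibre_scale E (-1) (w x)))"


section \<open>The spaces on a vector bundle\<close>

text \<open>The choices entering the norm. The indices \<open>j < num_charts L\<close> are used, and the coordinate patch
  with index \<open>j\<close> is the range of \<open>chart L j\<close>.\<close>

record ('m, 'v, 'n, 'p) localization =
  num_charts :: nat
  chart :: "nat \<Rightarrow> real^'n \<Rightarrow> 'm"
  cutoff :: "nat \<Rightarrow> 'm \<Rightarrow> real"
  triv :: "nat \<Rightarrow> 'v \<Rightarrow> 'm \<times> (complex^'p)"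

text \<open>The functions forming the partition of unity are real-valued; their sign is not prescribed.\<close>

definition is_localization ::
    "('m::topological_space, 'v::topological_space, 'n::finite, 'p::finite) vbundle \<Rightarrow>
     ('m, 'v, 'n, 'p) localization \<Rightarrow> bool" where
  "is_localization E L \<longleftrightarrow>
     (\<forall>j<num_charts L. diffeo euclidean_atlas UNIV (base_atlas E) (range (chart L j)) (chart L j)) \<and>
     (\<Union>j<num_charts L. range (chart L j)) = UNIV \<and>
     (\<forall>j<num_charts L. smooth_map (base_atlas E) UNIV euclidean_atlas (cutoff L j) \<and>
        closure {x. cutoff L j x \<noteq> 0} \<subseteq> range (chart L j)) \<and>
     (\<forall>x. (\<Sum>j<num_charts L. cutoff L j x) = 1) \<and>
     (\<forall>j<num_charts L. local_trivialization E (range (chart L j)) (triv L j))"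

definition local_component ::
    "('m, 'v, 'n::finite, 'p::finite) vbundle \<Rightarrow> ('m, 'v, 'n, 'p) localization \<Rightarrow>
     ('m \<Rightarrow> 'v) \<Rightarrow> nat \<Rightarrow> 'p \<Rightarrow> real^'n \<Rightarrow> complex" where
  "local_component E L u j k = (\<lambda>y. let x = chart L j y in
     snd (triv L j (fibre_scale E (complex_of_real (cutoff L j x)) (u x))) $ k)"

definition section_norm ::
    "('m, 'v, 'n::finite, 'p::finite) vbundle \<Rightarrow> ('m, 'v, 'n, 'p) localization \<Rightarrow>
     real \<Rightarrow> (real \<Rightarrow> real) \<Rightarrow> ('m \<Rightarrow> 'v) \<Rightarrow> real" where
  "section_norm E L s \<phi> u = sqrt (\<Sum>j<num_charts L. \<Sum>k\<in>UNIV.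
     (sobolev_norm s \<phi> (regular_distribution (local_component E L u j k)))\<^sup>2)"

text \<open>The completion of a space \<open>X\<close> with subtraction \<open>d\<close> and norm \<open>N\<close>: Cauchy sequences modulo
  null sequences.\<close>

definition cauchy_sequences :: "('x \<Rightarrow> 'x \<Rightarrow> 'x) \<Rightarrow> ('x \<Rightarrow> real) \<Rightarrow> 'x set \<Rightarrow> (nat \<Rightarrow> 'x) set" where
  "cauchy_sequences d N X = {S. range S \<subseteq> X \<and>
     (\<forall>e>0. \<exists>M. \<forall>i\<ge>M. \<forall>j\<ge>M. N (d (S i) (S j)) < e)}"

definition null_rel :: "('x \<Rightarrow> 'x \<Rightarrow> 'x) \<Rightarrow> ('x \<Rightarrow> real) \<Rightarrow> 'x set \<Rightarrow> ((nat \<Rightarrow> 'x) \<times> (nat \<Rightarrow> 'x)) set" where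
  "null_rel d N X = {(S, T). S \<in> cauchy_sequences d N X \<and> T \<in> cauchy_sequences d N X \<and>
     (\<lambda>i. N (d (S i) (T i))) \<longlonglongrightarrow> 0}"

definition completion :: "('x \<Rightarrow> 'x \<Rightarrow> 'x) \<Rightarrow> ('x \<Rightarrow> real) \<Rightarrow> 'x set \<Rightarrow> (nat \<Rightarrow> 'x) set set" where
  "completion d N X = cauchy_sequences d N X // null_rel d N X"

definition completion_norm :: "('x \<Rightarrow> real) \<Rightarrow> (nat \<Rightarrow> 'x) set \<Rightarrow> real" where
  "completion_norm N h = lim (\<lambda>i. N ((SOME S. S \<in> h) i))"

definition bundle_space ::
    "('m::topological_space, 'v::topological_space, 'n::finite, 'p::finite) vbundle \<Rightarrow>
     ('m, 'v, 'n, 'p) localization \<Rightarrow> real \<Rightarrow> (real \<Rightarrow> real) \<Rightarrow> (nat \<Rightarrow> 'm \<Rightarrow> 'v) set set" where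
  "bundle_space E L s \<phi> = completion (section_diff E) (section_norm E L s \<phi>) (smooth_sections E)"

definition bundle_space_norm ::
    "('m, 'v, 'n::finite, 'p::finite) vbundle \<Rightarrow> ('m, 'v, 'n, 'p) localization \<Rightarrow>
     real \<Rightarrow> (real \<Rightarrow> real) \<Rightarrow> (nat \<Rightarrow> 'm \<Rightarrow> 'v) set \<Rightarrow> real" where
  "bundle_space_norm E L s \<phi> = completion_norm (section_norm E L s \<phi>)"

definition equivalent_norms_on :: "'x set \<Rightarrow> ('x \<Rightarrow> real) \<Rightarrow> ('x \<Rightarrow> real) \<Rightarrow> bool" where
  "equivalent_norms_on X N N' \<longleftrightarrow> (\<exists>c>0. \<exists>C>0. \<forall>u\<in>X. c * N u \<le> N' u \<and> N' u \<le> C * N u)"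

end

theory Submission
  imports Defs "HOL-Probability.Probability"
begin

text \<open>
  In two local descriptions of the bundle the components of a section are related by operators
  \<open>f \<mapsto> a * (f \<circ> \<kappa>)\<close>, where \<open>\<kappa>\<close> is a coordinate change and the amplitude \<open>a\<close> is smooth with
  compact support in its domain. So it suffices to bound such an operator in the weighted
  \<open>L\<^sup>2\<close> norm of the Fourier transform with weight \<open>\<omega> (japanese_bracket \<xi>)\<close>, where
  \<open>\<omega> t = t powr (2 * s) * (\<phi> t)\<^sup>2\<close>. On the Fourier side its kernel is
  \<open>\<integral> a x * cis (\<kappa> x \<bullet> \<xi> - x \<bullet> \<eta>)\<close>. Integrating by parts in \<open>x\<close> trades factors \<open>\<eta>\<close> for
  factors \<open>\<xi>\<close> and, \<open>\<kappa>\<close> being invertible, conversely; starting from the unweighted bound this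
  gives boundedness for the weights \<open>japanese_bracket \<xi> ^ (2 * m)\<close> and their inverses.

  For a general weight, the output near frequency \<open>2 ^ k\<close> is estimated by splitting the input at
  frequency \<open>2 ^ k\<close> and using a positive power weight for the lower and a negative one for the
  upper part. Since \<open>\<phi>\<close> varies slowly, \<open>\<omega> s / \<omega> t\<close> is bounded by a power of \<open>s / t + t / s\<close>, so
  the resulting dyadic sum converges when \<open>m\<close> is large. This replaces the interpolation
  with a function parameter between Sobolev spaces.
\<close>

section \<open>Calculus of smooth functions\<close>

text \<open>The operators act on Fourier transforms, and their inputs are the merely measurable
  functions of class \<open>rapid\<close>: a sharp cut in frequency destroys smoothness but not
  membership in this class. The unweighted bound comes from positivity (Gaussian regularization,
  expansion of a square, Schur's test), not from substitution in an integral, so no Jacobian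
  determinant appears; invertibility of \<kappa> enters through the chain rule, which yields the
  decay of the kernel at output frequency 0. Every bound is proved for all amplitudes at once,
  because integration by parts replaces \<open>a\<close> by derivatives and by products with
  Jacobian entries. Two choices inside the definitions must be controlled. The density of a Fourier
  transform is an arbitrary representative, so norms are computable only after uniqueness almost
  everywhere. The norm on the completion is read off an arbitrary sequence of a class, so both norms
  are compared along one common sequence. Only one inequality is proved for an ordered pair of
  localizations; exchanging them gives the other.\<close>

lemma Ck_on_subset: "Ck_on k S f \<Longrightarrow> T \<subseteq> S \<Longrightarrow> Ck_on k T f"
proof (induction k arbitrary: f)
  case 0
  then show ?case by (auto intro: continuous_on_subset)
next
  case (Suc k)
  then show ?case by (auto simp: subset_iff)
qed

text \<open>Openness of \<open>S\<close> matters: a derivative is determined by the values in a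
  neighbourhood, so agreement on \<open>S\<close> carries over to the derivatives on
  \<open>S\<close>.\<close>

lemma Ck_on_cong:
  assumes "open S" "\<And>x. x \<in> S \<Longrightarrow> f x = g x" "Ck_on k S f"
  shows "Ck_on k S g"
  using assms(2,3)
proof (induction k arbitrary: f g)
  case 0
  then show ?case by (auto cong: continuous_on_cong)
next
  case (Suc k)
  have d: "f differentiable at x" "g differentiable at x"
    "frechet_derivative f (at x) = frechet_derivative g (at x)" if "x \<in> S" for x
  proof -
    show f: "f differentiable at x" using Suc.prems that by auto
    show "g differentiable at x"
      using f Suc.prems(1) assms(1) that
      by (meson differentiable_def has_derivative_transform_within_open)
    show "frechet_derivative f (at x) = frechet_derivative g (at x)"
      using f Suc.prems(1) assms(1) that
      by (intro frechet_derivative_transform_within_open[of f x S g]) auto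
  qed
  have "Ck_on k S (\<lambda>x. frechet_derivative g (at x) v)" for v
    by (rule Suc.IH[of "\<lambda>x. frechet_derivative f (at x) v"]) (use Suc.prems(2) in \<open>simp_all add: d(3)\<close>)
  then show ?case using d(2) by simp
qed

lemma Ck_on_local:
  assumes "\<And>x. x \<in> S \<Longrightarrow> \<exists>T. open T \<and> x \<in> T \<and> Ck_on k T f"
  shows "Ck_on k S f"
  using assms
proof (induction k arbitrary: f)
  case 0
  then show ?case
    by (auto intro!: continuous_at_imp_continuous_on simp: continuous_on_eq_continuous_at)
      (metis continuous_on_eq_continuous_at)
next
  case (Suc k)
  have "Ck_on k S (\<lambda>x. frechet_derivative f (at x) v)" for v
    using Suc.prems by (intro Suc.IH) (fastforce)
  then show ?case using Suc.prems by fastforce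
qed

lemma Ck_on_SucD: "Ck_on (Suc k) S f \<Longrightarrow> Ck_on k S f"
proof (induction k arbitrary: f)
  case 0
  then show ?case
    by (auto intro!: continuous_at_imp_continuous_on differentiable_imp_continuous_within)
next
  case (Suc k)
  then show ?case by (metis Ck_on.simps(2))
qed

text \<open>\<open>Ck_on\<close> speaks of the chosen derivative \<open>frechet_derivative\<close>;
  by uniqueness of derivatives an explicit candidate may be used instead. Most closure properties
  below go through this rule.\<close>

lemma Ck_on_SucI:
  assumes "open S" "\<And>x. x \<in> S \<Longrightarrow> (f has_derivative f' x) (at x)"
    "\<And>v. Ck_on k S (\<lambda>x. f' x v)"
  shows "Ck_on (Suc k) S f"
proof -
  have d: "f' x = frechet_derivative f (at x)" if "x \<in> S" for x
    using assms(2)[OF that] by (rule frechet_derivative_at)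
  have "Ck_on k S (\<lambda>x. frechet_derivative f (at x) v)" for v
    by (rule Ck_on_cong[OF assms(1) _ assms(3)]) (simp add: d)
  then show ?thesis using assms(2) by (auto simp: differentiable_def)
qed

lemma Ck_on_derivative:
  assumes "Ck_on (Suc k) S f"
  shows "\<And>x. x \<in> S \<Longrightarrow> (f has_derivative frechet_derivative f (at x)) (at x)"
    "Ck_on k S (\<lambda>x. frechet_derivative f (at x) v)"
  using assms by (auto simp: frechet_derivative_works)

lemma Ck_on_const: "Ck_on k S (\<lambda>x. c)"
  by (induction k arbitrary: c) (auto intro: differentiable_const)

lemma Ck_on_bounded_linear:
  assumes "bounded_linear L" "open S" "Ck_on k S f"
  shows "Ck_on k S (\<lambda>x. L (f x))"
  using assms(3)
proof (induction k arbitrary: f)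
  case 0
  then show ?case using assms(1) by (auto intro: bounded_linear.continuous_on)
next
  case (Suc k)
  show ?case
    by (rule Ck_on_SucI[OF assms(2), where f'="\<lambda>x v. L (frechet_derivative f (at x) v)"])
      (use Suc.prems Ck_on_derivative[OF Suc.prems] Suc.IH assms(1) in
        \<open>auto intro: bounded_linear.has_derivative\<close>)
qed

lemma Ck_on_ident: "Ck_on k S (\<lambda>x. x)"
  by (cases k) (auto simp: Ck_on_const)

lemma Ck_on_add:
  assumes "open S" "Ck_on k S f" "Ck_on k S g"
  shows "Ck_on k S (\<lambda>x. f x + g x)"
  using assms(2,3)
proof (induction k arbitrary: f g)
  case 0
  then show ?case by (auto intro: continuous_intros)
next
  case (Suc k)
  show ?case
    by (rule Ck_on_SucI[OF assms(1), where f'="\<lambda>x v. frechet_derivative f (at x) v + frechet_derivative g (at x) v"])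
     (use Ck_on_derivative[OF Suc.prems(1)] Ck_on_derivative[OF Suc.prems(2)] Suc.IH in
        \<open>auto intro: has_derivative_add\<close>)
qed

lemma Ck_on_sum:
  assumes "open S" "\<And>i. i \<in> I \<Longrightarrow> Ck_on k S (f i)"
  shows "Ck_on k S (\<lambda>x. \<Sum>i\<in>I. f i x)"
  using assms(2)
  by (induction I rule: infinite_finite_induct) (auto simp: Ck_on_const intro: Ck_on_add[OF assms(1)])

lemma Ck_on_bilinear:
  assumes "bounded_bilinear b" "open S" "Ck_on k S f" "Ck_on k S g"
  shows "Ck_on k S (\<lambda>x. b (f x) (g x))"
  using assms(3,4)
proof (induction k arbitrary: f g)
  case 0
  then show ?case using assms(1) by (auto intro: bounded_bilinear.continuous_on)
next
  case (Suc k)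
  show ?case
    by (rule Ck_on_SucI[OF assms(2), where f'="\<lambda>x v. b (f x) (frechet_derivative g (at x) v) + b (frechet_derivative f (at x) v) (g x)"])
     (use Ck_on_derivative[OF Suc.prems(1)] Ck_on_derivative[OF Suc.prems(2)] Suc.IH
         Suc.prems[THEN Ck_on_SucD] in
        \<open>auto intro!: bounded_bilinear.FDERIV[OF assms(1)] Ck_on_add[OF assms(2)]\<close>)
qed

lemma Ck_on_compose:
  fixes f :: "'a::euclidean_space \<Rightarrow> 'b::euclidean_space" and g :: "'b \<Rightarrow> 'c::real_normed_vector"
  assumes "open S" "open T" "f ` S \<subseteq> T" "Ck_on k S f" "Ck_on k T g"
  shows "Ck_on k S (\<lambda>x. g (f x))"
  using assms(4,5)
proof (induction k arbitrary: g)
  case 0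
  then show ?case using assms(3) by (auto intro: continuous_on_compose2)
next
  case (Suc k)
  let ?g' = "\<lambda>y. frechet_derivative g (at y)" and ?f' = "\<lambda>x. frechet_derivative f (at x)"
  have g': "(g has_derivative ?g' (f x)) (at (f x))" if "x \<in> S" for x
    using Ck_on_derivative(1)[OF Suc.prems(2)] that assms(3) by auto
  have f': "(f has_derivative ?f' x) (at x)" if "x \<in> S" for x
    using Ck_on_derivative(1)[OF Suc.prems(1)] that by auto
  \<comment> \<open>The direction \<open>?f' x v\<close> varies with \<open>x\<close>, whereas the
    induction hypothesis speaks of derivatives in a fixed direction; expanding it in
    \<open>Basis\<close> separates the two.\<close>
  have eq: "?g' (f x) (?f' x v) = (\<Sum>i\<in>Basis. (?f' x v \<bullet> i) *\<^sub>R ?g' (f x) i)" if "x \<in> S" for x v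
  proof -
    interpret bounded_linear "?g' (f x)" using g'[OF that] by (rule has_derivative_bounded_linear)
    have "?g' (f x) (?f' x v) = ?g' (f x) (\<Sum>i\<in>Basis. (?f' x v \<bullet> i) *\<^sub>R i)"
      by (simp add: euclidean_representation)
    then show ?thesis by (simp add: sum scaleR)
  qed
  have "Ck_on k S (\<lambda>x. (?f' x v \<bullet> i) *\<^sub>R ?g' (f x) i)" for v i
    by (intro Ck_on_bilinear[OF bounded_bilinear_scaleR] Ck_on_bounded_linear[OF bounded_linear_inner_left]
        Suc.IH Ck_on_derivative(2)[OF Suc.prems(1)] Ck_on_derivative(2)[OF Suc.prems(2)]
        Ck_on_SucD[OF Suc.prems(1)] assms(1))
  then have "Ck_on k S (\<lambda>x. \<Sum>i\<in>Basis. (?f' x v \<bullet> i) *\<^sub>R ?g' (f x) i)" for v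
    by (intro Ck_on_sum assms(1))
  then have "Ck_on k S (\<lambda>x. ?g' (f x) (?f' x v))" for v
    by (rule Ck_on_cong[OF assms(1), rotated]) (simp add: eq)
  then show ?case
    by (intro Ck_on_SucI[OF assms(1), where f'="\<lambda>x v. ?g' (f x) (?f' x v)"])
       (use f' g' in \<open>auto intro: has_derivative_compose\<close>)
qed

lemma smooth_on_subset: "smooth_on S f \<Longrightarrow> T \<subseteq> S \<Longrightarrow> smooth_on T f"
  by (auto simp: smooth_on_def intro: Ck_on_subset)

lemma smooth_on_cong: "open S \<Longrightarrow> (\<And>x. x \<in> S \<Longrightarrow> f x = g x) \<Longrightarrow> smooth_on S f \<Longrightarrow> smooth_on S g"
  unfolding smooth_on_def by (blast intro: Ck_on_cong)

lemma smooth_on_local: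
  assumes "\<And>x. x \<in> S \<Longrightarrow> \<exists>T. open T \<and> x \<in> T \<and> smooth_on T f"
  shows "smooth_on S f"
  unfolding smooth_on_def
proof
  fix k show "Ck_on k S f"
    using assms unfolding smooth_on_def by (intro Ck_on_local) blast
qed

lemma smooth_on_const: "smooth_on S (\<lambda>x. c)"
  and smooth_on_ident: "smooth_on S (\<lambda>x. x)"
  by (simp_all add: smooth_on_def Ck_on_const Ck_on_ident)

lemma smooth_on_bounded_linear:
  "bounded_linear L \<Longrightarrow> open S \<Longrightarrow> smooth_on S f \<Longrightarrow> smooth_on S (\<lambda>x. L (f x))"
  by (auto simp: smooth_on_def intro: Ck_on_bounded_linear)

lemma smooth_on_add:
  "open S \<Longrightarrow> smooth_on S f \<Longrightarrow> smooth_on S g \<Longrightarrow> smooth_on S (\<lambda>x. f x + g x)"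
  by (auto simp: smooth_on_def intro: Ck_on_add)

lemma smooth_on_bilinear:
  "bounded_bilinear b \<Longrightarrow> open S \<Longrightarrow> smooth_on S f \<Longrightarrow> smooth_on S g \<Longrightarrow> smooth_on S (\<lambda>x. b (f x) (g x))"
  by (auto simp: smooth_on_def intro: Ck_on_bilinear)

lemmas smooth_on_mult = smooth_on_bilinear[OF bounded_bilinear_mult]

lemma smooth_on_compose:
  fixes f :: "'a::euclidean_space \<Rightarrow> 'b::euclidean_space" and g :: "'b \<Rightarrow> 'c::real_normed_vector"
  assumes "open S" "open T" "f ` S \<subseteq> T" "smooth_on S f" "smooth_on T g"
  shows "smooth_on S (\<lambda>x. g (f x))"
  using assms unfolding smooth_on_def by (blast intro: Ck_on_compose)

lemma smooth_on_imp_continuous_on: "smooth_on S f \<Longrightarrow> continuous_on S f"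
  unfolding smooth_on_def by (metis Ck_on.simps(1))

lemma smooth_on_has_derivative:
  "smooth_on S f \<Longrightarrow> x \<in> S \<Longrightarrow> (f has_derivative frechet_derivative f (at x)) (at x)"
  unfolding smooth_on_def by (metis Ck_on_derivative(1))

lemma smooth_on_frechet_derivative:
  "smooth_on S f \<Longrightarrow> smooth_on S (\<lambda>x. frechet_derivative f (at x) v)"
  unfolding smooth_on_def by (metis Ck_on_derivative(2))

lemma smooth_on_Pair:
  assumes "open S" "smooth_on S f" "smooth_on S g"
  shows "smooth_on S (\<lambda>x. (f x, g x))"
proof -
  have 1: "bounded_linear (\<lambda>a. (a, 0))" by (intro bounded_linear_Pair bounded_linear_ident bounded_linear_zero)
  have 2: "bounded_linear (\<lambda>a. (0, a))" by (intro bounded_linear_Pair bounded_linear_ident bounded_linear_zero)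
  show ?thesis
    using smooth_on_add[OF assms(1) smooth_on_bounded_linear[OF 1 assms(1,2)] smooth_on_bounded_linear[OF 2 assms(1,3)]]
    by simp
qed

lemma smooth_on_cis: "smooth_on UNIV cis"
proof -
  have "Ck_on k UNIV cis" for k
  proof (induction k)
    case 0
    then show ?case by (simp add: continuous_on_cis)
  next
    case (Suc k)
    have "Ck_on k UNIV (\<lambda>x. v *\<^sub>R (\<i> * cis x))" for v
      by (rule Ck_on_bounded_linear[OF _ _ Suc.IH])
        (auto intro!: bounded_linear_scaleR_right[THEN bounded_linear_compose] bounded_linear_mult_right)
    then show ?case
      by (intro Ck_on_SucI[where f'="\<lambda>x v. v *\<^sub>R (\<i> * cis x)"])
        (auto intro!: derivative_eq_intros simp: scaleR_conv_of_real)
  qed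
  then show ?thesis by (simp add: smooth_on_def)
qed

lemma smooth_on_inverse: "smooth_on {x::real. x \<noteq> 0} inverse"
proof -
  have o: "open {x::real. x \<noteq> 0}" by (simp add: open_Collect_neq continuous_on_const continuous_on_id)
  have "Ck_on k {x::real. x \<noteq> 0} inverse" for k
  proof (induction k)
    case 0
    then show ?case by (auto intro!: continuous_intros)
  next
    case (Suc k)
    have "Ck_on k {x::real. x \<noteq> 0} (\<lambda>x. -v * (inverse x * inverse x))" for v
      by (intro Ck_on_bounded_linear[OF bounded_linear_mult_right] Ck_on_bilinear[OF bounded_bilinear_mult] o Suc.IH)
    then show ?case
      by (intro Ck_on_SucI[where f'="\<lambda>x v. -v * (inverse x * inverse x)"] o)
        (auto intro!: derivative_eq_intros)
  qed
  then show ?thesis by (simp add: smooth_on_def)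
qed

subsection \<open>Cutoff functions\<close>

text \<open>The polynomial parameter makes the family p(1/t) exp(-1/t), extended by 0, closed under
  differentiation; \<open>p = 1\<close> is the classical flat function.\<close>

definition exp_cutoff :: "real poly \<Rightarrow> real \<Rightarrow> real" where
  "exp_cutoff p t = (if t > 0 then poly p (1 / t) * exp (- (1 / t)) else 0)"

lemma exp_cutoff_tendsto_0: "(exp_cutoff p \<longlongrightarrow> 0) (at 0)"
proof -
  have "((\<lambda>x. \<Sum>i\<le>degree p. coeff p i * (x ^ i / exp x)) \<longlongrightarrow> (\<Sum>i\<le>degree p. coeff p i * 0)) at_top"
    by (intro tendsto_intros tendsto_power_div_exp_0)
  then have "((\<lambda>x. poly p x / exp x) \<longlongrightarrow> 0) at_top"
    by (simp add: poly_altdef sum_divide_distrib)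
  then have "((\<lambda>t. poly p (inverse t) / exp (inverse t)) \<longlongrightarrow> 0) (at_right 0)"
    by (rule filterlim_compose) (rule filterlim_inverse_at_top_right)
  then have r: "(exp_cutoff p \<longlongrightarrow> 0) (at_right 0)"
    by (rule Lim_transform_eventually)
      (auto simp: exp_cutoff_def exp_minus field_simps eventually_at_filter)
  have l: "(exp_cutoff p \<longlongrightarrow> 0) (at_left 0)"
    by (rule Lim_transform_eventually[OF tendsto_const])
      (auto simp: exp_cutoff_def eventually_at_filter)
  show ?thesis using l r by (simp add: filterlim_at_split)
qed

text \<open>For t > 0 the chain rule gives (p(1/t) - p'(1/t)) t^-2 exp(-1/t), and t^-2 is the
  polynomial \<open>[:0, 0, 1:]\<close> at 1/t.\<close>

lemma exp_cutoff_has_derivative: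
  "(exp_cutoff p has_derivative (\<lambda>v. exp_cutoff ((p - pderiv p) * [:0, 0, 1:]) t * v)) (at t)"
proof (cases t "0::real" rule: linorder_cases)
  case less
  have "((\<lambda>x. 0) has_derivative (\<lambda>v. exp_cutoff ((p - pderiv p) * [:0, 0, 1:]) t * v)) (at t)"
    using less by (auto simp: exp_cutoff_def)
  then show ?thesis
    by (rule has_derivative_transform_within_open[where s="{..<0}"]) (use less in \<open>auto simp: exp_cutoff_def\<close>)
next
  case greater
  have "((\<lambda>x. poly p (1 / x) * exp (- (1 / x))) has_real_derivative
     exp_cutoff ((p - pderiv p) * [:0, 0, 1:]) t) (at t)"
    using greater
    by (auto intro!: derivative_eq_intros DERIV_chain2[OF poly_DERIV] simp: exp_cutoff_def field_simps power2_eq_square)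
  then have "((\<lambda>x. poly p (1 / x) * exp (- (1 / x))) has_derivative
     (\<lambda>v. exp_cutoff ((p - pderiv p) * [:0, 0, 1:]) t * v)) (at t)"
    by (simp add: has_field_derivative_def)
  then show ?thesis
    by (rule has_derivative_transform_within_open[where s="{0<..}"]) (use greater in \<open>auto simp: exp_cutoff_def\<close>)
next
  case equal
  have "(exp_cutoff (p * [:0, 1:]) \<longlongrightarrow> 0) (at 0)" by (rule exp_cutoff_tendsto_0)
  \<comment> \<open>The difference quotient at 0 is again a member of the family, hence tends to
    0.\<close>
  moreover have "exp_cutoff (p * [:0, 1:]) = (\<lambda>h. (exp_cutoff p (0 + h) - exp_cutoff p 0) / h)"
    by (auto simp: exp_cutoff_def)
  ultimately have "(exp_cutoff p has_real_derivative 0) (at 0)"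
    by (simp only: DERIV_def)
  moreover have "(*) (0::real) = (\<lambda>v. 0)" by auto
  ultimately show ?thesis using equal by (simp add: has_field_derivative_def exp_cutoff_def)
qed

lemma smooth_on_exp_cutoff: "smooth_on UNIV (exp_cutoff p)"
proof -
  have "Ck_on k UNIV (exp_cutoff p)" for k
  proof (induction k arbitrary: p)
    case 0
    then show ?case
      using exp_cutoff_has_derivative
      by (auto intro!: continuous_at_imp_continuous_on has_derivative_continuous)
  next
    case (Suc k)
    have "Ck_on k UNIV (\<lambda>x. exp_cutoff ((p - pderiv p) * [:0, 0, 1:]) x * v)" for v
      by (intro Ck_on_bounded_linear[OF bounded_linear_mult_left] Suc.IH) auto
    then show ?case
      using exp_cutoff_has_derivative by (intro Ck_on_SucI) auto
  qed
  then show ?thesis by (simp add: smooth_on_def)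
qed

text \<open>With e(t) = exp(-1/t) for t > 0 the step is e(t) / (e(t) + e(1 - t)); the denominator
  never vanishes because t and 1 - t cannot both be nonpositive.\<close>

lemma smooth_step:
  obtains \<sigma> :: "real \<Rightarrow> real" where "smooth_on UNIV \<sigma>" "\<forall>t. 0 \<le> \<sigma> t \<and> \<sigma> t \<le> 1"
    "\<forall>t\<le>0. \<sigma> t = 0" "\<forall>t\<ge>1. \<sigma> t = 1"
proof -
  let ?e = "exp_cutoff 1"
  define \<sigma> where "\<sigma> t = ?e t * inverse (?e t + ?e (1 - t))" for t
  have nn: "?e t \<ge> 0" for t by (auto simp: exp_cutoff_def)
  have pos: "?e t + ?e (1 - t) > 0" for t
    using nn[of t] nn[of "1-t"]
    by (cases "t > 0") (auto simp: exp_cutoff_def intro: add_pos_nonneg add_nonneg_pos)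
  have s1: "smooth_on UNIV (\<lambda>t::real. 1 - t)"
    using smooth_on_add[OF open_UNIV smooth_on_const[of _ 1] smooth_on_bounded_linear[OF bounded_linear_minus[OF bounded_linear_ident] open_UNIV smooth_on_ident]]
    by simp
  have s: "smooth_on UNIV (\<lambda>t. ?e t + ?e (1 - t))"
    by (intro smooth_on_add smooth_on_exp_cutoff open_UNIV smooth_on_compose[OF open_UNIV open_UNIV _ s1]) auto
  have o: "open {x::real. x \<noteq> 0}" by (simp add: open_Collect_neq continuous_on_const continuous_on_id)
  have "smooth_on UNIV (\<lambda>t. inverse (?e t + ?e (1 - t)))"
    by (rule smooth_on_compose[OF open_UNIV o _ s smooth_on_inverse]) (use pos in \<open>auto simp: less_imp_neq[THEN not_sym]\<close>)
  then have "smooth_on UNIV \<sigma>"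
    unfolding \<sigma>_def by (intro smooth_on_mult smooth_on_exp_cutoff open_UNIV)
  moreover have "0 \<le> \<sigma> t \<and> \<sigma> t \<le> 1" for t
    using nn[of t] nn[of "1-t"] pos[of t] by (auto simp: \<sigma>_def field_simps)
  moreover have "\<forall>t\<le>0. \<sigma> t = 0" "\<forall>t\<ge>1. \<sigma> t = 1" by (auto simp: \<sigma>_def exp_cutoff_def)
  ultimately show ?thesis by (intro that) auto
qed

lemma smooth_on_prod:
  fixes f :: "'i \<Rightarrow> 'a::euclidean_space \<Rightarrow> real"
  assumes "open S" "\<And>i. i \<in> I \<Longrightarrow> smooth_on S (f i)"
  shows "smooth_on S (\<lambda>x. \<Prod>i\<in>I. f i x)"
  using assms(2)
  by (induction I rule: infinite_finite_induct) (auto simp: smooth_on_const intro: smooth_on_mult[OF assms(1)])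

text \<open>Finitely many bumps centred in \<open>K\<close> are combined as 1 minus the product of
  the (1 - bump), which is 1 as soon as one bump is 1 and vanishes where all bumps vanish.\<close>

lemma smooth_urysohn:
  fixes K U :: "'a::euclidean_space set"
  assumes "compact K" "open U" "K \<subseteq> U"
  obtains \<psi> C where "smooth_on UNIV (\<psi> :: 'a \<Rightarrow> real)" "\<forall>x\<in>K. \<psi> x = 1"
    "compact C" "C \<subseteq> U" "\<forall>x. x \<notin> C \<longrightarrow> \<psi> x = 0" "\<forall>x. 0 \<le> \<psi> x \<and> \<psi> x \<le> 1"
proof -
  obtain \<sigma> :: "real \<Rightarrow> real" where \<sigma>: "smooth_on UNIV \<sigma>"
    and \<sigma>b: "\<forall>t. 0 \<le> \<sigma> t \<and> \<sigma> t \<le> 1" and "\<forall>t\<le>0. \<sigma> t = 0" "\<forall>t\<ge>1. \<sigma> t = 1"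
    by (rule smooth_step)
  then have \<sigma>0: "\<And>t. t \<le> 0 \<Longrightarrow> \<sigma> t = 0" and \<sigma>1: "\<And>t. t \<ge> 1 \<Longrightarrow> \<sigma> t = 1" by auto
  have "\<exists>r>0. cball x (2 * r) \<subseteq> U" if "x \<in> K" for x
  proof -
    have "x \<in> U" using that assms(3) by auto
    then obtain e where "e > 0" "cball x e \<subseteq> U"
      using assms(2)[unfolded open_contains_cball, rule_format, of x] by auto
    then show ?thesis by (intro exI[of _ "e/2"]) simp
  qed
  then have "\<forall>x\<in>K. \<exists>r>0. cball x (2 * r) \<subseteq> U" by simp
  then obtain r where "\<forall>x\<in>K. r x > 0 \<and> cball x (2 * r x) \<subseteq> U" unfolding bchoice_iff by (elim exE)
  then have r: "\<And>x. x \<in> K \<Longrightarrow> r x > 0" "\<And>x. x \<in> K \<Longrightarrow> cball x (2 * r x) \<subseteq> U" by auto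
  obtain F where F: "finite F" "F \<subseteq> K" "K \<subseteq> (\<Union>x\<in>F. ball x (r x))"
  proof (rule compactE_image[of K K "\<lambda>x. ball x (r x)"])
    show "K \<subseteq> (\<Union>x\<in>K. ball x (r x))" using r by force
  qed (use assms in auto)
  \<comment> \<open>The squared norm keeps \<open>f z\<close> smooth at its centre. The value is at
    least 1 on the ball of radius \<open>r z\<close> and negative off the ball of twice that radius,
    which lies in \<open>U\<close>.\<close>
  define f where "f z x = 2 - (norm (x - z))\<^sup>2 / (r z)\<^sup>2" for z x :: 'a
  have "smooth_on UNIV (\<lambda>x. (x - z) \<bullet> (x - z))" for z :: 'a
    using smooth_on_add[OF open_UNIV smooth_on_ident[of "UNIV::'a set"] smooth_on_const[of _ "-z"]]
    by (intro smooth_on_bilinear[OF bounded_bilinear_inner]) auto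
  then have "smooth_on UNIV (\<lambda>x. 2 + (- (1 / (r z)\<^sup>2)) * ((x - z) \<bullet> (x - z)))" for z :: 'a
    by (intro smooth_on_add[OF open_UNIV smooth_on_const] smooth_on_bounded_linear[OF bounded_linear_mult_right]) auto
  then have f: "smooth_on UNIV (f z)" for z
    by (simp add: f_def[abs_def] power2_norm_eq_inner)
  have \<sigma>f: "smooth_on UNIV (\<lambda>x. 1 - \<sigma> (f z x))" for z
    using smooth_on_add[OF open_UNIV smooth_on_const[of _ "1::real"]
        smooth_on_bounded_linear[OF bounded_linear_minus[OF bounded_linear_ident] open_UNIV
        smooth_on_compose[OF open_UNIV open_UNIV _ f \<sigma>]]] by simp
  define \<psi> where "\<psi> x = 1 - (\<Prod>z\<in>F. 1 - \<sigma> (f z x))" for x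
  have "smooth_on UNIV \<psi>"
    using smooth_on_add[OF open_UNIV smooth_on_const[of _ "1::real"]
        smooth_on_bounded_linear[OF bounded_linear_minus[OF bounded_linear_ident] open_UNIV
        smooth_on_prod[OF open_UNIV \<sigma>f]]] by (simp add: \<psi>_def[abs_def])
  moreover have "\<psi> x = 1" if xK: "x \<in> K" for x
  proof -
    obtain z where z: "z \<in> F" "dist z x < r z" using F xK by auto
    have "(norm (x - z))\<^sup>2 / (r z)\<^sup>2 \<le> 1"
      using z F r(1)[of z] by (auto simp: dist_norm norm_minus_commute intro!: power_mono)
    then have "\<sigma> (f z x) = 1" by (intro \<sigma>1) (auto simp: f_def)
    then show ?thesis using z F by (auto simp: \<psi>_def)
  qed
  moreover have "compact (\<Union>z\<in>F. cball z (2 * r z))" using F by (intro compact_UN) auto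
  moreover have "(\<Union>z\<in>F. cball z (2 * r z)) \<subseteq> U" using F r by blast
  moreover have "\<psi> x = 0" if "x \<notin> (\<Union>z\<in>F. cball z (2 * r z))" for x
  proof -
    have "\<sigma> (f z x) = 0" if zF: "z \<in> F" for z
    proof -
      have "2 * r z \<le> norm (x - z)" "0 < r z" using zF \<open>x \<notin> _\<close> F r by (auto simp: dist_norm norm_minus_commute)
      then have "4 * (r z)\<^sup>2 \<le> (norm (x - z))\<^sup>2" using power_mono[of "2 * r z" "norm (x-z)" 2] by simp
      moreover have "0 < (r z)\<^sup>2" using \<open>0 < r z\<close> by simp
      ultimately have "2 * (r z)\<^sup>2 \<le> (norm (x - z))\<^sup>2" by linarith
      then have "f z x \<le> 0" using \<open>0 < r z\<close> by (simp add: f_def field_simps)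
      then show ?thesis by (rule \<sigma>0)
    qed
    then show ?thesis by (simp add: \<psi>_def)
  qed
  moreover have "0 \<le> (\<Prod>z\<in>F. 1 - \<sigma> (f z x))" "(\<Prod>z\<in>F. 1 - \<sigma> (f z x)) \<le> 1" for x
    using \<sigma>b by (auto intro!: prod_nonneg prod_le_1)
  then have "\<forall>x. 0 \<le> \<psi> x \<and> \<psi> x \<le> 1" by (simp add: \<psi>_def)
  ultimately show ?thesis by (intro that) auto
qed

section \<open>The Fourier transform of integrable functions\<close>

lemma borel_measurable_cis [measurable]: "cis \<in> borel_measurable borel"
  by (intro borel_measurable_continuous_onI continuous_on_cis continuous_on_id)

lemma borel_measurable_cnj [measurable]: "cnj \<in> borel_measurable borel"
  by (intro borel_measurable_continuous_onI continuous_on_cnj continuous_on_id)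

lemma borel_measurable_fourier [measurable]:
  assumes [measurable]: "f \<in> borel_measurable borel"
  shows "fourier f \<in> borel_measurable borel"
  unfolding fourier_def[abs_def] by measurable

lemma integrable_lborel_measurable [dest]: "integrable lborel f \<Longrightarrow> f \<in> borel_measurable borel"
  using borel_measurable_integrable by fastforce

lemma integrable_cis_mult:
  assumes "integrable lborel f" "g \<in> borel_measurable borel"
  shows "integrable lborel (\<lambda>x. cis (g x) * f x)"
  using assms(1)
  by (rule Bochner_Integration.integrable_bound)
    (use assms in \<open>auto simp: norm_mult dest: borel_measurable_integrable\<close>)

lemma norm_fourier_le: "norm (fourier f \<xi>) \<le> (\<integral>x. norm (f x) \<partial>lborel)"
  unfolding fourier_def by (rule order_trans[OF integral_norm_bound]) (simp add: norm_mult)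

text \<open>The hypothesis of Fubini's theorem in the shape that recurs below: a bounded oscillating
  factor \<open>b\<close> against a product of two integrable functions.\<close>

lemma integrable_pair_bounded:
  fixes f k :: "'a::euclidean_space \<Rightarrow> complex" and b :: "'a \<times> 'a \<Rightarrow> complex"
  assumes f: "integrable lborel f" and k: "integrable lborel k"
    and b: "b \<in> borel_measurable borel" "\<And>p. norm (b p) \<le> B"
  shows "integrable (lborel \<Otimes>\<^sub>M lborel) (\<lambda>(x, y). b (x, y) * (f x * k y))"
proof -
  have [measurable]: "f \<in> borel_measurable borel" "k \<in> borel_measurable borel"
    using f k by auto
  have bm: "b \<in> borel_measurable (borel \<Otimes>\<^sub>M borel)" using b(1) by (simp add: borel_prod)
  have fk: "integrable (lborel \<Otimes>\<^sub>M lborel) (\<lambda>(x, y). f x * k y)"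
    by (rule lborel_pair.Fubini_integrable) (use f k in \<open>auto simp: norm_mult\<close>)
  have "integrable (lborel \<Otimes>\<^sub>M lborel) (\<lambda>p. B *\<^sub>R (case p of (x, y) \<Rightarrow> f x * k y))"
    using fk by (rule integrable_scaleR_right)
  then show ?thesis
  proof (rule Bochner_Integration.integrable_bound)
    show "(\<lambda>(x, y). b (x, y) * (f x * k y)) \<in> borel_measurable (lborel \<Otimes>\<^sub>M lborel)"
      using bm by (simp add: case_prod_beta' del: borel_prod) measurable
    show "AE p in lborel \<Otimes>\<^sub>M lborel. norm (case p of (x, y) \<Rightarrow> b (x, y) * (f x * k y))
        \<le> norm (B *\<^sub>R (case p of (x, y) \<Rightarrow> f x * k y))"
    proof (intro AE_I2)
      fix p :: "'a \<times> 'a"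
      show "norm (case p of (x, y) \<Rightarrow> b (x, y) * (f x * k y)) \<le> norm (B *\<^sub>R (case p of (x, y) \<Rightarrow> f x * k y))"
        using b(2)[of p] by (auto simp: case_prod_beta' norm_mult intro!: mult_right_mono order_trans[OF _ abs_ge_self])
    qed
  qed
qed

lemma Fubini_bounded:
  fixes f k :: "'a::euclidean_space \<Rightarrow> complex" and b :: "'a \<times> 'a \<Rightarrow> complex"
  assumes "integrable lborel f" "integrable lborel k"
    "b \<in> borel_measurable borel" "\<And>p. norm (b p) \<le> B"
  shows "(\<integral>y. (\<integral>x. b (x, y) * (f x * k y) \<partial>lborel) \<partial>lborel) = (\<integral>x. (\<integral>y. b (x, y) * (f x * k y) \<partial>lborel) \<partial>lborel)"
  by (rule lborel_pair.Fubini_integral) (rule integrable_pair_bounded[OF assms])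

text \<open>Fubini with a symmetric kernel. Since the Fourier transform of a distribution is defined
  by duality, this is what identifies it with the integral formula.\<close>

lemma fourier_multiplication_formula:
  assumes f: "integrable lborel f" and k: "integrable lborel k"
  shows "(\<integral>y. fourier f y * k y \<partial>lborel) = (\<integral>x. f x * fourier k x \<partial>lborel)"
proof -
  have "(\<integral>y. fourier f y * k y \<partial>lborel) = (\<integral>y. (\<integral>x. cis (- (fst (x, y) \<bullet> snd (x, y))) * (f x * k y) \<partial>lborel) \<partial>lborel)"
    unfolding fourier_def by (simp add: mult.assoc flip: integral_mult_left_zero)
  also have "\<dots> = (\<integral>x. (\<integral>y. cis (- (fst (x, y) \<bullet> snd (x, y))) * (f x * k y) \<partial>lborel) \<partial>lborel)"
    by (rule Fubini_bounded[OF f k, where B=1]) (auto simp: borel_prod[symmetric])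
  also have "\<dots> = (\<integral>x. f x * fourier k x \<partial>lborel)"
    unfolding fourier_def by (simp add: mult.left_commute inner_commute flip: integral_mult_right_zero)
  finally show ?thesis .
qed

section \<open>Affine substitutions and integrands of product form\<close>

lemma nn_integral_lborel_affine:
  fixes c :: real and t :: "'a::euclidean_space"
  assumes [measurable]: "f \<in> borel_measurable borel" and c: "c \<noteq> 0"
  shows "(\<integral>\<^sup>+x. f x \<partial>lborel) = ennreal (\<bar>c\<bar> ^ DIM('a)) * (\<integral>\<^sup>+x. f (t + c *\<^sub>R x) \<partial>lborel)"
  by (subst lborel_affine[OF c, of t])
    (simp add: nn_integral_density nn_integral_distr nn_integral_cmult)

lemma integrable_lborel_affine:
  fixes f :: "'a::euclidean_space \<Rightarrow> 'b::{banach, second_countable_topology}"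
  assumes f: "integrable lborel f" and c: "c \<noteq> 0"
  shows "integrable lborel (\<lambda>x. f (t + c *\<^sub>R x))"
proof -
  have [measurable]: "f \<in> borel_measurable borel" using f by auto
  have "ennreal (\<bar>c\<bar> ^ DIM('a)) * (\<integral>\<^sup>+x. norm (f (t + c *\<^sub>R x)) \<partial>lborel) < \<infinity>"
    using f c by (subst nn_integral_lborel_affine[symmetric]) (auto simp: integrable_iff_bounded)
  moreover have "\<not> \<bar>c\<bar> ^ DIM('a) \<le> 0" using c by (simp add: not_le)
  ultimately show ?thesis
    by (auto simp: integrable_iff_bounded ennreal_mult_less_top ennreal_eq_0_iff)
qed

lemma integral_lborel_affine:
  fixes f :: "'a::euclidean_space \<Rightarrow> 'b::{banach, second_countable_topology}"
  assumes f: "integrable lborel f" and c: "c \<noteq> 0"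
  shows "(\<integral>x. f x \<partial>lborel) = \<bar>c\<bar> ^ DIM('a) *\<^sub>R (\<integral>x. f (t + c *\<^sub>R x) \<partial>lborel)"
proof -
  have [measurable]: "f \<in> borel_measurable borel" using f by auto
  show ?thesis
    by (subst lborel_affine[OF c, of t]) (simp add: integral_density integral_distr)
qed

text \<open>Transport to a product of one-dimensional Lebesgue measures. It reduces Gaussians and
  powers of the Japanese bracket to one real variable.\<close>

lemma
  fixes f :: "'a::euclidean_space \<Rightarrow> real \<Rightarrow> 'c::{real_normed_field, banach, second_countable_topology}"
  assumes "\<And>b. b \<in> Basis \<Longrightarrow> integrable lborel (f b)"
  shows integrable_lborel_prod: "integrable lborel (\<lambda>x. \<Prod>b\<in>Basis. f b (x \<bullet> b))"
    and integral_lborel_prod: "(\<integral>x. (\<Prod>b\<in>Basis. f b (x \<bullet> b)) \<partial>lborel) = (\<Prod>b\<in>Basis. \<integral>x. f b x \<partial>lborel)"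
proof -
  interpret product_sigma_finite "\<lambda>_::'a. lborel :: real measure" ..
  have [measurable]: "f b \<in> borel_measurable borel" if "b \<in> Basis" for b
    using assms[OF that] by auto
  have eq: "(\<Prod>b\<in>Basis. f b ((\<Sum>b\<in>Basis. g b *\<^sub>R b) \<bullet> b)) = (\<Prod>b\<in>Basis. f b (g b))" for g
    by (intro prod.cong) auto
  have m: "(\<lambda>f. \<Sum>b\<in>Basis. f b *\<^sub>R b) \<in> (\<Pi>\<^sub>M b\<in>Basis. lborel) \<rightarrow>\<^sub>M (borel :: 'a measure)"
    by measurable
  have m2: "(\<lambda>x. \<Prod>b\<in>Basis. f b (x \<bullet> b)) \<in> borel_measurable borel"
    by measurable
  show "integrable lborel (\<lambda>x. \<Prod>b\<in>Basis. f b (x \<bullet> b))"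
    unfolding lborel_eq[where 'a='a] integrable_distr_eq[OF m m2] eq
    by (intro product_integrable_prod assms) auto
  show "(\<integral>x. (\<Prod>b\<in>Basis. f b (x \<bullet> b)) \<partial>lborel) = (\<Prod>b\<in>Basis. \<integral>x. f b x \<partial>lborel)"
    unfolding lborel_eq[where 'a='a] integral_distr[OF m m2] eq
    by (intro product_integral_prod assms) auto
qed

subsection \<open>Gaussians\<close>

definition gauss :: "real \<Rightarrow> 'a::euclidean_space \<Rightarrow> real" where
  "gauss e x = exp (- (e\<^sup>2 * (x \<bullet> x) / 2))"

text \<open>The Fourier transform of \<open>gauss e\<close> without normalization. Its total mass is
  (2 pi)^n for every \<open>e\<close>, which is the constant in Bessel's inequality and in the
  inversion formula.\<close>

definition gauss_hat :: "real \<Rightarrow> 'a::euclidean_space \<Rightarrow> real" where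
  "gauss_hat e x = (sqrt (2 * pi) / e) ^ DIM('a) * gauss (1 / e) x"

lemma borel_measurable_gauss [measurable]: "gauss e \<in> borel_measurable borel"
  unfolding gauss_def[abs_def] by measurable

lemma borel_measurable_gauss_hat [measurable]:
  "(gauss_hat e :: 'a::euclidean_space \<Rightarrow> real) \<in> borel_measurable borel"
  unfolding gauss_hat_def[abs_def] by measurable

lemma gauss_bounds: "0 < gauss e x" "gauss e x \<le> 1"
  by (auto simp: gauss_def)

lemma gauss_nonneg [simp]: "0 \<le> gauss e x" and gauss_le_1 [simp]: "gauss e x \<le> 1"
  by (auto simp: gauss_def)

lemma gauss_hat_nonneg: "e > 0 \<Longrightarrow> 0 \<le> gauss_hat e x"
  unfolding gauss_hat_def using gauss_bounds(1)[of "1/e" x] by (intro mult_nonneg_nonneg) auto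

lemma norm_gauss_hat_le:
  fixes x :: "'a::euclidean_space"
  assumes "e > 0"
  shows "norm (complex_of_real (gauss_hat e x)) \<le> (sqrt (2 * pi) / e) ^ DIM('a)"
proof -
  have "norm (complex_of_real (gauss_hat e x)) = gauss_hat e x"
    using gauss_hat_nonneg[OF assms, of x] by simp
  also have "\<dots> \<le> (sqrt (2 * pi) / e) ^ DIM('a)"
    unfolding gauss_hat_def using assms by (intro mult_left_le zero_le_power) auto
  finally show ?thesis .
qed

lemma gauss_eq_prod: "gauss e x = (\<Prod>b\<in>Basis. exp (- (e\<^sup>2 * (x \<bullet> b)\<^sup>2 / 2)))"
proof -
  have "x \<bullet> x = (\<Sum>b\<in>Basis. (x \<bullet> b)\<^sup>2)"
    by (subst euclidean_inner) (simp add: power2_eq_square)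
  then show ?thesis
    unfolding gauss_def by (simp add: exp_sum[symmetric] sum_negf sum_distrib_left sum_divide_distrib)
qed

text \<open>The integral is the characteristic function of the standard normal distribution,
  rescaled by \<open>e\<close>.\<close>

lemma gauss_real_fourier:
  fixes e t :: real assumes "e > 0"
  shows "integrable lborel (\<lambda>x. complex_of_real (exp (- (e\<^sup>2 * x\<^sup>2 / 2))))"
    and "(\<integral>x. cis (- (x * t)) * complex_of_real (exp (- (e\<^sup>2 * x\<^sup>2 / 2))) \<partial>lborel) =
      complex_of_real (sqrt (2 * pi) / e * exp (- ((1 / e)\<^sup>2 * t\<^sup>2 / 2)))"
proof -
  have n: "std_normal_density x = exp (- (x\<^sup>2 / 2)) / sqrt (2 * pi)" for x
    by (simp add: std_normal_density_def)
  have i0: "integrable lborel (\<lambda>x. complex_of_real (std_normal_density x))"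
    using integrable_normal_density[of 1 0] by (intro integrable_of_real) simp
  have i1: "integrable lborel (\<lambda>x. complex_of_real (exp (- (x\<^sup>2 / 2))))"
    using integrable_mult_right[OF i0, of "complex_of_real (sqrt (2 * pi))"] by (simp add: n)
  have "integrable lborel (\<lambda>x. complex_of_real (exp (- ((0 + e * x)\<^sup>2 / 2))))"
    using lborel_integrable_real_affine[OF i1, of e 0] assms by simp
  then show "integrable lborel (\<lambda>x. complex_of_real (exp (- (e\<^sup>2 * x\<^sup>2 / 2))))"
    by (simp add: power_mult_distrib)
  have c: "(\<integral>x. cis (s * x) * complex_of_real (exp (- (x\<^sup>2 / 2))) \<partial>lborel) = complex_of_real (sqrt (2 * pi) * exp (- (s\<^sup>2 / 2)))" for s
  proof -
    have "complex_of_real (exp (- (s\<^sup>2 / 2))) = char std_normal_distribution s"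
      by (simp add: char_std_normal_distribution)
    also have "\<dots> = (\<integral>x. std_normal_density x *\<^sub>R iexp (s * x) \<partial>lborel)"
      unfolding char_def by (subst integral_density) (auto simp: normal_density_nonneg)
    also have "\<dots> = (\<integral>x. (cis (s * x) * complex_of_real (exp (- (x\<^sup>2 / 2)))) / complex_of_real (sqrt (2 * pi)) \<partial>lborel)"
      by (intro Bochner_Integration.integral_cong) (auto simp: n scaleR_conv_of_real cis_conv_exp)
    finally show ?thesis by (simp add: field_simps)
  qed
  have "(\<integral>x. cis (- (t / e) * x) * complex_of_real (exp (- (x\<^sup>2 / 2))) \<partial>lborel) =
     \<bar>e\<bar> *\<^sub>R (\<integral>x. cis (- (t / e) * (0 + e * x)) * complex_of_real (exp (- ((0 + e * x)\<^sup>2 / 2))) \<partial>lborel)"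
    using assms by (intro lborel_integral_real_affine) auto
  then have "complex_of_real (sqrt (2 * pi) * exp (- ((t / e)\<^sup>2 / 2))) =
     e *\<^sub>R (\<integral>x. cis (- (x * t)) * complex_of_real (exp (- (e\<^sup>2 * x\<^sup>2 / 2))) \<partial>lborel)"
    using assms unfolding c by (simp add: power_mult_distrib mult.commute)
  then show "(\<integral>x. cis (- (x * t)) * complex_of_real (exp (- (e\<^sup>2 * x\<^sup>2 / 2))) \<partial>lborel) =
      complex_of_real (sqrt (2 * pi) / e * exp (- ((1 / e)\<^sup>2 * t\<^sup>2 / 2)))"
    using assms by (simp add: scaleR_conv_of_real field_simps power_divide)
qed

lemma integrable_gauss:
  assumes "e > 0"
  shows "integrable lborel (\<lambda>x::'a::euclidean_space. complex_of_real (gauss e x))"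
  using integrable_lborel_prod[OF gauss_real_fourier(1)[OF assms], where 'a='a]
  by (simp add: gauss_eq_prod)

lemma fourier_gauss:
  fixes x :: "'a::euclidean_space"
  assumes "e > 0"
  shows "fourier (\<lambda>x. complex_of_real (gauss e x)) x = complex_of_real (gauss_hat e x)"
proof -
  have cp: "cis (- (y \<bullet> x)) = (\<Prod>b\<in>Basis. cis (- ((y \<bullet> b) * (x \<bullet> b))))" for y :: 'a
    by (subst euclidean_inner) (simp add: cis_conv_exp exp_sum[symmetric] sum_negf sum_distrib_left)
  have "fourier (\<lambda>x. complex_of_real (gauss e x)) x =
    (\<integral>y. (\<Prod>b\<in>Basis. cis (- ((y \<bullet> b) * (x \<bullet> b))) * complex_of_real (exp (- (e\<^sup>2 * (y \<bullet> b)\<^sup>2 / 2)))) \<partial>lborel)"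
    unfolding fourier_def gauss_eq_prod cp by (simp add: prod.distrib)
  also have "\<dots> = (\<Prod>b\<in>Basis. \<integral>y. cis (- (y * (x \<bullet> b))) * complex_of_real (exp (- (e\<^sup>2 * y\<^sup>2 / 2))) \<partial>lborel)"
    by (intro integral_lborel_prod integrable_cis_mult gauss_real_fourier(1) assms) measurable
  also have "\<dots> = complex_of_real (gauss_hat e x)"
    using assms by (simp add: gauss_real_fourier(2) gauss_hat_def gauss_eq_prod prod.distrib prod_dividef power_divide)
  finally show ?thesis .
qed

lemma integrable_gauss_hat:
  assumes "e > 0"
  shows "integrable lborel (\<lambda>x::'a::euclidean_space. complex_of_real (gauss_hat e x))"
  using integrable_gauss[of "1/e", where 'a='a] assms by (auto simp: gauss_hat_def)

lemma integral_gauss_hat: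
  assumes "e > 0"
  shows "(\<integral>x. complex_of_real (gauss_hat e (x::'a::euclidean_space)) \<partial>lborel) = complex_of_real ((2 * pi) ^ DIM('a))"
proof -
  have "(\<integral>x. complex_of_real (gauss (1/e) (x::'a)) \<partial>lborel) = fourier (\<lambda>x. complex_of_real (gauss (1/e) x)) (0::'a)"
    by (simp add: fourier_def)
  also have "\<dots> = complex_of_real ((sqrt (2 * pi) * e) ^ DIM('a))"
    using assms by (subst fourier_gauss) (auto simp: gauss_hat_def gauss_def)
  finally have "(\<integral>x. complex_of_real (gauss_hat e (x::'a)) \<partial>lborel) =
     complex_of_real ((sqrt (2 * pi) / e) ^ DIM('a) * (sqrt (2 * pi) * e) ^ DIM('a))"
    by (simp add: gauss_hat_def)
  also have "(sqrt (2 * pi) / e) ^ DIM('a) * (sqrt (2 * pi) * e) ^ DIM('a) = (sqrt (2 * pi) / e * (sqrt (2 * pi) * e)) ^ DIM('a)"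
    by (rule power_mult_distrib[symmetric])
  also have "sqrt (2 * pi) / e * (sqrt (2 * pi) * e) = 2 * pi" using assms by simp
  finally show ?thesis .
qed

lemma nn_integral_gauss_hat:
  assumes "e > 0"
  shows "(\<integral>\<^sup>+y. ennreal (gauss_hat e (y::'a::euclidean_space)) \<partial>lborel) = ennreal ((2 * pi) ^ DIM('a))"
proof -
  have i: "integrable lborel (gauss_hat e :: 'a \<Rightarrow> real)"
    using integrable_Re[OF integrable_gauss_hat[OF assms, where 'a='a]] by simp
  have "(\<integral>\<^sup>+y. ennreal (gauss_hat e (y::'a)) \<partial>lborel) = ennreal (\<integral>y. gauss_hat e (y::'a) \<partial>lborel)"
    using i by (intro nn_integral_eq_integral) (auto simp: gauss_hat_nonneg assms)
  also have "complex_of_real (\<integral>y. gauss_hat e (y::'a) \<partial>lborel) = complex_of_real ((2 * pi) ^ DIM('a))"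
    using integral_gauss_hat[OF assms, where 'a='a] by (simp only: integral_complex_of_real)
  then have "(\<integral>y. gauss_hat e (y::'a) \<partial>lborel) = (2 * pi) ^ DIM('a)" by (simp only: of_real_eq_iff)
  finally show ?thesis .
qed

lemma gauss_tendsto_1: "(\<lambda>n. gauss (1 / real (Suc n)) x) \<longlonglongrightarrow> 1"
proof -
  have "(\<lambda>n. exp (- ((1 / real (Suc n))\<^sup>2 * (x \<bullet> x) / 2))) \<longlonglongrightarrow> exp (- (0\<^sup>2 * (x \<bullet> x) / 2))"
    using LIMSEQ_inverse_real_of_nat by (intro tendsto_intros) (simp_all add: inverse_eq_divide)
  then show ?thesis by (simp add: gauss_def)
qed

subsection \<open>Bessel's inequality and Fourier inversion\<close>

lemma fourier_translate:
  "fourier (\<lambda>\<xi>. cis (y \<bullet> \<xi>) * g \<xi>) x = fourier g (x - y)"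
  unfolding fourier_def
  by (intro Bochner_Integration.integral_cong)
    (auto simp: inner_diff_right inner_commute cis_mult mult.assoc[symmetric])

lemma fourier_cnj: "cnj (fourier f \<xi>) = (\<integral>x. cis (x \<bullet> \<xi>) * cnj (f x) \<partial>lborel)"
  unfolding fourier_def by (subst Bochner_Integration.integral_cnj[symmetric]) (simp add: cis_cnj)

text \<open>Gaussian damping makes the conjugate of \<open>fourier f\<close> integrable, so Fubini
  applies and produces a convolution with \<open>gauss_hat e\<close>. Fed into the multiplication
  formula, this turns the integral of the damped square of \<open>fourier f\<close> into a double
  integral in \<open>f\<close>.\<close>

lemma fourier_gauss_cnj_fourier:
  fixes f :: "'a::euclidean_space \<Rightarrow> complex"
  assumes f: "integrable lborel f" and e: "e > 0"
  shows "fourier (\<lambda>\<xi>. complex_of_real (gauss e \<xi>) * cnj (fourier f \<xi>)) x =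
    (\<integral>y. cnj (f y) * complex_of_real (gauss_hat e (x - y)) \<partial>lborel)"
proof -
  have cf: "integrable lborel (\<lambda>y. cnj (f y))" using f by (simp add: integrable_cnj)
  have eq: "cis (fst (y, \<xi>) \<bullet> snd (y, \<xi>) - snd (y, \<xi>) \<bullet> x) * (cnj (f y) * complex_of_real (gauss e \<xi>)) =
    (cis (- (\<xi> \<bullet> x)) * complex_of_real (gauss e \<xi>)) * (cis (y \<bullet> \<xi>) * cnj (f y))" for y \<xi>
    using cis_mult[of "- (\<xi> \<bullet> x)" "y \<bullet> \<xi>"] by (simp add: algebra_simps)
  have "fourier (\<lambda>\<xi>. complex_of_real (gauss e \<xi>) * cnj (fourier f \<xi>)) x =
    (\<integral>\<xi>. (\<integral>y. cis (fst (y, \<xi>) \<bullet> snd (y, \<xi>) - snd (y, \<xi>) \<bullet> x) * (cnj (f y) * complex_of_real (gauss e \<xi>)) \<partial>lborel) \<partial>lborel)"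
    unfolding fourier_cnj fourier_def[of "\<lambda>\<xi>. complex_of_real (gauss e \<xi>) * _ \<xi>"] eq integral_mult_right_zero
    by (simp add: mult.assoc)
  also have "\<dots> = (\<integral>y. (\<integral>\<xi>. cis (fst (y, \<xi>) \<bullet> snd (y, \<xi>) - snd (y, \<xi>) \<bullet> x) * (cnj (f y) * complex_of_real (gauss e \<xi>)) \<partial>lborel) \<partial>lborel)"
    by (rule Fubini_bounded[OF cf integrable_gauss[OF e], where B=1]) (auto simp: borel_prod[symmetric])
  also have "\<dots> = (\<integral>y. cnj (f y) * fourier (\<lambda>\<xi>. cis (y \<bullet> \<xi>) * complex_of_real (gauss e \<xi>)) x \<partial>lborel)"
    unfolding fourier_def eq by (simp add: ac_simps flip: integral_mult_right_zero)
  finally show ?thesis by (simp add: fourier_translate fourier_gauss[OF e])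
qed

text \<open>Fatou's lemma along e = 1/(n+1), where the Gaussians tend to 1 pointwise.\<close>

lemma nn_integral_le_gauss_limit:
  fixes u :: "'a::euclidean_space \<Rightarrow> ennreal"
  assumes [measurable]: "u \<in> borel_measurable borel"
    and "\<And>e. e > 0 \<Longrightarrow> (\<integral>\<^sup>+x. u x * ennreal (gauss e x) \<partial>lborel) \<le> C"
  shows "(\<integral>\<^sup>+x. u x \<partial>lborel) \<le> C"
proof -
  have "(\<integral>\<^sup>+x. u x \<partial>lborel) = (\<integral>\<^sup>+x. liminf (\<lambda>n. u x * ennreal (gauss (1 / real (Suc n)) x)) \<partial>lborel)"
  proof (intro nn_integral_cong)
    fix x
    have "(\<lambda>n. u x * ennreal (gauss (1 / real (Suc n)) x)) \<longlonglongrightarrow> u x * ennreal 1"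
      by (intro tendsto_mult_ennreal tendsto_const tendsto_ennrealI gauss_tendsto_1) simp
    then show "u x = liminf (\<lambda>n. u x * ennreal (gauss (1 / real (Suc n)) x))"
      by (simp add: lim_imp_Liminf)
  qed
  also have "\<dots> \<le> liminf (\<lambda>n. \<integral>\<^sup>+x. u x * ennreal (gauss (1 / real (Suc n)) x) \<partial>lborel)"
    by (intro nn_integral_liminf) measurable
  also have "\<dots> \<le> liminf (\<lambda>n::nat. C)"
    by (intro Liminf_mono always_eventually allI assms) simp
  finally show ?thesis by (simp add: Liminf_const)
qed

lemma ennreal_mult_le_half_squares:
  assumes "0 \<le> a" "0 \<le> b"
  shows "ennreal (a * b) \<le> ennreal (a\<^sup>2 / 2) + ennreal (b\<^sup>2 / 2)"
proof -
  have "a * b \<le> a\<^sup>2 / 2 + b\<^sup>2 / 2"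
    using zero_le_power2[of "a - b"] by (simp add: power2_diff)
  then have "ennreal (a * b) \<le> ennreal (a\<^sup>2 / 2 + b\<^sup>2 / 2)" by (rule ennreal_leI)
  then show ?thesis by (simp add: ennreal_plus)
qed

text \<open>By u(x) u(y) <= u(x)^2/2 + u(y)^2/2 the form splits into two equal halves. In each half
  the kernel is integrated in one variable only, which by translation and reflection invariance
  gives the mass of \<open>k\<close>.\<close>

lemma schur_le:
  fixes u v :: "'a::euclidean_space \<Rightarrow> real" and k :: "'a \<Rightarrow> real"
  assumes [measurable]: "u \<in> borel_measurable borel" "k \<in> borel_measurable borel"
    and u: "\<And>x. u x \<ge> 0" and k: "\<And>x. k x \<ge> 0"
    and C: "(\<integral>\<^sup>+z. ennreal (k z) \<partial>lborel) \<le> C"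
  shows "(\<integral>\<^sup>+x. (\<integral>\<^sup>+y. ennreal (u x * u y * k (x - y)) \<partial>lborel) \<partial>lborel) \<le> C * (\<integral>\<^sup>+x. ennreal ((u x)\<^sup>2) \<partial>lborel)"
proof -
  have sh: "(\<integral>\<^sup>+y. ennreal (k (x - y)) \<partial>lborel) = (\<integral>\<^sup>+z. ennreal (k z) \<partial>lborel)" for x
    by (subst (2) nn_integral_lborel_affine[of _ "-1" x]) (auto simp: one_ennreal_def[symmetric])
  have sh2: "(\<integral>\<^sup>+x. ennreal (k (x - y)) \<partial>lborel) = (\<integral>\<^sup>+z. ennreal (k z) \<partial>lborel)" for y
    by (subst (2) nn_integral_lborel_affine[of _ 1 "-y"]) (auto simp: one_ennreal_def[symmetric])
  let ?U = "\<lambda>x. ennreal ((u x)\<^sup>2 / 2)" and ?K = "\<lambda>x. ennreal (k x)"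
  have "(\<integral>\<^sup>+x. (\<integral>\<^sup>+y. ennreal (u x * u y * k (x - y)) \<partial>lborel) \<partial>lborel) \<le>
     (\<integral>\<^sup>+x. (\<integral>\<^sup>+y. ?U x * ?K (x - y) + ?U y * ?K (x - y) \<partial>lborel) \<partial>lborel)"
  proof (intro nn_integral_mono)
    fix x y
    have "ennreal (u x * u y * k (x - y)) = ennreal (u x * u y) * ?K (x - y)"
      using u k by (simp add: ennreal_mult)
    also have "\<dots> \<le> (?U x + ?U y) * ?K (x - y)"
      using u by (intro mult_right_mono ennreal_mult_le_half_squares) auto
    finally show "ennreal (u x * u y * k (x - y)) \<le> ?U x * ?K (x - y) + ?U y * ?K (x - y)"
      by (simp add: distrib_right)
  qed
  also have "\<dots> = (\<integral>\<^sup>+x. (\<integral>\<^sup>+y. ?U x * ?K (x - y) \<partial>lborel) \<partial>lborel) + (\<integral>\<^sup>+x. (\<integral>\<^sup>+y. ?U y * ?K (x - y) \<partial>lborel) \<partial>lborel)"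
    by (subst nn_integral_add[symmetric]) (auto simp: nn_integral_add)
  also have "(\<integral>\<^sup>+x. (\<integral>\<^sup>+y. ?U y * ?K (x - y) \<partial>lborel) \<partial>lborel) = (\<integral>\<^sup>+y. (\<integral>\<^sup>+x. ?U y * ?K (x - y) \<partial>lborel) \<partial>lborel)"
    by (rule lborel_pair.Fubini'[symmetric]) measurable
  also have "\<dots> = (\<integral>\<^sup>+z. ?K z \<partial>lborel) * (\<integral>\<^sup>+y. ?U y \<partial>lborel)"
    by (simp add: nn_integral_cmult sh2 nn_integral_multc mult.commute)
  also have "(\<integral>\<^sup>+x. (\<integral>\<^sup>+y. ?U x * ?K (x - y) \<partial>lborel) \<partial>lborel) = (\<integral>\<^sup>+z. ?K z \<partial>lborel) * (\<integral>\<^sup>+y. ?U y \<partial>lborel)"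
    by (simp add: nn_integral_cmult sh nn_integral_multc mult.commute)
  also have "\<dots> + \<dots> = (\<integral>\<^sup>+z. ?K z \<partial>lborel) * (\<integral>\<^sup>+y. ?U y + ?U y \<partial>lborel)"
    by (simp add: distrib_left nn_integral_add)
  also have "\<dots> = (\<integral>\<^sup>+z. ?K z \<partial>lborel) * (\<integral>\<^sup>+x. ennreal ((u x)\<^sup>2) \<partial>lborel)"
    by (simp flip: ennreal_plus)
  also have "\<dots> \<le> C * (\<integral>\<^sup>+x. ennreal ((u x)\<^sup>2) \<partial>lborel)"
    using C by (rule mult_right_mono) simp
  finally show ?thesis .
qed

text \<open>The Gaussian-regularized left-hand side is the integral of \<open>f x * cnj (f y)\<close> against the
  symmetric positive kernel \<open>gauss_hat e (x - y)\<close>; it is bounded by Schur's test.\<close>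

theorem fourier_bessel:
  fixes f :: "'a::euclidean_space \<Rightarrow> complex"
  assumes f: "integrable lborel f"
  shows "(\<integral>\<^sup>+\<xi>. ennreal ((norm (fourier f \<xi>))\<^sup>2) \<partial>lborel) \<le> ennreal ((2 * pi) ^ DIM('a)) * (\<integral>\<^sup>+x. ennreal ((norm (f x))\<^sup>2) \<partial>lborel)"
proof (rule nn_integral_le_gauss_limit)
  have [measurable]: "f \<in> borel_measurable borel" using f by auto
  show "(\<lambda>\<xi>. ennreal ((norm (fourier f \<xi>))\<^sup>2)) \<in> borel_measurable borel" by measurable
  fix e :: real assume e: "e > 0"
  let ?k = "\<lambda>\<xi>. complex_of_real (gauss e \<xi>) * cnj (fourier f \<xi>)"
  let ?B = "\<integral>x. norm (f x) \<partial>lborel"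
  have k: "integrable lborel ?k"
  proof (rule Bochner_Integration.integrable_bound)
    show "integrable lborel (\<lambda>x::'a. ?B *\<^sub>R complex_of_real (gauss e x))"
      using integrable_gauss[OF e] by (rule integrable_scaleR_right)
    show "AE x in lborel. norm (?k x) \<le> norm (?B *\<^sub>R complex_of_real (gauss e x))"
      using norm_fourier_le[of f]
      by (intro AE_I2) (auto simp: norm_mult mult.commute intro!: mult_left_mono order_trans[OF _ abs_ge_self])
  qed measurable
  have "(\<integral>\<^sup>+\<xi>. ennreal ((norm (fourier f \<xi>))\<^sup>2) * ennreal (gauss e \<xi>) \<partial>lborel) =
    (\<integral>\<^sup>+\<xi>. ennreal (norm (fourier f \<xi> * ?k \<xi>)) \<partial>lborel)"
    using gauss_bounds(1)[of e, THEN less_imp_le]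
    by (intro nn_integral_cong) (simp add: norm_mult power2_eq_square ennreal_mult[symmetric] ac_simps)
  also have "\<dots> = ennreal (\<integral>\<xi>. norm (fourier f \<xi> * ?k \<xi>) \<partial>lborel)"
  proof (rule nn_integral_eq_integral)
    show "integrable lborel (\<lambda>\<xi>. norm (fourier f \<xi> * ?k \<xi>))"
    proof (rule integrable_norm, rule Bochner_Integration.integrable_bound)
      show "integrable lborel (\<lambda>x::'a. ?B *\<^sub>R ?k x)" using k by (rule integrable_scaleR_right)
      show "AE x in lborel. norm (fourier f x * ?k x) \<le> norm (?B *\<^sub>R ?k x)"
        using norm_fourier_le[of f]
        by (intro AE_I2) (auto simp: norm_mult intro!: mult_right_mono order_trans[OF _ abs_ge_self])
    qed measurable
  qed simp
  also have "(\<integral>\<xi>. norm (fourier f \<xi> * ?k \<xi>) \<partial>lborel) = Re (\<integral>\<xi>. fourier f \<xi> * ?k \<xi> \<partial>lborel)"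
  proof -
    have "fourier f \<xi> * ?k \<xi> = complex_of_real (norm (fourier f \<xi> * ?k \<xi>))" for \<xi>
      using gauss_bounds(1)[of e \<xi>, THEN less_imp_le] complex_norm_square[of "fourier f \<xi>"]
      by (simp add: norm_mult power2_eq_square ac_simps)
    then have "(\<integral>\<xi>. fourier f \<xi> * ?k \<xi> \<partial>lborel) = (\<integral>\<xi>. complex_of_real (norm (fourier f \<xi> * ?k \<xi>)) \<partial>lborel)"
      by (intro Bochner_Integration.integral_cong) auto
    then show ?thesis by (simp only: integral_complex_of_real Re_complex_of_real)
  qed
  also have "(\<integral>\<xi>. fourier f \<xi> * ?k \<xi> \<partial>lborel) = (\<integral>x. f x * (\<integral>y. cnj (f y) * complex_of_real (gauss_hat e (x - y)) \<partial>lborel) \<partial>lborel)"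
    by (subst fourier_multiplication_formula[OF f k]) (simp only: fourier_gauss_cnj_fourier[OF f e])
  also have "ennreal (Re \<dots>) \<le> ennreal (norm \<dots>)" by (intro ennreal_leI complex_Re_le_cmod)
  also have "\<dots> \<le> (\<integral>\<^sup>+x. norm (f x * (\<integral>y. cnj (f y) * complex_of_real (gauss_hat e (x - y)) \<partial>lborel)) \<partial>lborel)"
  proof (rule integral_norm_bound_ennreal)
    have "integrable lborel (\<lambda>x. f x * fourier ?k x)"
    proof (rule Bochner_Integration.integrable_bound)
      show "integrable lborel (\<lambda>x::'a. (\<integral>x. norm (?k x) \<partial>lborel) *\<^sub>R f x)" using f by (rule integrable_scaleR_right)
      show "AE x in lborel. norm (f x * fourier ?k x) \<le> norm ((\<integral>x. norm (?k x) \<partial>lborel) *\<^sub>R f x)"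
        using norm_fourier_le[of ?k]
        by (intro AE_I2) (auto simp: norm_mult mult.commute[of "cmod (f _)"] intro!: mult_right_mono order_trans[OF _ abs_ge_self])
    qed measurable
    then show "integrable lborel (\<lambda>x. f x * (\<integral>y. cnj (f y) * complex_of_real (gauss_hat e (x - y)) \<partial>lborel))"
      by (simp only: fourier_gauss_cnj_fourier[OF f e])
  qed
  also have "\<dots> \<le> (\<integral>\<^sup>+x. (\<integral>\<^sup>+y. ennreal (norm (f x) * norm (f y) * gauss_hat e (x - y)) \<partial>lborel) \<partial>lborel)"
  proof (intro nn_integral_mono)
    fix x
    note bd = norm_gauss_hat_le[OF e, where 'a='a]
    have ig: "integrable lborel (\<lambda>y. cnj (f y) * complex_of_real (gauss_hat e (x - y)))"
    proof (rule Bochner_Integration.integrable_bound)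
      show "integrable lborel (\<lambda>x::'a. ((sqrt (2 * pi) / e) ^ DIM('a)) *\<^sub>R f x)" using f by (rule integrable_scaleR_right)
      show "AE y in lborel. norm (cnj (f y) * complex_of_real (gauss_hat e (x - y))) \<le> norm ((sqrt (2 * pi) / e) ^ DIM('a) *\<^sub>R f y)"
        using bd by (intro AE_I2) (auto simp: norm_mult mult.commute[of "cmod (f _)"] intro!: mult_right_mono order_trans[OF _ abs_ge_self])
    qed measurable
    have "ennreal (norm (f x * (\<integral>y. cnj (f y) * complex_of_real (gauss_hat e (x - y)) \<partial>lborel))) =
      ennreal (norm (f x)) * ennreal (norm (\<integral>y. cnj (f y) * complex_of_real (gauss_hat e (x - y)) \<partial>lborel))"
      by (simp add: norm_mult ennreal_mult)
    also have "\<dots> \<le> ennreal (norm (f x)) * (\<integral>\<^sup>+y. norm (cnj (f y) * complex_of_real (gauss_hat e (x - y))) \<partial>lborel)"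
      by (intro mult_left_mono integral_norm_bound_ennreal ig) simp
    also have "\<dots> = (\<integral>\<^sup>+y. ennreal (norm (f x) * norm (f y) * gauss_hat e (x - y)) \<partial>lborel)"
      using gauss_hat_nonneg[OF e, where 'a='a]
      by (subst nn_integral_cmult[symmetric]) (auto simp: norm_mult ennreal_mult[symmetric] mult.assoc intro!: nn_integral_cong)
    finally show "ennreal (norm (f x * (\<integral>y. cnj (f y) * complex_of_real (gauss_hat e (x - y)) \<partial>lborel))) \<le>
       (\<integral>\<^sup>+y. ennreal (norm (f x) * norm (f y) * gauss_hat e (x - y)) \<partial>lborel)" .
  qed
  also have "\<dots> \<le> ennreal ((2 * pi) ^ DIM('a)) * (\<integral>\<^sup>+x. ennreal ((norm (f x))\<^sup>2) \<partial>lborel)"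
  proof (rule schur_le)
    show "(\<integral>\<^sup>+z. ennreal (gauss_hat e (z::'a)) \<partial>lborel) \<le> ennreal ((2 * pi) ^ DIM('a))"
      by (simp add: nn_integral_gauss_hat[OF e])
  qed (auto simp: gauss_hat_nonneg e)
  finally show "(\<integral>\<^sup>+\<xi>. ennreal ((norm (fourier f \<xi>))\<^sup>2) * ennreal (gauss e \<xi>) \<partial>lborel) \<le>
    ennreal ((2 * pi) ^ DIM('a)) * (\<integral>\<^sup>+x. ennreal ((norm (f x))\<^sup>2) \<partial>lborel)" .
qed

text \<open>A Gaussian factor is inserted and moved by the multiplication formula, where it becomes
  a kernel concentrating at \<open>y\<close>. Continuity of \<open>f\<close> gives the pointwise
  limit, boundedness the dominating function.\<close>

theorem fourier_inversion:
  fixes f :: "'a::euclidean_space \<Rightarrow> complex"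
  assumes f: "integrable lborel f" and cont: "continuous_on UNIV f" and bd: "\<And>x. norm (f x) \<le> M"
    and fh: "integrable lborel (fourier f)"
  shows "(\<integral>\<xi>. cis (y \<bullet> \<xi>) * fourier f \<xi> \<partial>lborel) = (2 * pi) ^ DIM('a) *\<^sub>R f y"
proof -
  have [measurable]: "f \<in> borel_measurable borel" using f by auto
  let ?e = "\<lambda>n. 1 / real (Suc n)"
  let ?G = "\<lambda>n (\<xi>::'a). complex_of_real (gauss (?e n) \<xi>)"
  have L: "(\<lambda>n. \<integral>\<xi>. fourier f \<xi> * (cis (y \<bullet> \<xi>) * ?G n \<xi>) \<partial>lborel) \<longlonglongrightarrow> (\<integral>\<xi>. cis (y \<bullet> \<xi>) * fourier f \<xi> \<partial>lborel)"
  proof (rule integral_dominated_convergence)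
    show "integrable lborel (\<lambda>\<xi>. norm (fourier f \<xi>))" using fh by (rule integrable_norm)
    show "AE \<xi> in lborel. norm (fourier f \<xi> * (cis (y \<bullet> \<xi>) * ?G n \<xi>)) \<le> norm (fourier f \<xi>)" for n
      using gauss_bounds[of "?e n"] by (intro AE_I2) (auto simp: norm_mult less_imp_le intro!: mult_left_le)
    show "AE \<xi> in lborel. (\<lambda>n. fourier f \<xi> * (cis (y \<bullet> \<xi>) * ?G n \<xi>)) \<longlonglongrightarrow> cis (y \<bullet> \<xi>) * fourier f \<xi>"
    proof (intro AE_I2)
      fix \<xi>
      have "(\<lambda>n. fourier f \<xi> * (cis (y \<bullet> \<xi>) * ?G n \<xi>)) \<longlonglongrightarrow> fourier f \<xi> * (cis (y \<bullet> \<xi>) * complex_of_real 1)"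
        by (intro tendsto_intros gauss_tendsto_1)
      then show "(\<lambda>n. fourier f \<xi> * (cis (y \<bullet> \<xi>) * ?G n \<xi>)) \<longlonglongrightarrow> cis (y \<bullet> \<xi>) * fourier f \<xi>"
        by (simp add: mult.commute)
    qed
  qed measurable
  have eq: "(\<integral>\<xi>. fourier f \<xi> * (cis (y \<bullet> \<xi>) * ?G n \<xi>) \<partial>lborel) =
    (\<integral>z. f (y + ?e n *\<^sub>R z) * complex_of_real (gauss_hat 1 z) \<partial>lborel)" for n
  proof -
    define e where "e = ?e n"
    have e: "e > 0" by (simp add: e_def)
    note bdg = norm_gauss_hat_le[OF e, where 'a='a]
    have i: "integrable lborel (\<lambda>x. f x * complex_of_real (gauss_hat e (x - y)))"
    proof (rule Bochner_Integration.integrable_bound)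
      show "integrable lborel (\<lambda>x::'a. ((sqrt (2 * pi) / e) ^ DIM('a)) *\<^sub>R f x)" using f by (rule integrable_scaleR_right)
      show "AE x in lborel. norm (f x * complex_of_real (gauss_hat e (x - y))) \<le> norm ((sqrt (2 * pi) / e) ^ DIM('a) *\<^sub>R f x)"
        using bdg by (intro AE_I2) (auto simp: norm_mult mult.commute[of "cmod (f _)"] intro!: mult_right_mono order_trans[OF _ abs_ge_self])
    qed measurable
    \<comment> \<open>The kernel scales like e^-n, which cancels the factor from x = y + e z; the
      weight left over does not depend on \<open>e\<close>.\<close>
    have gh: "gauss_hat e (e *\<^sub>R z) = gauss_hat 1 z / e ^ DIM('a)" for z :: 'a
      using e by (simp add: gauss_hat_def gauss_def power_divide power2_eq_square field_simps)
    have "(\<integral>\<xi>. fourier f \<xi> * (cis (y \<bullet> \<xi>) * complex_of_real (gauss e \<xi>)) \<partial>lborel) =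
      (\<integral>x. f x * complex_of_real (gauss_hat e (x - y)) \<partial>lborel)"
      by (subst fourier_multiplication_formula[OF f integrable_cis_mult[OF integrable_gauss[OF e]]])
         (simp_all only: fourier_translate fourier_gauss[OF e], measurable)
    also have "\<dots> = e ^ DIM('a) *\<^sub>R (\<integral>z. f (y + e *\<^sub>R z) * complex_of_real (gauss_hat e (e *\<^sub>R z)) \<partial>lborel)"
      using integral_lborel_affine[OF i, of e y] e by simp
    also have "\<dots> = (\<integral>z. f (y + e *\<^sub>R z) * complex_of_real (gauss_hat 1 z) \<partial>lborel)"
      unfolding gh using e by (simp add: scaleR_conv_of_real)
    finally show ?thesis unfolding e_def .
  qed
  have R: "(\<lambda>n. \<integral>z. f (y + ?e n *\<^sub>R z) * complex_of_real (gauss_hat 1 z) \<partial>lborel) \<longlonglongrightarrow> (\<integral>z. f y * complex_of_real (gauss_hat 1 (z::'a)) \<partial>lborel)"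
  proof (rule integral_dominated_convergence)
    show "integrable lborel (\<lambda>z::'a. M *\<^sub>R norm (complex_of_real (gauss_hat 1 z)))"
      by (intro integrable_scaleR_right integrable_norm integrable_gauss_hat) simp
    show "AE z in lborel. norm (f (y + ?e n *\<^sub>R z) * complex_of_real (gauss_hat 1 z)) \<le> M *\<^sub>R norm (complex_of_real (gauss_hat 1 z))" for n
      using bd by (intro AE_I2) (auto simp: norm_mult intro!: mult_right_mono)
    show "AE z in lborel. (\<lambda>n. f (y + ?e n *\<^sub>R z) * complex_of_real (gauss_hat 1 z)) \<longlonglongrightarrow> f y * complex_of_real (gauss_hat 1 z)"
    proof (intro AE_I2)
      fix z
      have "(\<lambda>n. y + ?e n *\<^sub>R z) \<longlonglongrightarrow> y + 0 *\<^sub>R z"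
        using LIMSEQ_inverse_real_of_nat by (intro tendsto_intros) (simp add: inverse_eq_divide)
      then have "(\<lambda>n. f (y + ?e n *\<^sub>R z)) \<longlonglongrightarrow> f y"
        using cont continuous_on_tendsto_compose[of UNIV f "\<lambda>n. y + ?e n *\<^sub>R z" y] by simp
      then show "(\<lambda>n. f (y + ?e n *\<^sub>R z) * complex_of_real (gauss_hat 1 z)) \<longlonglongrightarrow> f y * complex_of_real (gauss_hat 1 z)"
        by (intro tendsto_intros)
    qed
  qed measurable
  have "(\<integral>\<xi>. cis (y \<bullet> \<xi>) * fourier f \<xi> \<partial>lborel) = (\<integral>z. f y * complex_of_real (gauss_hat 1 (z::'a)) \<partial>lborel)"
    using L R unfolding eq by (rule LIMSEQ_unique)
  also have "\<dots> = (2 * pi) ^ DIM('a) *\<^sub>R f y"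
    by (simp add: integral_gauss_hat scaleR_conv_of_real del: integral_complex_of_real)
  finally show ?thesis .
qed

section \<open>Test functions and rapidly decreasing functions\<close>

text \<open>Global smoothness with support in a compact part of \<open>S\<close>: such a function is
  already extended by zero, so its product with a function that is smooth only on \<open>S\<close>
  is smooth on the whole space. Any compact \<open>K\<close> containing the support may serve as
  witness.\<close>

definition test_on :: "'a::euclidean_space set \<Rightarrow> ('a \<Rightarrow> complex) \<Rightarrow> bool" where
  "test_on S f \<longleftrightarrow> smooth_on UNIV f \<and> (\<exists>K. compact K \<and> K \<subseteq> S \<and> (\<forall>x. x \<notin> K \<longrightarrow> f x = 0))"

lemma test_onE:
  assumes "test_on S f"
  obtains K where "smooth_on UNIV f" "compact K" "K \<subseteq> S" "\<forall>x. x \<notin> K \<longrightarrow> f x = 0"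
  using assms unfolding test_on_def by (elim conjE exE) (intro that)

lemma test_on_mono: "test_on S f \<Longrightarrow> S \<subseteq> T \<Longrightarrow> test_on T f"
  unfolding test_on_def by (meson order_trans)

lemma test_functions_iff: "f \<in> test_functions \<longleftrightarrow> test_on UNIV f"
proof
  assume "f \<in> test_functions"
  then show "test_on UNIV f"
    unfolding test_functions_def test_on_def
    by (intro conjI exI[of _ "closure {x. f x \<noteq> 0}"]) (auto dest: closure_subset[THEN subsetD, of _ "{x. f x \<noteq> 0}", OF CollectI])
next
  assume "test_on UNIV f"
  then obtain K where K: "smooth_on UNIV f" "compact K" "\<forall>x. x \<notin> K \<longrightarrow> f x = 0" by (rule test_onE)
  have "closure {x. f x \<noteq> 0} \<subseteq> K"
    using K by (intro closure_minimal compact_imp_closed) auto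
  then show "f \<in> test_functions"
    using K compact_Int_closed[OF K(2) closed_closure, of "{x. f x \<noteq> 0}"]
    by (simp add: test_functions_def Int_absorb1)
qed

lemma test_on_continuous: "test_on S f \<Longrightarrow> continuous_on UNIV f"
  by (auto simp: test_on_def intro: smooth_on_imp_continuous_on)

lemma test_on_smooth: "test_on S f \<Longrightarrow> smooth_on UNIV f"
  by (auto simp: test_on_def)

lemma test_on_measurable [dest]: "test_on S f \<Longrightarrow> f \<in> borel_measurable borel"
  by (rule borel_measurable_continuous_onI) (rule test_on_continuous)

lemma compact_support_integrable:
  fixes f :: "'a::euclidean_space \<Rightarrow> complex"
  assumes "continuous_on UNIV f" "compact K" "\<forall>x. x \<notin> K \<longrightarrow> f x = 0"
  shows "integrable lborel f"
proof -
  have "integrable lborel (\<lambda>x. indicator K x *\<^sub>R f x)"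
    using assms by (intro borel_integrable_compact) (auto intro: continuous_on_subset)
  moreover have "(\<lambda>x. indicator K x *\<^sub>R f x) = f"
    using assms(3) by (auto split: split_indicator)
  ultimately show ?thesis by simp
qed

lemma compact_support_bounded:
  fixes f :: "'a::euclidean_space \<Rightarrow> 'b::real_normed_vector"
  assumes "continuous_on UNIV f" "compact K" "\<forall>x. x \<notin> K \<longrightarrow> f x = 0"
  obtains B where "B > 0" "\<forall>x. norm (f x) \<le> B"
proof -
  have "bounded (f ` K)"
    using assms by (intro compact_imp_bounded compact_continuous_image) (auto intro: continuous_on_subset)
  then obtain B where B: "B > 0" "\<forall>y\<in>f ` K. norm y \<le> B" by (auto simp: bounded_pos)
  have "norm (f x) \<le> B" for x using B assms(3) by (cases "x \<in> K") auto
  then show ?thesis using B that by blast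
qed

lemma test_on_integrable: "test_on S f \<Longrightarrow> integrable lborel f"
  by (erule test_onE) (blast intro: compact_support_integrable smooth_on_imp_continuous_on)

lemma test_on_bounded:
  assumes "test_on S f"
  obtains B where "B > 0" "\<forall>x. norm (f x) \<le> B"
proof -
  obtain K where "smooth_on UNIV f" "compact K" "\<forall>x. x \<notin> K \<longrightarrow> f x = 0" using assms by (rule test_onE)
  then show ?thesis
    using compact_support_bounded[of f K] that smooth_on_imp_continuous_on[of UNIV f] by blast
qed

text \<open>Values of \<open>g\<close> off \<open>U\<close> are harmless because \<open>a\<close>
  vanishes there: \<open>U\<close> and the complement of the compact set carrying \<open>a\<close>
  are open, cover the space, and the product is smooth on each.\<close>

lemma test_on_mult_smooth:
  assumes a: "test_on U a" and U: "open U" and g: "smooth_on U g"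
  shows "test_on U (\<lambda>x. a x * g x)"
proof -
  obtain K where K: "smooth_on UNIV a" "compact K" "K \<subseteq> U" "\<forall>x. x \<notin> K \<longrightarrow> a x = 0" using a by (rule test_onE)
  have "smooth_on UNIV (\<lambda>x. a x * g x)"
  proof (rule smooth_on_local)
    fix x
    show "\<exists>T. open T \<and> x \<in> T \<and> smooth_on T (\<lambda>x. a x * g x)"
    proof (cases "x \<in> U")
      case True
      have "smooth_on U (\<lambda>x. a x * g x)"
        using K(1) by (intro smooth_on_mult U g) (rule smooth_on_subset, auto)
      then show ?thesis using True U by blast
    next
      case False
      have o: "open (- K)" using K(2) by (simp add: compact_imp_closed open_Compl)
      have "smooth_on (-K) (\<lambda>x. a x * g x)"
        by (rule smooth_on_cong[OF o _ smooth_on_const[of _ 0]]) (use K in auto)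
      then show ?thesis using False K(3) o by blast
    qed
  qed
  then show ?thesis unfolding test_on_def using K by (intro conjI exI[of _ K]) auto
qed

lemma test_on_mult_left:
  assumes "test_on U a" "open U" "smooth_on U g"
  shows "test_on U (\<lambda>x. g x * a x)"
  using test_on_mult_smooth[OF assms] by (simp add: mult.commute)

lemma test_on_cmult: "test_on U a \<Longrightarrow> test_on U (\<lambda>x. c * a x)"
  unfolding test_on_def
  by (elim conjE exE, intro conjI exI smooth_on_bounded_linear[OF bounded_linear_mult_right open_UNIV]) auto

lemma test_on_add:
  assumes "test_on U a" "test_on U b"
  shows "test_on U (\<lambda>x. a x + b x)"
proof -
  obtain K where K: "smooth_on UNIV a" "compact K" "K \<subseteq> U" "\<forall>x. x \<notin> K \<longrightarrow> a x = 0" using assms(1) by (rule test_onE)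
  obtain K' where K': "smooth_on UNIV b" "compact K'" "K' \<subseteq> U" "\<forall>x. x \<notin> K' \<longrightarrow> b x = 0" using assms(2) by (rule test_onE)
  show ?thesis unfolding test_on_def
    using K K' by (intro conjI exI[of _ "K \<union> K'"] smooth_on_add compact_Un) auto
qed

lemma test_on_sum: "(\<And>i. i \<in> I \<Longrightarrow> test_on U (a i)) \<Longrightarrow> test_on U (\<lambda>x. \<Sum>i\<in>I. a i x)"
proof (induction I rule: infinite_finite_induct)
  case (insert i I)
  then show ?case by (simp add: test_on_add)
qed (simp_all add: test_on_def smooth_on_const exI[of _ "{}"])

lemma test_on_frechet_derivative:
  assumes "test_on U a"
  shows "test_on U (\<lambda>x. frechet_derivative a (at x) v)"
proof -
  obtain K where K: "smooth_on UNIV a" "compact K" "K \<subseteq> U" "\<forall>x. x \<notin> K \<longrightarrow> a x = 0" using assms by (rule test_onE)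
  have "frechet_derivative a (at x) v = 0" if "x \<notin> K" for x
  proof -
    have "open (- K)" using K(2) by (simp add: compact_imp_closed open_Compl)
    then have "(a has_derivative (\<lambda>_. 0)) (at x)"
      using that K(4) by (intro has_derivative_transform_within_open[OF has_derivative_const[of 0]]) auto
    then show ?thesis using frechet_derivative_at by metis
  qed
  then show ?thesis unfolding test_on_def
    using K smooth_on_frechet_derivative[OF K(1)] by blast
qed

lemma test_on_has_derivative:
  "test_on U a \<Longrightarrow> (a has_derivative frechet_derivative a (at x)) (at x)"
  by (auto simp: test_on_def intro: smooth_on_has_derivative)

text \<open>Difference quotients in direction \<open>v\<close> have integral 0 by translation
  invariance, and dominated convergence passes to the derivative. The integrations by parts below
  rest on this.\<close>

lemma integral_frechet_derivative_eq_0: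
  fixes F :: "'a::euclidean_space \<Rightarrow> complex"
  assumes F: "test_on UNIV F"
  shows "(\<integral>x. frechet_derivative F (at x) v \<partial>lborel) = 0"
proof -
  have [measurable]: "F \<in> borel_measurable borel" using F by auto
  have D: "test_on UNIV (\<lambda>x. frechet_derivative F (at x) v)" using F by (rule test_on_frechet_derivative)
  have [measurable]: "(\<lambda>x. frechet_derivative F (at x) v) \<in> borel_measurable borel" using D by auto
  obtain B where B: "B > 0" "\<forall>x. norm (frechet_derivative F (at x) v) \<le> B" using D by (rule test_on_bounded)
  obtain K where K: "smooth_on UNIV F" "compact K" "\<forall>x. x \<notin> K \<longrightarrow> F x = 0" using F by (rule test_onE)
  obtain R where R: "\<forall>x\<in>K. norm x \<le> R" using compact_imp_bounded[OF K(2)] by (auto simp: bounded_iff)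
  define t where "t n = 1 / real (Suc n)" for n
  have t: "0 < t n" "t n \<le> 1" for n by (auto simp: t_def)
  have t0: "t \<longlonglongrightarrow> 0" using LIMSEQ_inverse_real_of_nat by (simp add: t_def[abs_def] inverse_eq_divide)
  define q where "q n x = (F (x + t n *\<^sub>R v) - F x) /\<^sub>R t n" for n x
  have iF: "integrable lborel F" using F by (rule test_on_integrable)
  have iF': "integrable lborel (\<lambda>x. F (x + t n *\<^sub>R v))" for n
    using integrable_lborel_affine[OF iF, of 1 "t n *\<^sub>R v"] by (simp add: add.commute)
  have q0: "(\<integral>x. q n x \<partial>lborel) = 0" for n
  proof -
    have "(\<integral>x. F (x + t n *\<^sub>R v) \<partial>lborel) = (\<integral>x. F x \<partial>lborel)"
      using integral_lborel_affine[OF iF, of 1 "t n *\<^sub>R v"] by (simp add: add.commute)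
    then show ?thesis unfolding q_def using iF iF' by simp
  qed
  have line: "((\<lambda>s. F (x + s *\<^sub>R v)) has_derivative (\<lambda>h. h *\<^sub>R frechet_derivative F (at (x + s *\<^sub>R v)) v)) (at s)" for x s
  proof -
    have 1: "(F has_derivative frechet_derivative F (at (x + s *\<^sub>R v))) (at (x + s *\<^sub>R v))"
      using F by (rule test_on_has_derivative)
    have "((\<lambda>s. F (x + s *\<^sub>R v)) has_derivative (\<lambda>h. frechet_derivative F (at (x + s *\<^sub>R v)) (h *\<^sub>R v))) (at s)"
      by (rule has_derivative_compose[where f="\<lambda>s. x + s *\<^sub>R v" and f'="\<lambda>h. h *\<^sub>R v" and g=F, OF _ 1]) (auto intro!: derivative_eq_intros)
    then show ?thesis
      using linear_scale[OF has_derivative_linear[OF 1]] by simp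
  qed
  have bq: "norm (q n x) \<le> B" for n x
  proof -
    have on: "onorm (\<lambda>h::real. h *\<^sub>R frechet_derivative F (at (x + s *\<^sub>R v)) v) \<le> B" for s
    proof (rule onorm_le)
      fix h :: real
      show "norm (h *\<^sub>R frechet_derivative F (at (x + s *\<^sub>R v)) v) \<le> B * norm h"
        using B(2) mult_left_mono[of "norm (frechet_derivative F (at (x + s *\<^sub>R v)) v)" B "\<bar>h\<bar>"]
        by (simp add: mult.commute)
    qed
    have "norm (F (x + t n *\<^sub>R v) - F (x + 0 *\<^sub>R v)) \<le> B * norm (t n - 0)"
      by (rule differentiable_bound[where S=UNIV and f'="\<lambda>s h. h *\<^sub>R frechet_derivative F (at (x + s *\<^sub>R v)) v"])
        (use line on in auto)
    then show ?thesis using t(1)[of n]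
      by (simp add: q_def inverse_eq_divide pos_divide_le_eq)
  qed
  \<comment> \<open>As \<open>t n\<close> is at most 1, a shift moves points by at most
    \<open>norm v\<close>, so all quotients vanish off one common ball.\<close>
  have sq: "q n x = 0" if "x \<notin> cball 0 (R + norm v)" for n x
  proof -
    have "norm (t n *\<^sub>R v) \<le> norm v" using t[of n] by (simp add: mult_left_le_one_le)
    moreover have "norm x \<le> norm (x + t n *\<^sub>R v) + norm (t n *\<^sub>R v)"
      using norm_triangle_ineq4[of "x + t n *\<^sub>R v" "t n *\<^sub>R v"] by simp
    ultimately have "norm (x + t n *\<^sub>R v) > R" using that by auto
    then have "F (x + t n *\<^sub>R v) = 0" using R K(3) by (meson not_le)
    moreover have "norm x > R" using that norm_ge_zero[of v] by (simp add: dist_norm del: norm_ge_zero)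
    then have "F x = 0" using R K(3) by (meson not_le)
    ultimately show ?thesis by (simp add: q_def)
  qed
  have "(\<lambda>n. \<integral>x. q n x \<partial>lborel) \<longlonglongrightarrow> (\<integral>x. frechet_derivative F (at x) v \<partial>lborel)"
  proof (rule integral_dominated_convergence)
    show "integrable lborel (\<lambda>x. indicator (cball (0::'a) (R + norm v)) x *\<^sub>R B)"
      by (intro borel_integrable_compact) auto
    show "AE x in lborel. norm (q n x) \<le> indicator (cball (0::'a) (R + norm v)) x *\<^sub>R B" for n
      using bq[of n] sq[of _ n] by (intro AE_I2) (auto split: split_indicator)
    show "AE x in lborel. (\<lambda>n. q n x) \<longlonglongrightarrow> frechet_derivative F (at x) v"
    proof (intro AE_I2)
      fix x
      let ?D = "frechet_derivative F (at x) v"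
      have L: "((\<lambda>h. norm (F (x + (0 + h) *\<^sub>R v) - F (x + 0 *\<^sub>R v) - h *\<^sub>R ?D) / norm h) \<longlongrightarrow> 0) (at 0)"
        using line[of x 0] unfolding has_derivative_at by simp
      have "filterlim t (at 0) sequentially"
        unfolding filterlim_at using t0 t(1) by (auto simp: less_imp_neq[THEN not_sym])
      then have "(\<lambda>n. norm (F (x + (0 + t n) *\<^sub>R v) - F (x + 0 *\<^sub>R v) - t n *\<^sub>R ?D) / norm (t n)) \<longlonglongrightarrow> 0"
        by (rule filterlim_compose[OF L])
      moreover have "norm (F (x + (0 + t n) *\<^sub>R v) - F (x + 0 *\<^sub>R v) - t n *\<^sub>R ?D) / norm (t n) = norm (q n x - ?D)" for n
      proof -
        have "q n x - ?D = (F (x + t n *\<^sub>R v) - F x - t n *\<^sub>R ?D) /\<^sub>R t n"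
          using t(1)[of n] by (simp add: q_def scaleR_diff_right)
        then show ?thesis using t(1)[of n] by (simp add: divide_inverse mult.commute)
      qed
      ultimately have "(\<lambda>n. norm (q n x - ?D)) \<longlonglongrightarrow> 0" by simp
      then show "(\<lambda>n. q n x) \<longlonglongrightarrow> ?D" by (simp add: tendsto_norm_zero_iff LIM_zero_iff)
    qed
  qed (auto simp: q_def)
  then show ?thesis unfolding q0 using LIMSEQ_unique[OF tendsto_const] by metis
qed

section \<open>The Japanese bracket and rapidly decreasing functions\<close>

lemma japanese_bracket_ge_1: "japanese_bracket \<xi> \<ge> 1"
  by (simp add: japanese_bracket_def)

lemma japanese_bracket_pos [simp]: "japanese_bracket \<xi> > 0"
  using japanese_bracket_ge_1[of \<xi>] by linarith

lemma japanese_bracket_sq: "(japanese_bracket \<xi>)\<^sup>2 = 1 + (\<Sum>b\<in>Basis. (\<xi> \<bullet> b)\<^sup>2)"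
proof -
  have "\<xi> \<bullet> \<xi> = (\<Sum>b\<in>Basis. (\<xi> \<bullet> b)\<^sup>2)"
    by (subst euclidean_inner) (simp add: power2_eq_square)
  moreover have "(japanese_bracket \<xi>)\<^sup>2 = 1 + \<xi> \<bullet> \<xi>"
    by (simp add: japanese_bracket_def power2_norm_eq_inner)
  ultimately show ?thesis by simp
qed

lemma norm_le_japanese_bracket: "norm \<xi> \<le> japanese_bracket \<xi>"
  unfolding japanese_bracket_def by (rule real_le_rsqrt) simp

lemma japanese_bracket_le: "japanese_bracket \<xi> \<le> 1 + norm \<xi>"
  unfolding japanese_bracket_def by (rule real_le_lsqrt) (auto simp: power2_sum)

lemma inner_le_japanese_bracket: "b \<in> Basis \<Longrightarrow> \<bar>\<xi> \<bullet> b\<bar> \<le> japanese_bracket \<xi>"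
  using Basis_le_norm norm_le_japanese_bracket order_trans by blast

lemma borel_measurable_japanese_bracket [measurable]: "japanese_bracket \<in> borel_measurable borel"
  unfolding japanese_bracket_def[abs_def] by measurable

text \<open>Decay without any regularity, so that indicators of frequency regions and powers of the
  bracket can be multiplied in.\<close>

definition rapid :: "('a::euclidean_space \<Rightarrow> complex) \<Rightarrow> bool" where
  "rapid h \<longleftrightarrow> h \<in> borel_measurable borel \<and> (\<forall>N. \<exists>C. \<forall>\<xi>. japanese_bracket \<xi> ^ N * norm (h \<xi>) \<le> C)"

lemma rapid_measurable [dest]: "rapid h \<Longrightarrow> h \<in> borel_measurable borel"
  by (simp add: rapid_def)

lemma rapidE:
  assumes "rapid h"
  obtains C where "C > 0" "\<forall>\<xi>. japanese_bracket \<xi> ^ N * norm (h \<xi>) \<le> C"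
proof -
  obtain C where "\<forall>\<xi>. japanese_bracket \<xi> ^ N * norm (h \<xi>) \<le> C" using assms unfolding rapid_def by blast
  then have "\<forall>\<xi>. japanese_bracket \<xi> ^ N * norm (h \<xi>) \<le> max C 1" by (simp add: le_max_iff_disj)
  then show ?thesis by (intro that[of "max C 1"]) auto
qed

lemma rapid_mult_bounded:
  fixes h :: "'a::euclidean_space \<Rightarrow> complex"
  assumes h: "rapid h" and [measurable]: "g \<in> borel_measurable borel"
    and g: "\<And>\<xi>. norm (g \<xi>) \<le> B * japanese_bracket \<xi> ^ M"
  shows "rapid (\<lambda>\<xi>. g \<xi> * h \<xi>)"
  unfolding rapid_def
proof (intro conjI allI)
  have [measurable]: "h \<in> borel_measurable borel" using h by auto
  show "(\<lambda>\<xi>. g \<xi> * h \<xi>) \<in> borel_measurable borel" by measurable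
  fix N
  obtain C where C: "C > 0" "\<forall>\<xi>. japanese_bracket \<xi> ^ (N + M) * norm (h \<xi>) \<le> C" using h by (rule rapidE)
  have "0 \<le> B * japanese_bracket (0::'a) ^ M" using order_trans[OF norm_ge_zero g[of 0]] .
  then have B: "B \<ge> 0" by (simp add: japanese_bracket_def)
  have "japanese_bracket \<xi> ^ N * norm (g \<xi> * h \<xi>) \<le> B * C" for \<xi>
  proof -
    have "japanese_bracket \<xi> ^ N * norm (g \<xi> * h \<xi>) \<le> japanese_bracket \<xi> ^ N * ((B * japanese_bracket \<xi> ^ M) * norm (h \<xi>))"
      unfolding norm_mult by (intro mult_left_mono mult_right_mono g) (auto simp: less_imp_le)
    also have "\<dots> = B * (japanese_bracket \<xi> ^ (N + M) * norm (h \<xi>))" by (simp add: power_add mult_ac)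
    also have "\<dots> \<le> B * C" using C B by (intro mult_left_mono) auto
    finally show ?thesis .
  qed
  then show "\<exists>C. \<forall>\<xi>. japanese_bracket \<xi> ^ N * norm (g \<xi> * h \<xi>) \<le> C" by blast
qed

lemma rapid_add:
  assumes "rapid g" "rapid h"
  shows "rapid (\<lambda>\<xi>. g \<xi> + h \<xi>)"
  unfolding rapid_def
proof (intro conjI allI)
  have [measurable]: "g \<in> borel_measurable borel" "h \<in> borel_measurable borel" using assms by auto
  show "(\<lambda>\<xi>. g \<xi> + h \<xi>) \<in> borel_measurable borel" by measurable
  fix N
  obtain C where C: "C > 0" "\<forall>\<xi>. japanese_bracket \<xi> ^ N * norm (g \<xi>) \<le> C" using assms(1) by (rule rapidE)
  obtain C' where C': "C' > 0" "\<forall>\<xi>. japanese_bracket \<xi> ^ N * norm (h \<xi>) \<le> C'" using assms(2) by (rule rapidE)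
  have "japanese_bracket \<xi> ^ N * norm (g \<xi> + h \<xi>) \<le> C + C'" for \<xi>
  proof -
    have "japanese_bracket \<xi> ^ N * norm (g \<xi> + h \<xi>) \<le> japanese_bracket \<xi> ^ N * (norm (g \<xi>) + norm (h \<xi>))"
      by (intro mult_left_mono norm_triangle_ineq) (auto simp: less_imp_le)
    also have "\<dots> \<le> C + C'" unfolding distrib_left using C C' by (intro add_mono) auto
    finally show ?thesis .
  qed
  then show "\<exists>C. \<forall>\<xi>. japanese_bracket \<xi> ^ N * norm (g \<xi> + h \<xi>) \<le> C" by blast
qed

text \<open>The exponent is twice the dimension because each coordinate factor 1 + (x . b)^2 is
  bounded by one square of the bracket; the product of the one-dimensional functions then
  dominates.\<close>

lemma integrable_japanese_bracket:
  "integrable lborel (\<lambda>x::'a::euclidean_space. 1 / japanese_bracket x ^ (2 * DIM('a)))"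
proof (rule Bochner_Integration.integrable_bound)
  have "integrable lborel (\<lambda>x::real. inverse (1 + x\<^sup>2))"
    using integrable_inverse_1_plus_square by (simp add: set_integrable_def)
  then show "integrable lborel (\<lambda>x::'a. \<Prod>b\<in>Basis. inverse (1 + (x \<bullet> b)\<^sup>2))"
    by (rule integrable_lborel_prod)
  show "AE x in lborel. norm (1 / japanese_bracket (x::'a) ^ (2 * DIM('a))) \<le> norm (\<Prod>b\<in>Basis. inverse (1 + (x \<bullet> b)\<^sup>2))"
  proof (intro AE_I2)
    fix x :: 'a
    have "(\<Prod>b\<in>Basis. 1 + (x \<bullet> b)\<^sup>2) \<le> (\<Prod>b\<in>(Basis::'a set). (japanese_bracket x)\<^sup>2)"
    proof (intro prod_mono conjI)
      fix b :: 'a assume "b \<in> Basis"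
      then show "1 + (x \<bullet> b)\<^sup>2 \<le> (japanese_bracket x)\<^sup>2"
        unfolding japanese_bracket_sq by (auto intro!: member_le_sum)
    qed simp
    moreover have "(\<Prod>b\<in>(Basis::'a set). (japanese_bracket x)\<^sup>2) = japanese_bracket x ^ (2 * DIM('a))"
      by (simp add: power_mult)
    moreover have "0 < (\<Prod>b\<in>Basis. 1 + (x \<bullet> b)\<^sup>2)"
      by (intro prod_pos) (auto intro: add_pos_nonneg)
    ultimately have "inverse (japanese_bracket x ^ (2 * DIM('a))) \<le> inverse (\<Prod>b\<in>Basis. 1 + (x \<bullet> b)\<^sup>2)"
      by (intro le_imp_inverse_le) auto
    then show "norm (1 / japanese_bracket x ^ (2 * DIM('a))) \<le> norm (\<Prod>b\<in>Basis. inverse (1 + (x \<bullet> b)\<^sup>2))"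
      using less_imp_le[OF japanese_bracket_pos, of x]
      by (simp add: prod_inversef[symmetric, unfolded comp_def] inverse_eq_divide[symmetric] abs_of_nonneg prod_nonneg)
  qed
qed measurable

lemma rapid_integrable:
  fixes h :: "'a::euclidean_space \<Rightarrow> complex"
  assumes "rapid h"
  shows "integrable lborel h"
proof -
  have [measurable]: "h \<in> borel_measurable borel" using assms by auto
  obtain C where C: "C > 0" "\<forall>\<xi>. japanese_bracket \<xi> ^ (2 * DIM('a)) * norm (h \<xi>) \<le> C" using assms by (rule rapidE)
  show ?thesis
  proof (rule Bochner_Integration.integrable_bound)
    show "integrable lborel (\<lambda>x::'a. C * (1 / japanese_bracket x ^ (2 * DIM('a))))"
      by (intro integrable_mult_right integrable_japanese_bracket)
    show "AE x in lborel. norm (h x) \<le> norm (C * (1 / japanese_bracket x ^ (2 * DIM('a))))"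
    proof (intro AE_I2)
      fix x :: 'a
      have "norm (h x) \<le> C / japanese_bracket x ^ (2 * DIM('a))"
        using C(2)[rule_format, of x] by (simp add: pos_le_divide_eq mult.commute)
      then show "norm (h x) \<le> norm (C * (1 / japanese_bracket x ^ (2 * DIM('a))))"
        using C(1) less_imp_le[OF japanese_bracket_pos, of x] by (simp add: abs_of_nonneg)
    qed
  qed measurable
qed

section \<open>Fourier transforms of test functions\<close>

lemma smooth_on_linear: "bounded_linear L \<Longrightarrow> smooth_on UNIV L"
  using smooth_on_bounded_linear[OF _ open_UNIV smooth_on_ident] .

lemma smooth_on_cis_compose:
  fixes g :: "'a::euclidean_space \<Rightarrow> real"
  assumes "open S" "smooth_on S g"
  shows "smooth_on S (\<lambda>x. cis (g x))"
  using assms by (intro smooth_on_compose[OF _ open_UNIV _ _ smooth_on_cis]) auto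

lemma bounded_linear_of_real_inner: "bounded_linear (\<lambda>x. complex_of_real (x \<bullet> v))"
  by (intro bounded_linear_compose[OF bounded_linear_of_real bounded_linear_inner_left])

text \<open>The derivative of the product of \<open>f\<close> with the oscillating exponential has
  integral 0; the product rule does the rest.\<close>

lemma fourier_frechet_derivative:
  fixes f :: "'a::euclidean_space \<Rightarrow> complex"
  assumes f: "test_on UNIV f"
  shows "fourier (\<lambda>x. frechet_derivative f (at x) b) \<xi> = \<i> * complex_of_real (b \<bullet> \<xi>) * fourier f \<xi>"
proof -
  have sc: "smooth_on UNIV (\<lambda>x::'a. cis (- (x \<bullet> \<xi>)))"
    by (intro smooth_on_cis_compose open_UNIV smooth_on_linear bounded_linear_minus bounded_linear_inner_left)
  have F: "test_on UNIV (\<lambda>x. cis (- (x \<bullet> \<xi>)) * f x)"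
    by (rule test_on_mult_left[OF f open_UNIV sc])
  have "((\<lambda>x. cis (- (x \<bullet> \<xi>)) * f x) has_derivative
      (\<lambda>v. cis (- (x \<bullet> \<xi>)) * frechet_derivative f (at x) v + ((- (v \<bullet> \<xi>)) *\<^sub>R (\<i> * cis (- (x \<bullet> \<xi>)))) * f x)) (at x)" for x
    by (intro has_derivative_mult test_on_has_derivative[OF f] has_derivative_cis) (auto intro!: derivative_eq_intros)
  then have D: "frechet_derivative (\<lambda>x. cis (- (x \<bullet> \<xi>)) * f x) (at x) b =
      cis (- (x \<bullet> \<xi>)) * frechet_derivative f (at x) b - (\<i> * complex_of_real (b \<bullet> \<xi>)) * (cis (- (x \<bullet> \<xi>)) * f x)" for x
    by (subst frechet_derivative_at[symmetric]) (auto simp: scaleR_conv_of_real mult_ac)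
  have i1: "integrable lborel (\<lambda>x. cis (- (x \<bullet> \<xi>)) * frechet_derivative f (at x) b)"
    by (intro integrable_cis_mult test_on_integrable[OF test_on_frechet_derivative[OF f]]) measurable
  have i2: "integrable lborel (\<lambda>x. cis (- (x \<bullet> \<xi>)) * f x)"
    by (intro integrable_cis_mult test_on_integrable[OF f]) measurable
  have "0 = (\<integral>x. frechet_derivative (\<lambda>x. cis (- (x \<bullet> \<xi>)) * f x) (at x) b \<partial>lborel)"
    by (rule integral_frechet_derivative_eq_0[OF F, symmetric])
  also have "\<dots> = fourier (\<lambda>x. frechet_derivative f (at x) b) \<xi> - \<i> * complex_of_real (b \<bullet> \<xi>) * fourier f \<xi>"
    unfolding D fourier_def using i1 i2 by simp
  finally show ?thesis by simp
qed

lemma japanese_bracket_le_sum: "japanese_bracket \<xi> \<le> 1 + (\<Sum>b\<in>Basis. \<bar>\<xi> \<bullet> b\<bar>)"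
  using japanese_bracket_le[of \<xi>] norm_le_l1[of \<xi>] by simp

text \<open>Induction on \<open>N\<close> over all \<open>f\<close>: the bracket is at most 1 plus
  the sum of the moduli of the coordinates of \<xi>, and each coordinate is traded for a derivative
  of \<open>f\<close>.\<close>

lemma fourier_test_on_rapid:
  fixes f :: "'a::euclidean_space \<Rightarrow> complex"
  assumes "test_on UNIV f"
  shows "rapid (fourier f)"
proof -
  have "\<exists>C. \<forall>\<xi>. japanese_bracket \<xi> ^ N * norm (fourier f \<xi>) \<le> C" for N
    using assms
  proof (induction N arbitrary: f)
    case 0
    then show ?case using norm_fourier_le by auto
  next
    case (Suc N)
    obtain C where C: "\<forall>\<xi>. japanese_bracket \<xi> ^ N * norm (fourier f \<xi>) \<le> C" using Suc by blast
    have "\<forall>b. \<exists>C. \<forall>\<xi>. japanese_bracket \<xi> ^ N * norm (fourier (\<lambda>x. frechet_derivative f (at x) b) \<xi>) \<le> C"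
      using Suc.IH test_on_frechet_derivative[OF Suc.prems] by blast
    then obtain D where D: "\<forall>b \<xi>. japanese_bracket \<xi> ^ N * norm (fourier (\<lambda>x. frechet_derivative f (at x) b) \<xi>) \<le> D b"
      by (metis (no_types))
    have "japanese_bracket \<xi> ^ Suc N * norm (fourier f \<xi>) \<le> C + (\<Sum>b\<in>Basis. D b)" for \<xi>
    proof -
      have "japanese_bracket \<xi> ^ Suc N * norm (fourier f \<xi>) \<le>
         (1 + (\<Sum>b\<in>Basis. \<bar>\<xi> \<bullet> b\<bar>)) * (japanese_bracket \<xi> ^ N * norm (fourier f \<xi>))"
        using mult_right_mono[OF japanese_bracket_le_sum[of \<xi>], of "japanese_bracket \<xi> ^ N * norm (fourier f \<xi>)"]
          less_imp_le[OF japanese_bracket_pos, of \<xi>]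
        by (simp add: mult.assoc)
      also have "\<dots> = japanese_bracket \<xi> ^ N * norm (fourier f \<xi>) +
        (\<Sum>b\<in>Basis. japanese_bracket \<xi> ^ N * norm (fourier (\<lambda>x. frechet_derivative f (at x) b) \<xi>))"
        by (simp add: fourier_frechet_derivative[OF Suc.prems] norm_mult distrib_right sum_distrib_right inner_commute mult.left_commute
          distrib_left sum_distrib_left)
      also have "\<dots> \<le> C + (\<Sum>b\<in>Basis. D b)"
        using C D by (intro add_mono sum_mono) auto
      finally show ?thesis .
    qed
    then show ?case by blast
  qed
  then show ?thesis using assms by (auto simp: rapid_def)
qed

lemma test_on_mult_inner:
  assumes f: "test_on UNIV f"
  shows "test_on UNIV (\<lambda>x. - \<i> * complex_of_real (x \<bullet> v) * f x)"
  by (intro test_on_mult_left[OF f open_UNIV] smooth_on_linear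
      bounded_linear_compose[OF bounded_linear_mult_right bounded_linear_of_real_inner])

text \<open>A Taylor estimate of second order; factoring out \<open>cis (- s)\<close> makes it
  uniform in \<open>s\<close>.\<close>

lemma norm_cis_diff_le: "norm (cis (- (s + t)) - cis (- s) + \<i> * complex_of_real t * cis (- s)) \<le> t\<^sup>2"
proof -
  have "cmod (iexp (- t) - (\<Sum>k\<le>1. (\<i> * complex_of_real (- t)) ^ k / fact k)) \<le> \<bar>- t\<bar> ^ Suc 1 / fact (Suc 1)"
    by (rule iexp_approx1)
  then have 1: "norm (cis (- t) - 1 + \<i> * complex_of_real t) \<le> t\<^sup>2 / 2"
    by (simp add: cis_conv_exp algebra_simps power2_eq_square)
  have "cis (- (s + t)) - cis (- s) + \<i> * complex_of_real t * cis (- s) = cis (- s) * (cis (- t) - 1 + \<i> * complex_of_real t)"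
    by (simp add: algebra_simps cis_mult)
  then have "norm (cis (- (s + t)) - cis (- s) + \<i> * complex_of_real t * cis (- s)) = norm (cis (- t) - 1 + \<i> * complex_of_real t)"
    by (simp add: norm_mult)
  also have "\<dots> \<le> t\<^sup>2" using 1 zero_le_power2[of t] by linarith
  finally show ?thesis .
qed

text \<open>Differentiation under the integral sign with an explicit remainder: the second moment of
  \<open>f\<close> is finite by compact support and bounds the error by a multiple of the squared
  increment.\<close>

lemma fourier_has_derivative:
  fixes f :: "'a::euclidean_space \<Rightarrow> complex"
  assumes f: "test_on UNIV f"
  shows "(fourier f has_derivative (\<lambda>v. fourier (\<lambda>x. - \<i> * complex_of_real (x \<bullet> v) * f x) \<xi>)) (at \<xi>)"
proof -
  have [measurable]: "f \<in> borel_measurable borel" using f by auto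
  define D where "D v = fourier (\<lambda>x. - \<i> * complex_of_real (x \<bullet> v) * f x) \<xi>" for v
  have i0: "integrable lborel (\<lambda>x. cis (- (x \<bullet> \<eta>)) * f x)" for \<eta>
    by (intro integrable_cis_mult test_on_integrable[OF f]) measurable
  have iv: "integrable lborel (\<lambda>x. cis (- (x \<bullet> \<xi>)) * (- \<i> * complex_of_real (x \<bullet> v) * f x))" for v
    by (intro integrable_cis_mult test_on_integrable[OF test_on_mult_inner[OF f]]) measurable
  have "linear D"
  proof (rule linearI)
    fix u v :: 'a and c :: real
    have "D (u + v) = (\<integral>x. cis (- (x \<bullet> \<xi>)) * (- \<i> * complex_of_real (x \<bullet> u) * f x) + cis (- (x \<bullet> \<xi>)) * (- \<i> * complex_of_real (x \<bullet> v) * f x) \<partial>lborel)"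
      unfolding D_def fourier_def by (intro Bochner_Integration.integral_cong) (auto simp: inner_add_right algebra_simps)
    also have "\<dots> = D u + D v"
      unfolding D_def fourier_def by (rule Bochner_Integration.integral_add[OF iv iv])
    finally show "D (u + v) = D u + D v" .
    have "D (c *\<^sub>R u) = (\<integral>x. c *\<^sub>R (cis (- (x \<bullet> \<xi>)) * (- \<i> * complex_of_real (x \<bullet> u) * f x)) \<partial>lborel)"
      unfolding D_def fourier_def by (intro Bochner_Integration.integral_cong) (auto simp: scaleR_conv_of_real algebra_simps)
    then show "D (c *\<^sub>R u) = c *\<^sub>R D u"
      unfolding D_def fourier_def by simp
  qed
  then have bl: "bounded_linear D" by (simp add: linear_conv_bounded_linear)
  define C where "C = (\<integral>x. (norm x)\<^sup>2 * norm (f x) \<partial>lborel)"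
  have iC: "integrable lborel (\<lambda>x. (norm x)\<^sup>2 * norm (f x))"
  proof -
    obtain K where K: "smooth_on UNIV f" "compact K" "\<forall>x. x \<notin> K \<longrightarrow> f x = 0" using f by (rule test_onE)
    have "integrable lborel (\<lambda>x. complex_of_real ((norm x)\<^sup>2) * f x)"
      using K by (intro compact_support_integrable[of _ K] continuous_intros smooth_on_imp_continuous_on) auto
    from integrable_norm[OF this] show ?thesis by (simp add: norm_mult norm_power)
  qed
  have est: "norm (fourier f \<eta> - fourier f \<xi> - D (\<eta> - \<xi>)) \<le> C * (norm (\<eta> - \<xi>))\<^sup>2" for \<eta>
  proof -
    let ?g = "\<lambda>x. cis (- (x \<bullet> \<eta>)) * f x - cis (- (x \<bullet> \<xi>)) * f x - cis (- (x \<bullet> \<xi>)) * (- \<i> * complex_of_real (x \<bullet> (\<eta> - \<xi>)) * f x)"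
    have eq: "fourier f \<eta> - fourier f \<xi> - D (\<eta> - \<xi>) = (\<integral>x. ?g x \<partial>lborel)"
      unfolding D_def fourier_def using i0 iv by simp
    have "norm (fourier f \<eta> - fourier f \<xi> - D (\<eta> - \<xi>)) \<le> (\<integral>x. norm (?g x) \<partial>lborel)"
      unfolding eq by (rule integral_norm_bound)
    also have "\<dots> \<le> (\<integral>x. (norm (\<eta> - \<xi>))\<^sup>2 * ((norm x)\<^sup>2 * norm (f x)) \<partial>lborel)"
    proof (rule integral_mono)
      show "integrable lborel (\<lambda>x. norm (?g x))"
        by (rule integrable_norm[OF Bochner_Integration.integrable_diff[OF Bochner_Integration.integrable_diff[OF i0 i0] iv]])
      show "integrable lborel (\<lambda>x. (norm (\<eta> - \<xi>))\<^sup>2 * ((norm x)\<^sup>2 * norm (f x)))" using iC by (rule integrable_mult_right)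
      fix x
      let ?s = "x \<bullet> \<xi>" and ?t = "x \<bullet> (\<eta> - \<xi>)"
      have "?g x = (cis (- (?s + ?t)) - cis (- ?s) + \<i> * complex_of_real ?t * cis (- ?s)) * f x"
      proof -
        have "cis (- (s + t)) * z - cis (- s) * z - cis (- s) * (- \<i> * complex_of_real t * z) =
          (cis (- (s + t)) - cis (- s) + \<i> * complex_of_real t * cis (- s)) * z" for s t z
          by (simp add: left_diff_distrib distrib_right)
        moreover have "x \<bullet> \<eta> = ?s + ?t" by (simp add: inner_diff_right)
        ultimately show ?thesis by (simp only:)
      qed
      then have "norm (?g x) \<le> ?t\<^sup>2 * norm (f x)"
        using norm_cis_diff_le[of ?s ?t] by (simp add: norm_mult mult_right_mono)
      also have "?t\<^sup>2 \<le> (norm x * norm (\<eta> - \<xi>))\<^sup>2"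
        by (rule power2_le_iff_abs_le[THEN iffD2]) (auto intro: Cauchy_Schwarz_ineq2)
      finally show "norm (?g x) \<le> (norm (\<eta> - \<xi>))\<^sup>2 * ((norm x)\<^sup>2 * norm (f x))"
        by (simp add: power_mult_distrib mult_ac mult_right_mono)
    qed
    finally show ?thesis by (simp add: C_def mult.commute)
  qed
  have "(fourier f has_derivative D) (at \<xi>)"
  proof (rule has_derivativeI_sandwich[of 1 _ _ _ _ "\<lambda>\<eta>. C * norm (\<eta> - \<xi>)"])
    fix \<eta> assume "\<eta> \<noteq> \<xi>"
    then show "norm (fourier f \<eta> - fourier f \<xi> - D (\<eta> - \<xi>)) / norm (\<eta> - \<xi>) \<le> C * norm (\<eta> - \<xi>)"
      using est[of \<eta>] by (simp add: pos_divide_le_eq power2_eq_square mult.assoc)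
  next
    have "((\<lambda>\<eta>. C * norm (\<eta> - \<xi>)) \<longlongrightarrow> C * norm (\<xi> - \<xi>)) (at \<xi>)" by (intro tendsto_intros)
    then show "((\<lambda>\<eta>. C * norm (\<eta> - \<xi>)) \<longlongrightarrow> 0) (at \<xi>)" by simp
  qed (use bl in auto)
  then show ?thesis by (simp add: D_def[abs_def])
qed

lemma smooth_on_fourier:
  assumes "test_on UNIV f"
  shows "smooth_on UNIV (fourier f)"
proof -
  have "Ck_on k UNIV (fourier f)" for k
    using assms
  proof (induction k arbitrary: f)
    case 0
    then show ?case
      by (auto intro!: continuous_at_imp_continuous_on has_derivative_continuous fourier_has_derivative)
  next
    case (Suc k)
    show ?case
      by (rule Ck_on_SucI[OF open_UNIV fourier_has_derivative[OF Suc.prems]])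
        (rule Suc.IH[OF test_on_mult_inner[OF Suc.prems]])
  qed
  then show ?thesis by (simp add: smooth_on_def)
qed

text \<open>Differentiating a transform multiplies \<open>f\<close> by a linear function, which
  keeps it a test function. So the decay of transforms already contains the decay of all their
  derivatives.\<close>

lemma iter_deriv_fourier:
  assumes "test_on UNIV f"
  shows "\<exists>g. test_on UNIV g \<and> iter_deriv vs (fourier f) = fourier g"
proof (induction vs)
  case Nil
  then show ?case using assms by auto
next
  case (Cons v vs)
  then obtain g where g: "test_on UNIV g" "iter_deriv vs (fourier f) = fourier g" by blast
  have "frechet_derivative (fourier g) (at x) v = fourier (\<lambda>y. - \<i> * complex_of_real (y \<bullet> v) * g y) x" for x
    using frechet_derivative_at[OF fourier_has_derivative[OF g(1), of x]] by metis
  then show ?case using g test_on_mult_inner[OF g(1), of v] by auto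
qed

lemma iter_deriv_test_on: "test_on S f \<Longrightarrow> test_on S (iter_deriv vs f)"
  by (induction vs) (auto intro: test_on_frechet_derivative)

lemma test_on_schwartz:
  assumes f: "test_on UNIV f"
  shows "f \<in> schwartz"
  unfolding schwartz_def
proof (intro CollectI conjI allI impI)
  show "smooth_on UNIV f" using f by (rule test_on_smooth)
  fix N vs
  have "test_on UNIV (iter_deriv vs f)" using f by (rule iter_deriv_test_on)
  then obtain K where K: "smooth_on UNIV (iter_deriv vs f)" "compact K" "\<forall>x. x \<notin> K \<longrightarrow> iter_deriv vs f x = 0"
    by (rule test_onE)
  have "continuous_on UNIV (\<lambda>x. (1 + norm x) ^ N * norm (iter_deriv vs f x))"
    using K(1) by (intro continuous_intros smooth_on_imp_continuous_on)
  then obtain B where "\<forall>x. norm ((1 + norm x) ^ N * norm (iter_deriv vs f x)) \<le> B"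
    by (rule compact_support_bounded[OF _ K(2)]) (use K(3) in auto)
  then show "bounded (range (\<lambda>x. (1 + norm x) ^ N * norm (iter_deriv vs f x)))"
    by (auto simp: bounded_iff)
qed

text \<open>Needed for \<open>fourier_distribution\<close>: a distribution is specified on Schwartz
  functions only, so \<open>fourier f\<close> has to be one before it can be inserted.\<close>

lemma fourier_test_on_schwartz:
  assumes f: "test_on UNIV f"
  shows "fourier f \<in> schwartz"
  unfolding schwartz_def
proof (intro CollectI conjI allI impI)
  show "smooth_on UNIV (fourier f)" using f by (rule smooth_on_fourier)
  fix N vs
  obtain g where g: "test_on UNIV g" "iter_deriv vs (fourier f) = fourier g"
    using iter_deriv_fourier[OF f] by blast
  obtain C where C: "\<forall>\<xi>. japanese_bracket \<xi> ^ N * norm (fourier g \<xi>) \<le> C"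
    by (rule rapidE[OF fourier_test_on_rapid[OF g(1)]])
  have "norm ((1 + norm x) ^ N * norm (fourier g x)) \<le> 2 ^ N * C" for x
  proof -
    have "norm ((1 + norm x) ^ N * norm (fourier g x)) = (1 + norm x) ^ N * norm (fourier g x)" by simp
    also have "\<dots> \<le> (2 * japanese_bracket x) ^ N * norm (fourier g x)"
      using norm_le_japanese_bracket[of x] japanese_bracket_ge_1[of x] by (intro mult_right_mono power_mono) auto
    also have "\<dots> = 2 ^ N * (japanese_bracket x ^ N * norm (fourier g x))" by (simp add: power_mult_distrib)
    also have "\<dots> \<le> 2 ^ N * C" using C by (intro mult_left_mono) auto
    finally show ?thesis .
  qed
  then show "bounded (range (\<lambda>x. (1 + norm x) ^ N * norm (iter_deriv vs (fourier f) x)))"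
    unfolding g(2) by (auto simp: bounded_iff)
qed

section \<open>The Sobolev norm of a test function\<close>

text \<open>Local integrability gives measurability of the restrictions to balls, and
  \<open>f\<close> is their pointwise limit.\<close>

lemma represents_measurable:
  assumes "represents f w"
  shows "f \<in> borel_measurable borel"
proof (rule borel_measurable_LIMSEQ_metric)
  fix n :: nat
  have "set_integrable lborel (cball 0 (real n)) f" using assms by (simp add: represents_def)
  then show "(\<lambda>x. indicator (cball 0 (real n)) x *\<^sub>R f x) \<in> borel_measurable borel"
    unfolding set_integrable_def by auto
next
  fix x :: 'a
  obtain N where N: "norm x \<le> real N" using real_arch_simple by blast
  have "\<forall>\<^sub>F n in sequentially. f x = indicator (cball 0 (real n)) x *\<^sub>R f x"
    using N by (auto simp: eventually_sequentially intro!: exI[of _ N])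
  then show "(\<lambda>n. indicator (cball 0 (real n)) x *\<^sub>R f x) \<longlonglongrightarrow> f x"
    by (rule Lim_transform_eventually[OF tendsto_const])
qed

text \<open>The fundamental lemma of the calculus of variations. It is what makes the Sobolev norm
  independent of the representative that \<open>fourier_density\<close> selects.\<close>

lemma represents_unique:
  fixes f g :: "'a::euclidean_space \<Rightarrow> complex"
  assumes f: "represents f w" and g: "represents g w"
  shows "AE x in lborel. f x = g x"
proof -
  have [measurable]: "f \<in> borel_measurable borel" "g \<in> borel_measurable borel"
    using f g by (auto intro: represents_measurable)
  define d where "d x = f x - g x" for x
  have [measurable]: "d \<in> borel_measurable borel" unfolding d_def by measurable
  have dK: "set_integrable lborel K d" if "compact K" for K
    unfolding d_def using f g that by (auto simp: represents_def intro: set_integral_diff)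
  have d0: "(\<integral>x. d x * \<psi> x \<partial>lborel) = 0" if \<psi>: "test_on UNIV \<psi>" for \<psi>
  proof -
    have [measurable]: "\<psi> \<in> borel_measurable borel" using \<psi> by auto
    obtain K where K: "smooth_on UNIV \<psi>" "compact K" "\<forall>x. x \<notin> K \<longrightarrow> \<psi> x = 0" using \<psi> by (rule test_onE)
    obtain B where B: "B > 0" "\<forall>x. norm (\<psi> x) \<le> B" using \<psi> by (rule test_on_bounded)
    have int: "integrable lborel (\<lambda>x. h x * \<psi> x)" if "set_integrable lborel K h" "h \<in> borel_measurable borel" for h :: "'a \<Rightarrow> complex"
    proof (rule Bochner_Integration.integrable_bound)
      show "integrable lborel (\<lambda>x. B *\<^sub>R (indicator K x *\<^sub>R h x))"
        using that(1) unfolding set_integrable_def by (rule integrable_scaleR_right)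
      show "AE x in lborel. norm (h x * \<psi> x) \<le> norm (B *\<^sub>R (indicator K x *\<^sub>R h x))"
        using B K(3) by (intro AE_I2) (auto simp: norm_mult mult.commute[of "cmod (h _)"] mult_right_mono split: split_indicator)
      show "(\<lambda>x. h x * \<psi> x) \<in> borel_measurable lborel" using that(2) by measurable
    qed
    have "(\<integral>x. d x * \<psi> x \<partial>lborel) = (\<integral>x. f x * \<psi> x - g x * \<psi> x \<partial>lborel)"
      by (simp add: d_def left_diff_distrib)
    also have "\<dots> = (\<integral>x. f x * \<psi> x \<partial>lborel) - (\<integral>x. g x * \<psi> x \<partial>lborel)"
      using f g K(2) by (intro Bochner_Integration.integral_diff int) (auto simp: represents_def)
    also have "\<dots> = 0"
      using f g \<psi> by (simp add: represents_def test_functions_iff)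
    finally show ?thesis .
  qed
  \<comment> \<open>The indicator of a compact set is a bounded pointwise limit of test functions
    living in shrinking neighbourhoods, so the difference \<open>d\<close> has integral 0 over every
    compact set.\<close>
  have c0: "(\<integral>x. indicator K x *\<^sub>R d x \<partial>lborel) = 0" if K: "compact K" for K
  proof -
    define U where "U n = (\<Union>x\<in>K. ball x (1 / real (Suc n)))" for n
    have oU: "open (U n)" "K \<subseteq> U n" for n by (auto simp: U_def intro!: bexI)
    obtain R where R: "\<forall>x\<in>K. norm x \<le> R" using compact_imp_bounded[OF K] by (auto simp: bounded_iff)
    have UR: "U n \<subseteq> cball 0 (R + 1)" for n
    proof
      fix y assume "y \<in> U n"
      then obtain x where x: "x \<in> K" "dist x y < 1 / real (Suc n)" by (auto simp: U_def)
      have "norm y \<le> norm x + dist x y" using norm_triangle_sub[of y x] by (simp add: dist_norm norm_minus_commute)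
      also have "dist x y \<le> 1" using x(2) by (smt (verit) divide_le_eq_1 of_nat_Suc of_nat_0_le_iff)
      finally show "y \<in> cball 0 (R + 1)" using R x(1) by force
    qed
    have "\<exists>\<psi>::'a \<Rightarrow> real. smooth_on UNIV \<psi> \<and> (\<forall>x\<in>K. \<psi> x = 1) \<and> (\<exists>C. compact C \<and> C \<subseteq> U n \<and> (\<forall>x. x \<notin> C \<longrightarrow> \<psi> x = 0)) \<and> (\<forall>x. 0 \<le> \<psi> x \<and> \<psi> x \<le> 1)" for n
      by (rule smooth_urysohn[OF K oU]) auto
    then have "\<forall>n. \<exists>\<psi>::'a \<Rightarrow> real. smooth_on UNIV \<psi> \<and> (\<forall>x\<in>K. \<psi> x = 1) \<and> (\<exists>C. compact C \<and> C \<subseteq> U n \<and> (\<forall>x. x \<notin> C \<longrightarrow> \<psi> x = 0)) \<and> (\<forall>x. 0 \<le> \<psi> x \<and> \<psi> x \<le> 1)"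
      by simp
    then obtain \<psi> :: "nat \<Rightarrow> 'a \<Rightarrow> real" where \<psi>: "\<forall>n. smooth_on UNIV (\<psi> n) \<and> (\<forall>x\<in>K. \<psi> n x = 1) \<and>
       (\<exists>C. compact C \<and> C \<subseteq> U n \<and> (\<forall>x. x \<notin> C \<longrightarrow> \<psi> n x = 0)) \<and> (\<forall>x. 0 \<le> \<psi> n x \<and> \<psi> n x \<le> 1)"
      unfolding choice_iff by (elim exE)
    have tst: "test_on UNIV (\<lambda>x. complex_of_real (\<psi> n x))" for n
      using \<psi>[rule_format, of n] unfolding test_on_def
      by (auto intro!: smooth_on_bounded_linear[OF bounded_linear_of_real])
    have out: "\<psi> n x = 0" if "x \<notin> U n" for n x using \<psi> that by (metis subsetD)
    have [measurable]: "\<psi> n \<in> borel_measurable borel" for n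
      using \<psi> by (intro borel_measurable_continuous_onI smooth_on_imp_continuous_on) auto
    have "(\<lambda>n. \<integral>x. d x * complex_of_real (\<psi> n x) \<partial>lborel) \<longlonglongrightarrow> (\<integral>x. indicator K x *\<^sub>R d x \<partial>lborel)"
    proof (rule integral_dominated_convergence)
      show "integrable lborel (\<lambda>x. norm (indicator (cball 0 (R + 1)) x *\<^sub>R d x))"
        using dK[of "cball 0 (R + 1)"] unfolding set_integrable_def by (intro integrable_norm) auto
      show "AE x in lborel. norm (d x * complex_of_real (\<psi> n x)) \<le> norm (indicator (cball 0 (R + 1)) x *\<^sub>R d x)" for n
      proof (intro AE_I2)
        fix x
        show "norm (d x * complex_of_real (\<psi> n x)) \<le> norm (indicator (cball 0 (R + 1)) x *\<^sub>R d x)"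
        proof (cases "x \<in> U n")
          case True
          then have "x \<in> cball 0 (R + 1)" using UR by blast
          then show ?thesis using \<psi> by (auto simp: norm_mult intro!: mult_left_le)
        qed (simp add: out)
      qed
      show "AE x in lborel. (\<lambda>n. d x * complex_of_real (\<psi> n x)) \<longlonglongrightarrow> indicator K x *\<^sub>R d x"
      proof (intro AE_I2)
        fix x
        show "(\<lambda>n. d x * complex_of_real (\<psi> n x)) \<longlonglongrightarrow> indicator K x *\<^sub>R d x"
        proof (cases "x \<in> K")
          case True
          then show ?thesis using \<psi> by simp
        next
          case False
          have "open (- K)" using K by (simp add: compact_imp_closed open_Compl)
          then obtain e where e: "e > 0" "ball x e \<subseteq> - K" using False open_contains_ball by blast
          obtain N where N: "1 / real (Suc N) < e" using nat_approx_posE[OF e(1)] by blast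
          have "x \<notin> U n" if "n \<ge> N" for n
          proof
            assume "x \<in> U n"
            then obtain y where y: "y \<in> K" "dist y x < 1 / real (Suc n)" by (auto simp: U_def)
            have "1 / real (Suc n) \<le> 1 / real (Suc N)" using that by (intro divide_left_mono) auto
            then have "y \<in> ball x e" using y(2) N by (simp add: dist_commute)
            then show False using e(2) y(1) by blast
          qed
          then have "\<forall>\<^sub>F n in sequentially. 0 = d x * complex_of_real (\<psi> n x)"
            using out by (auto simp: eventually_sequentially intro!: exI[of _ N])
          then show ?thesis using False by (auto intro: Lim_transform_eventually[OF tendsto_const])
        qed
      qed
    qed (use K in \<open>auto simp: compact_imp_closed\<close>)
    then have "(\<lambda>n::nat. 0::complex) \<longlonglongrightarrow> (\<integral>x. indicator K x *\<^sub>R d x \<partial>lborel)"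
      unfolding d0[OF tst] .
    then show ?thesis using LIMSEQ_unique[OF _ tendsto_const] by metis
  qed
  \<comment> \<open>Vanishing integrals over closed sets, a generator stable under intersection,
    extend to all Borel sets, and a function with this property is 0 almost everywhere. Restricting
    to a ball makes it integrable.\<close>
  have loc: "AE x in lborel. indicator (cball 0 (real n)) x *\<^sub>R d x = 0" for n :: nat
  proof (rule sigma_finite_measure.density_zero[OF sigma_finite_lborel])
    let ?B = "cball (0::'a) (real n)"
    let ?h = "\<lambda>x. indicator ?B x *\<^sub>R d x"
    show ih: "integrable lborel ?h" using dK[of ?B] by (simp add: set_integrable_def)
    have ihA: "set_integrable lborel A ?h" if "A \<in> sets borel" for A
      unfolding set_integrable_def by (rule integrable_mult_indicator) (use that ih in auto)
    fix A :: "'a set" assume "A \<in> sets lborel"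
    then have sA: "A \<in> sigma_sets UNIV (Collect closed)"
      by (simp add: borel_eq_closed)
    have st: "Int_stable (Collect closed :: 'a set set)" by (auto simp: Int_stable_def)
    have pw: "Collect closed \<subseteq> Pow (UNIV :: 'a set)" by auto
    from st pw sA show "set_lebesgue_integral lborel A ?h = 0"
    proof (induction rule: sigma_sets_induct_disjoint)
      case (basic A)
      then have "compact (A \<inter> ?B)" by (simp add: closed_Int_compact)
      from c0[OF this] show ?case by (simp add: set_lebesgue_integral_def indicator_inter_arith)
    next
      case empty then show ?case by (simp add: set_lebesgue_integral_def)
    next
      case (compl A)
      then have A: "A \<in> sets borel" by (simp add: borel_eq_closed)
      have "set_lebesgue_integral lborel UNIV ?h = set_lebesgue_integral lborel (A \<union> (UNIV - A)) ?h" by simp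
      also have "\<dots> = set_lebesgue_integral lborel A ?h + set_lebesgue_integral lborel (UNIV - A) ?h"
        using A by (intro set_integral_Un ihA) auto
      finally show ?case using compl c0[of ?B] by (simp add: set_lebesgue_integral_def)
    next
      case (union A)
      then have A: "A i \<in> sets borel" for i by (auto simp: borel_eq_closed)
      have "set_lebesgue_integral lborel (\<Union>i. A i) ?h = (\<Sum>i. set_lebesgue_integral lborel (A i) ?h)"
        using A union(1) by (intro lebesgue_integral_countable_add ihA) (auto simp: disjoint_family_on_def)
      then show ?case using union by simp
    qed
  qed
  have "AE x in lborel. \<forall>n. indicator (cball 0 (real n)) x *\<^sub>R d x = 0"
    unfolding AE_all_countable using loc by blast
  then show ?thesis
  proof eventually_elim
    case (elim x)
    obtain N where "norm x \<le> real N" using real_arch_simple by blast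
    then show ?case using elim[rule_format, of N] by (auto simp: d_def)
  qed
qed

definition sobolev_weight :: "real \<Rightarrow> (real \<Rightarrow> real) \<Rightarrow> 'a::euclidean_space \<Rightarrow> real" where
  "sobolev_weight s \<phi> \<xi> = japanese_bracket \<xi> powr (2 * s) * (\<phi> (japanese_bracket \<xi>))\<^sup>2"

lemma sobolev_weight_nonneg [simp]: "0 \<le> sobolev_weight s \<phi> \<xi>"
  by (simp add: sobolev_weight_def)

lemma borel_measurable_sobolev_weight:
  assumes "\<phi> \<in> class_M"
  shows "sobolev_weight s \<phi> \<in> borel_measurable borel"
proof -
  have p: "\<phi> \<in> borel_measurable (restrict_space borel {1..})" using assms by (simp add: class_M_def)
  have "japanese_bracket \<in> borel \<rightarrow>\<^sub>M restrict_space borel {1..}"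
    by (rule measurable_restrict_space2) (auto simp: japanese_bracket_ge_1)
  then have [measurable]: "(\<lambda>\<xi>. \<phi> (japanese_bracket \<xi>)) \<in> borel_measurable borel"
    using p by (rule measurable_compose)
  show ?thesis unfolding sobolev_weight_def[abs_def] by measurable
qed

lemma represents_fourier:
  assumes f: "test_on UNIV f"
  shows "represents (fourier f) (fourier_distribution (regular_distribution f))"
  unfolding represents_def
proof (intro conjI allI impI ballI)
  fix K :: "'a set" assume "compact K"
  then show "set_integrable lborel K (fourier f)"
    unfolding set_integrable_def
    by (intro integrable_mult_indicator rapid_integrable fourier_test_on_rapid f) (auto simp: compact_imp_closed)
next
  fix g :: "'a \<Rightarrow> complex" assume "g \<in> test_functions"
  then have g: "test_on UNIV g" by (simp add: test_functions_iff)
  have "fourier_distribution (regular_distribution f) g = (\<integral>x. f x * fourier g x \<partial>lborel)"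
    using test_on_schwartz[OF g] fourier_test_on_schwartz[OF g]
    by (simp add: fourier_distribution_def regular_distribution_def)
  also have "\<dots> = (\<integral>x. fourier f x * g x \<partial>lborel)"
    using fourier_multiplication_formula[OF test_on_integrable[OF f] test_on_integrable[OF g]] by simp
  finally show "fourier_distribution (regular_distribution f) g = (\<integral>x. fourier f x * g x \<partial>lborel)" .
qed

text \<open>The chosen density is replaced by \<open>fourier f\<close>. Written with
  \<open>enn2real\<close>, the identity holds before finiteness is known: a divergent Bochner
  integral is 0, and so is \<open>enn2real\<close> of infinity.\<close>

lemma sobolev_norm_regular_distribution:
  assumes f: "test_on UNIV f" and \<phi>: "\<phi> \<in> class_M"
  shows "(sobolev_norm s \<phi> (regular_distribution f))\<^sup>2 =
    enn2real (\<integral>\<^sup>+\<xi>. ennreal (sobolev_weight s \<phi> \<xi> * (norm (fourier f \<xi>))\<^sup>2) \<partial>lborel)"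
proof -
  let ?w = "fourier_distribution (regular_distribution f)"
  let ?d = "fourier_density (regular_distribution f)"
  have [measurable]: "f \<in> borel_measurable borel" using f by auto
  have [measurable]: "sobolev_weight s \<phi> \<in> borel_measurable (borel :: 'a measure)"
    using \<phi> by (rule borel_measurable_sobolev_weight)
  have d: "represents ?d ?w"
    unfolding fourier_density_def using represents_fourier[OF f]
    by (rule someI[where P="\<lambda>h. represents h ?w"])
  have [measurable]: "?d \<in> borel_measurable borel" using d by (rule represents_measurable)
  have ae: "AE x in lborel. ?d x = fourier f x"
    using d represents_fourier[OF f] by (rule represents_unique)
  have si: "sobolev_integrand s \<phi> (regular_distribution f) = (\<lambda>\<xi>. sobolev_weight s \<phi> \<xi> * (norm (?d \<xi>))\<^sup>2)"
    by (simp add: sobolev_integrand_def sobolev_weight_def fun_eq_iff)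
  have nn: "0 \<le> (\<integral>\<xi>. sobolev_weight s \<phi> \<xi> * (norm (?d \<xi>))\<^sup>2 \<partial>lborel)" by (intro integral_nonneg_AE) auto
  have "(sobolev_norm s \<phi> (regular_distribution f))\<^sup>2 = (\<integral>\<xi>. sobolev_weight s \<phi> \<xi> * (norm (?d \<xi>))\<^sup>2 \<partial>lborel)"
    using nn by (simp add: sobolev_norm_def si)
  also have "\<dots> = (\<integral>\<xi>. sobolev_weight s \<phi> \<xi> * (norm (fourier f \<xi>))\<^sup>2 \<partial>lborel)"
    by (rule integral_cong_AE) (use ae in auto)
  also have "\<dots> = enn2real (\<integral>\<^sup>+\<xi>. ennreal (sobolev_weight s \<phi> \<xi> * (norm (fourier f \<xi>))\<^sup>2) \<partial>lborel)"
    by (rule integral_eq_nn_integral) auto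
  finally show ?thesis .
qed

section \<open>Oscillatory integral operators of a change of variables\<close>

lemma test_on_outside: "test_on U a \<Longrightarrow> x \<notin> U \<Longrightarrow> a x = 0"
  by (auto simp: test_on_def)

text \<open>A diffeomorphism \<kappa> of \<open>U\<close> onto \<open>V\<close> with inverse \<mu>.
  It is Borel on the whole space because the integrals run over the whole space, with amplitudes
  vanishing off \<open>U\<close>.\<close>

locale change_of_variables =
  fixes U V :: "'a::euclidean_space set" and \<kappa> \<mu> :: "'a \<Rightarrow> 'a"
  assumes open_U: "open U" and open_V: "open V"
    and smooth_\<kappa>: "smooth_on U \<kappa>" and smooth_\<mu>: "smooth_on V \<mu>"
    and measurable_\<kappa> [measurable]: "\<kappa> \<in> borel_measurable borel"
    and \<kappa>_V: "\<And>x. x \<in> U \<Longrightarrow> \<kappa> x \<in> V" and \<mu>_U: "\<And>y. y \<in> V \<Longrightarrow> \<mu> y \<in> U"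
    and \<mu>_\<kappa>: "\<And>x. x \<in> U \<Longrightarrow> \<mu> (\<kappa> x) = x" and \<kappa>_\<mu>: "\<And>y. y \<in> V \<Longrightarrow> \<kappa> (\<mu> y) = y"
begin

text \<open>Up to the factor (2 pi)^n this is the kernel, in frequency variables, of multiplying
  \<open>f \<circ> \<kappa>\<close> by \<open>a\<close>; \<xi> is the input frequency and \<eta> the
  output frequency.\<close>

definition kern :: "('a \<Rightarrow> complex) \<Rightarrow> 'a \<Rightarrow> 'a \<Rightarrow> complex" where
  "kern a \<eta> \<xi> = (\<integral>x. cis (\<kappa> x \<bullet> \<xi> - x \<bullet> \<eta>) * a x \<partial>lborel)"

definition jac :: "'a \<Rightarrow> 'a \<Rightarrow> 'a \<Rightarrow> complex" where
  "jac b l x = complex_of_real (frechet_derivative \<kappa> (at x) b \<bullet> l)"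

text \<open>Entries of the inverse Jacobian matrix, pulled back to the source point \<open>x\<close>
  so that they can be multiplied into amplitudes on \<open>U\<close>.\<close>

definition jac_inv :: "'a \<Rightarrow> 'a \<Rightarrow> 'a \<Rightarrow> complex" where
  "jac_inv l b x = complex_of_real (frechet_derivative \<mu> (at (\<kappa> x)) l \<bullet> b)"

lemma smooth_jac: "smooth_on U (jac b l)"
  unfolding jac_def[abs_def]
  by (intro smooth_on_bounded_linear[OF bounded_linear_of_real_inner] open_U
      smooth_on_frechet_derivative smooth_\<kappa>)

lemma smooth_jac_inv: "smooth_on U (jac_inv l b)"
  unfolding jac_inv_def[abs_def]
  by (intro smooth_on_bounded_linear[OF bounded_linear_of_real_inner] open_U
      smooth_on_compose[OF open_U open_V _ smooth_\<kappa> smooth_on_frechet_derivative[OF smooth_\<mu>]])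
    (use \<kappa>_V in auto)

text \<open>Differentiating \<open>\<kappa> (\<mu> y) = y\<close> shows that the two derivatives
  compose to the identity; this is that identity in coordinates.\<close>

lemma jac_inv_jac:
  assumes x: "x \<in> U" and l: "l \<in> Basis" "l' \<in> Basis"
  shows "(\<Sum>b\<in>Basis. jac_inv l b x * jac b l' x) = (if l' = l then 1 else 0)"
proof -
  let ?D = "frechet_derivative \<kappa> (at x)" and ?E = "frechet_derivative \<mu> (at (\<kappa> x))"
  have D: "(\<kappa> has_derivative ?D) (at (\<mu> (\<kappa> x)))"
    using smooth_on_has_derivative[OF smooth_\<kappa> x] by (simp add: \<mu>_\<kappa>[OF x])
  have E: "(\<mu> has_derivative ?E) (at (\<kappa> x))"
    by (rule smooth_on_has_derivative[OF smooth_\<mu> \<kappa>_V[OF x]])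
  have "((\<lambda>y. \<kappa> (\<mu> y)) has_derivative (\<lambda>v. ?D (?E v))) (at (\<kappa> x))"
    by (rule has_derivative_compose[OF E D])
  then have "((\<lambda>y. y) has_derivative (\<lambda>v. ?D (?E v))) (at (\<kappa> x))"
    by (rule has_derivative_transform_within_open[OF _ open_V \<kappa>_V[OF x]]) (rule \<kappa>_\<mu>)
  then have "(\<lambda>v. ?D (?E v)) = (\<lambda>v. v)"
    using has_derivative_unique has_derivative_ident by blast
  then have DE: "?D (?E l) = l" by meson
  have lin: "linear ?D" using D has_derivative_linear by blast
  have "l \<bullet> l' = ?D (\<Sum>b\<in>Basis. (?E l \<bullet> b) *\<^sub>R b) \<bullet> l'"
    by (simp add: euclidean_representation DE)
  also have "\<dots> = (\<Sum>b\<in>Basis. (?E l \<bullet> b) * (?D b \<bullet> l'))"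
    by (simp add: linear_sum[OF lin] linear_scale[OF lin] inner_sum_left)
  finally have "complex_of_real (l \<bullet> l') = (\<Sum>b\<in>Basis. jac_inv l b x * jac b l' x)"
    by (simp add: jac_inv_def jac_def)
  then show ?thesis using l by (simp add: inner_Basis split: if_splits)
qed

lemma kern_integrable:
  "integrable lborel a \<Longrightarrow> integrable lborel (\<lambda>x. cis (\<kappa> x \<bullet> \<xi> - x \<bullet> \<eta>) * a x)"
  by (intro integrable_cis_mult) measurable

lemma norm_kern_le: "norm (kern a \<eta> \<xi>) \<le> (\<integral>x. norm (a x) \<partial>lborel)"
  unfolding kern_def by (rule order_trans[OF integral_norm_bound]) (simp add: norm_mult)

lemma kern_sum:
  assumes "\<And>i. i \<in> I \<Longrightarrow> integrable lborel (a i)"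
  shows "kern (\<lambda>x. \<Sum>i\<in>I. a i x) \<eta> \<xi> = (\<Sum>i\<in>I. kern (a i) \<eta> \<xi>)"
  unfolding kern_def sum_distrib_left
  by (rule Bochner_Integration.integral_sum) (rule kern_integrable[OF assms])

lemma test_on_jac: "test_on U a \<Longrightarrow> test_on U (\<lambda>x. a x * jac b l x)"
  and test_on_jac_inv: "test_on U a \<Longrightarrow> test_on U (\<lambda>x. a x * jac_inv l b x)"
  by (rule test_on_mult_smooth[OF _ open_U smooth_jac], assumption)
    (rule test_on_mult_smooth[OF _ open_U smooth_jac_inv], assumption)

text \<open>Integration by parts in \<open>x\<close>: the derivative of the phase trades a factor \<open>\<eta>\<close> for a
  factor \<open>\<xi>\<close>, with a new amplitude.\<close>

lemma kern_output_frequency: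
  assumes a: "test_on U a"
  shows "complex_of_real (\<eta> \<bullet> b) * kern a \<eta> \<xi> =
    - \<i> * kern (\<lambda>x. frechet_derivative a (at x) b) \<eta> \<xi> +
    (\<Sum>l\<in>Basis. complex_of_real (\<xi> \<bullet> l) * kern (\<lambda>x. a x * jac b l x) \<eta> \<xi>)"
proof -
  let ?E = "\<lambda>x. cis (\<kappa> x \<bullet> \<xi> - x \<bullet> \<eta>)"
  have 1: "smooth_on U (\<lambda>x. \<kappa> x \<bullet> \<xi>)"
    by (rule smooth_on_bounded_linear[OF bounded_linear_inner_left open_U smooth_\<kappa>])
  have 2: "smooth_on U (\<lambda>x. - (x \<bullet> \<eta>))"
    by (rule smooth_on_bounded_linear[OF bounded_linear_minus[OF bounded_linear_inner_left] open_U smooth_on_ident])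
  have "smooth_on U ?E"
    using smooth_on_cis_compose[OF open_U smooth_on_add[OF open_U 1 2]] by simp
  then have F: "test_on U (\<lambda>x. ?E x * a x)" by (rule test_on_mult_left[OF a open_U])
  have D: "frechet_derivative (\<lambda>x. ?E x * a x) (at x) b =
      ?E x * frechet_derivative a (at x) b +
      \<i> * ((\<Sum>l\<in>Basis. complex_of_real (\<xi> \<bullet> l) * (?E x * (a x * jac b l x))) - complex_of_real (\<eta> \<bullet> b) * (?E x * a x))" for x
  proof (cases "x \<in> U")
    case False
    then show ?thesis
      using test_on_outside[OF test_on_frechet_derivative[OF F]]
        test_on_outside[OF test_on_frechet_derivative[OF a]] test_on_outside[OF a] by simp
  next
    case True
    let ?D = "frechet_derivative \<kappa> (at x)"
    have d\<kappa>: "(\<kappa> has_derivative ?D) (at x)" by (rule smooth_on_has_derivative[OF smooth_\<kappa> True])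
    have dp: "((\<lambda>x. \<kappa> x \<bullet> \<xi> - x \<bullet> \<eta>) has_derivative (\<lambda>v. ?D v \<bullet> \<xi> - v \<bullet> \<eta>)) (at x)"
      by (intro has_derivative_diff bounded_linear.has_derivative[OF bounded_linear_inner_left] d\<kappa> has_derivative_ident)
    have "((\<lambda>x. ?E x * a x) has_derivative
      (\<lambda>v. ?E x * frechet_derivative a (at x) v + ((?D v \<bullet> \<xi> - v \<bullet> \<eta>) *\<^sub>R (\<i> * ?E x)) * a x)) (at x)"
      by (intro has_derivative_mult test_on_has_derivative[OF a] has_derivative_cis dp)
    then have "frechet_derivative (\<lambda>x. ?E x * a x) (at x) b =
      ?E x * frechet_derivative a (at x) b + ((?D b \<bullet> \<xi> - b \<bullet> \<eta>) *\<^sub>R (\<i> * ?E x)) * a x"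
      by (subst frechet_derivative_at[symmetric]) auto
    also have "?D b \<bullet> \<xi> = (\<Sum>l\<in>Basis. (?D b \<bullet> l) * (\<xi> \<bullet> l))" by (rule euclidean_inner)
    finally show ?thesis
      by (simp add: jac_def scaleR_conv_of_real inner_commute[of b \<eta>] sum_distrib_left sum_distrib_right algebra_simps)
  qed
  note ia = kern_integrable[OF test_on_integrable[OF a], of \<xi> \<eta>]
  note ida = kern_integrable[OF test_on_integrable[OF test_on_frechet_derivative[OF a]], of \<xi> \<eta> b]
  note ij = kern_integrable[OF test_on_integrable[OF test_on_jac[OF a]], of \<xi> \<eta> b]
  have "0 = (\<integral>x. frechet_derivative (\<lambda>x. ?E x * a x) (at x) b \<partial>lborel)"
    by (rule integral_frechet_derivative_eq_0[OF test_on_mono[OF F], symmetric]) simp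
  also have "\<dots> = kern (\<lambda>x. frechet_derivative a (at x) b) \<eta> \<xi> +
     \<i> * ((\<Sum>l\<in>Basis. complex_of_real (\<xi> \<bullet> l) * kern (\<lambda>x. a x * jac b l x) \<eta> \<xi>) - complex_of_real (\<eta> \<bullet> b) * kern a \<eta> \<xi>)"
    unfolding D kern_def using ia ida ij by simp
  finally have z: "kern (\<lambda>x. frechet_derivative a (at x) b) \<eta> \<xi> +
     \<i> * ((\<Sum>l\<in>Basis. complex_of_real (\<xi> \<bullet> l) * kern (\<lambda>x. a x * jac b l x) \<eta> \<xi>) - complex_of_real (\<eta> \<bullet> b) * kern a \<eta> \<xi>) = 0" by simp
  have "r = - \<i> * p + q" if "p + \<i> * (q - r) = 0" for p q r :: complex
  proof -
    have "- \<i> * (p + \<i> * (q - r)) = 0" using that by simp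
    then show ?thesis by (simp add: algebra_simps)
  qed
  from this[OF z] show ?thesis .
qed

text \<open>The integration by parts identity is summed over \<open>b\<close> with the amplitudes
  \<open>a * jac_inv l b\<close>: by \<open>jac_inv_jac\<close> the input frequencies recombine to
  the single component \<open>\<xi> \<bullet> l\<close>, which is thereby expressed through
  \<eta>.\<close>

lemma kern_input_frequency:
  assumes a: "test_on U a" and l: "l \<in> Basis"
  shows "complex_of_real (\<xi> \<bullet> l) * kern a \<eta> \<xi> =
    (\<Sum>b\<in>Basis. complex_of_real (\<eta> \<bullet> b) * kern (\<lambda>x. a x * jac_inv l b x) \<eta> \<xi> +
      \<i> * kern (\<lambda>x. frechet_derivative (\<lambda>x. a x * jac_inv l b x) (at x) b) \<eta> \<xi>)"
proof -
  let ?m = "\<lambda>b x. a x * jac_inv l b x"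
  have m: "test_on U (?m b)" for b by (rule test_on_jac_inv[OF a])
  have eq: "(\<Sum>b\<in>Basis. kern (\<lambda>x. ?m b x * jac b l' x) \<eta> \<xi>) = (if l' = l then kern a \<eta> \<xi> else 0)" if l': "l' \<in> Basis" for l'
  proof -
    have "(\<Sum>b\<in>Basis. kern (\<lambda>x. ?m b x * jac b l' x) \<eta> \<xi>) = kern (\<lambda>x. \<Sum>b\<in>Basis. ?m b x * jac b l' x) \<eta> \<xi>"
      by (rule kern_sum[symmetric]) (rule test_on_integrable[OF test_on_jac[OF m]])
    also have "(\<lambda>x. \<Sum>b\<in>Basis. ?m b x * jac b l' x) = (\<lambda>x. if l' = l then a x else 0)"
    proof
      fix x
      show "(\<Sum>b\<in>Basis. ?m b x * jac b l' x) = (if l' = l then a x else 0)"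
      proof (cases "x \<in> U")
        case True
        have "(\<Sum>b\<in>Basis. ?m b x * jac b l' x) = a x * (\<Sum>b\<in>Basis. jac_inv l b x * jac b l' x)"
          by (simp add: sum_distrib_left mult.assoc)
        then show ?thesis using jac_inv_jac[OF True l l'] by simp
      qed (simp add: test_on_outside[OF a])
    qed
    also have "kern (\<lambda>x. if l' = l then a x else 0) \<eta> \<xi> = (if l' = l then kern a \<eta> \<xi> else 0)"
      by (simp add: kern_def)
    finally show ?thesis .
  qed
  have "(\<Sum>b\<in>Basis. complex_of_real (\<eta> \<bullet> b) * kern (?m b) \<eta> \<xi>) =
    (\<Sum>b\<in>Basis. - \<i> * kern (\<lambda>x. frechet_derivative (?m b) (at x) b) \<eta> \<xi>) +
    (\<Sum>b\<in>Basis. \<Sum>l'\<in>Basis. complex_of_real (\<xi> \<bullet> l') * kern (\<lambda>x. ?m b x * jac b l' x) \<eta> \<xi>)"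
    unfolding kern_output_frequency[OF m] by (rule sum.distrib)
  also have "(\<Sum>b\<in>Basis. \<Sum>l'\<in>Basis. complex_of_real (\<xi> \<bullet> l') * kern (\<lambda>x. ?m b x * jac b l' x) \<eta> \<xi>) =
    (\<Sum>l'\<in>Basis. complex_of_real (\<xi> \<bullet> l') * (\<Sum>b\<in>Basis. kern (\<lambda>x. ?m b x * jac b l' x) \<eta> \<xi>))"
    unfolding sum_distrib_left by (rule sum.swap)
  also have "\<dots> = (\<Sum>l'\<in>Basis. if l' = l then complex_of_real (\<xi> \<bullet> l') * kern a \<eta> \<xi> else 0)"
    by (intro sum.cong refl) (simp add: eq)
  also have "\<dots> = complex_of_real (\<xi> \<bullet> l) * kern a \<eta> \<xi>"
    using l by (simp add: sum.delta')
  finally show ?thesis by (simp add: sum.distrib sum_negf)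
qed

lemma kern_measurable [measurable]:
  assumes [measurable]: "a \<in> borel_measurable borel"
  shows "(\<lambda>p. kern a (fst p) (snd p)) \<in> borel_measurable (borel \<Otimes>\<^sub>M borel)"
  unfolding kern_def by measurable

lemma kern_measurable' [measurable]:
  assumes [measurable]: "a \<in> borel_measurable borel"
  shows "kern a \<eta> \<in> borel_measurable borel"
  unfolding kern_def[abs_def] by measurable

text \<open>At output frequency 0 the formula for \<open>\<xi> \<bullet> l\<close> retains only
  kernels of differentiated amplitudes, so each power of the bracket costs one derivative.\<close>

lemma rapid_kern_0:
  assumes "test_on U a"
  shows "rapid (kern a 0)"
proof -
  have "\<exists>C. \<forall>\<xi>. japanese_bracket \<xi> ^ N * norm (kern a 0 \<xi>) \<le> C" for N
    using assms
  proof (induction N arbitrary: a)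
    case 0
    then show ?case using norm_kern_le by auto
  next
    case (Suc N)
    let ?d = "\<lambda>l b x. frechet_derivative (\<lambda>x. a x * jac_inv l b x) (at x) b"
    obtain C where C: "\<forall>\<xi>. japanese_bracket \<xi> ^ N * norm (kern a 0 \<xi>) \<le> C" using Suc by blast
    have "\<forall>l b. \<exists>C. \<forall>\<xi>. japanese_bracket \<xi> ^ N * norm (kern (?d l b) 0 \<xi>) \<le> C"
      by (intro allI Suc.IH test_on_frechet_derivative test_on_jac_inv Suc.prems)
    then obtain D where D: "\<forall>l b \<xi>. japanese_bracket \<xi> ^ N * norm (kern (?d l b) 0 \<xi>) \<le> D l b"
      unfolding choice_iff by (elim exE)
    have "japanese_bracket \<xi> ^ Suc N * norm (kern a 0 \<xi>) \<le> C + (\<Sum>l\<in>Basis. \<Sum>b\<in>Basis. D l b)" for \<xi>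
    proof -
      have "japanese_bracket \<xi> ^ Suc N * norm (kern a 0 \<xi>) \<le>
         (1 + (\<Sum>l\<in>Basis. \<bar>\<xi> \<bullet> l\<bar>)) * (japanese_bracket \<xi> ^ N * norm (kern a 0 \<xi>))"
        using mult_right_mono[OF japanese_bracket_le_sum[of \<xi>], of "japanese_bracket \<xi> ^ N * norm (kern a 0 \<xi>)"]
          less_imp_le[OF japanese_bracket_pos, of \<xi>]
        by (simp add: mult.assoc)
      also have "\<dots> = japanese_bracket \<xi> ^ N * norm (kern a 0 \<xi>) +
        (\<Sum>l\<in>Basis. japanese_bracket \<xi> ^ N * norm (complex_of_real (\<xi> \<bullet> l) * kern a 0 \<xi>))"
        by (simp add: norm_mult distrib_right sum_distrib_right mult.left_commute distrib_left sum_distrib_left)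
      also have "\<dots> \<le> C + (\<Sum>l\<in>Basis. \<Sum>b\<in>Basis. D l b)"
      proof (intro add_mono sum_mono)
        fix l :: 'a assume l: "l \<in> Basis"
        have "norm (complex_of_real (\<xi> \<bullet> l) * kern a 0 \<xi>) \<le> (\<Sum>b\<in>Basis. norm (kern (?d l b) 0 \<xi>))"
          unfolding kern_input_frequency[OF Suc.prems l] by (rule order_trans[OF norm_sum]) (simp add: norm_mult)
        then have "japanese_bracket \<xi> ^ N * norm (complex_of_real (\<xi> \<bullet> l) * kern a 0 \<xi>) \<le>
           (\<Sum>b\<in>Basis. japanese_bracket \<xi> ^ N * norm (kern (?d l b) 0 \<xi>))"
          unfolding sum_distrib_left[symmetric] by (intro mult_left_mono) (auto simp: less_imp_le)
        also have "\<dots> \<le> (\<Sum>b\<in>Basis. D l b)" using D by (intro sum_mono) auto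
        finally show "japanese_bracket \<xi> ^ N * norm (complex_of_real (\<xi> \<bullet> l) * kern a 0 \<xi>) \<le> (\<Sum>b\<in>Basis. D l b)" .
      qed (use C in auto)
      finally show ?thesis .
    qed
    then show ?case by blast
  qed
  then show ?thesis using assms by (auto simp: rapid_def)
qed

text \<open>Applied to \<open>fourier f\<close>, this operator gives (2 pi)^n times the Fourier
  transform of the product of \<open>a\<close> and \<open>f \<circ> \<kappa>\<close>.\<close>

definition osc :: "('a \<Rightarrow> complex) \<Rightarrow> ('a \<Rightarrow> complex) \<Rightarrow> 'a \<Rightarrow> complex" where
  "osc a h \<eta> = (\<integral>\<xi>. kern a \<eta> \<xi> * h \<xi> \<partial>lborel)"

lemma osc_measurable [measurable]:
  assumes [measurable]: "a \<in> borel_measurable borel" "h \<in> borel_measurable borel"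
  shows "osc a h \<in> borel_measurable borel"
  unfolding osc_def[abs_def] by measurable

lemma osc_integrable:
  assumes a: "test_on U a" and h: "rapid h"
  shows "integrable lborel (\<lambda>\<xi>. kern a \<eta> \<xi> * h \<xi>)"
proof (rule Bochner_Integration.integrable_bound)
  have [measurable]: "a \<in> borel_measurable borel" "h \<in> borel_measurable borel" using a h by auto
  show "integrable lborel (\<lambda>\<xi>. (\<integral>x. norm (a x) \<partial>lborel) *\<^sub>R h \<xi>)"
    by (intro integrable_scaleR_right rapid_integrable h)
  show "AE \<xi> in lborel. norm (kern a \<eta> \<xi> * h \<xi>) \<le> norm ((\<integral>x. norm (a x) \<partial>lborel) *\<^sub>R h \<xi>)"
    using norm_kern_le[of a \<eta>] by (intro AE_I2) (auto simp: norm_mult intro!: mult_right_mono)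
  show "(\<lambda>\<xi>. kern a \<eta> \<xi> * h \<xi>) \<in> borel_measurable lborel" by measurable
qed

definition inv_fourier_at :: "('a \<Rightarrow> complex) \<Rightarrow> 'a \<Rightarrow> complex" where
  "inv_fourier_at h x = (\<integral>\<xi>. cis (\<kappa> x \<bullet> \<xi>) * h \<xi> \<partial>lborel)"

lemma inv_fourier_at_measurable [measurable]:
  assumes [measurable]: "h \<in> borel_measurable borel"
  shows "inv_fourier_at h \<in> borel_measurable borel"
  unfolding inv_fourier_at_def[abs_def] by measurable

lemma norm_inv_fourier_at_le: "norm (inv_fourier_at h x) \<le> (\<integral>\<xi>. norm (h \<xi>) \<partial>lborel)"
  unfolding inv_fourier_at_def by (rule order_trans[OF integral_norm_bound]) (simp add: norm_mult)

lemma integrable_mult_inv_fourier_at: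
  assumes a: "integrable lborel a" and h: "rapid h"
  shows "integrable lborel (\<lambda>x. a x * inv_fourier_at h x)"
proof (rule Bochner_Integration.integrable_bound)
  have [measurable]: "a \<in> borel_measurable borel" "h \<in> borel_measurable borel" using a h by auto
  show "integrable lborel (\<lambda>x. (\<integral>\<xi>. norm (h \<xi>) \<partial>lborel) *\<^sub>R a x)"
    by (intro integrable_scaleR_right a)
  show "AE x in lborel. norm (a x * inv_fourier_at h x) \<le> norm ((\<integral>\<xi>. norm (h \<xi>) \<partial>lborel) *\<^sub>R a x)"
    using norm_inv_fourier_at_le[of h]
    by (intro AE_I2) (auto simp: norm_mult mult.commute[of "cmod (a _)"] intro!: mult_right_mono)
  show "(\<lambda>x. a x * inv_fourier_at h x) \<in> borel_measurable lborel" by measurable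
qed

lemma integral_inv_fourier_at:
  assumes c: "integrable lborel c" and h: "rapid h"
  shows "(\<integral>x. c x * inv_fourier_at h x \<partial>lborel) = (\<integral>\<xi>. (\<integral>x. cis (\<kappa> x \<bullet> \<xi>) * c x \<partial>lborel) * h \<xi> \<partial>lborel)"
proof -
  have "(\<integral>\<xi>. (\<integral>x. cis (\<kappa> (fst (x, \<xi>)) \<bullet> snd (x, \<xi>)) * (c x * h \<xi>) \<partial>lborel) \<partial>lborel) =
    (\<integral>x. (\<integral>\<xi>. cis (\<kappa> (fst (x, \<xi>)) \<bullet> snd (x, \<xi>)) * (c x * h \<xi>) \<partial>lborel) \<partial>lborel)"
    by (rule Fubini_bounded[OF c rapid_integrable[OF h], where B=1]) (auto simp: borel_prod[symmetric])
  then show ?thesis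
    unfolding inv_fourier_at_def
    by (simp add: mult.assoc[symmetric] mult.left_commute flip: integral_mult_left_zero integral_mult_right_zero)
       (simp add: mult.left_commute mult.assoc mult.commute)
qed

text \<open>Exchanging the integrals exhibits the output as a Fourier transform, to which Bessel's
  inequality applies.\<close>

lemma osc_eq_fourier:
  assumes a: "test_on U a" and h: "rapid h"
  shows "osc a h \<eta> = fourier (\<lambda>x. a x * inv_fourier_at h x) \<eta>"
proof -
  have "fourier (\<lambda>x. a x * inv_fourier_at h x) \<eta> = (\<integral>x. (cis (- (x \<bullet> \<eta>)) * a x) * inv_fourier_at h x \<partial>lborel)"
    by (simp add: fourier_def mult.assoc)
  also have "\<dots> = (\<integral>\<xi>. (\<integral>x. cis (\<kappa> x \<bullet> \<xi>) * (cis (- (x \<bullet> \<eta>)) * a x) \<partial>lborel) * h \<xi> \<partial>lborel)"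
    by (intro integral_inv_fourier_at h integrable_cis_mult test_on_integrable[OF a]) measurable
  also have "\<dots> = osc a h \<eta>"
    by (simp add: osc_def kern_def cis_mult mult.assoc[symmetric])
  finally show ?thesis by simp
qed

text \<open>Expanding the square turns the left-hand side into a quadratic form in \<open>h\<close> whose kernel depends
  on \<open>\<xi> - \<xi>'\<close> only and is rapidly decreasing, so that Schur's test applies.\<close>

lemma nn_integral_mult_inv_fourier_at_le:
  assumes a: "test_on U a" and h: "rapid h"
  shows "(\<integral>\<^sup>+x. ennreal ((norm (a x * inv_fourier_at h x))\<^sup>2) \<partial>lborel) \<le>
    (\<integral>\<^sup>+\<zeta>. ennreal (norm (kern (\<lambda>x. a x * cnj (a x)) 0 \<zeta>)) \<partial>lborel) * (\<integral>\<^sup>+\<xi>. ennreal ((norm (h \<xi>))\<^sup>2) \<partial>lborel)"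
proof -
  have [measurable]: "a \<in> borel_measurable borel" "h \<in> borel_measurable borel" using a h by auto
  let ?f = "inv_fourier_at h" and ?aa = "\<lambda>x. a x * cnj (a x)"
  have "smooth_on UNIV (\<lambda>x. cnj (a x))"
    using a by (intro smooth_on_bounded_linear[OF bounded_linear_cnj]) (auto simp: test_on_def)
  then have aa: "test_on U ?aa" by (intro test_on_mult_smooth[OF a open_U]) (rule smooth_on_subset, auto)
  have iaa: "integrable lborel ?aa" using aa by (rule test_on_integrable)
  have ch: "rapid (\<lambda>\<xi>. cnj (h \<xi>))" using h by (auto simp: rapid_def)
  let ?c = "\<lambda>x. cnj (?aa x * ?f x)"
  have c: "integrable lborel ?c" by (rule integrable_cnj[OF integrable_mult_inv_fourier_at[OF iaa h]])
  have P: "(\<integral>x. cis (\<kappa> x \<bullet> \<xi>) * ?c x \<partial>lborel) = (\<integral>\<xi>'. kern ?aa 0 (\<xi> - \<xi>') * cnj (h \<xi>') \<partial>lborel)" for \<xi>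
  proof -
    have "(\<integral>x. cis (\<kappa> x \<bullet> \<xi>) * ?c x \<partial>lborel) = cnj (\<integral>x. (cis (- (\<kappa> x \<bullet> \<xi>)) * ?aa x) * ?f x \<partial>lborel)"
      by (subst Bochner_Integration.integral_cnj[symmetric]) (simp add: cis_cnj mult.assoc)
    also have "(\<integral>x. (cis (- (\<kappa> x \<bullet> \<xi>)) * ?aa x) * ?f x \<partial>lborel) =
       (\<integral>\<xi>'. (\<integral>x. cis (\<kappa> x \<bullet> \<xi>') * (cis (- (\<kappa> x \<bullet> \<xi>)) * ?aa x) \<partial>lborel) * h \<xi>' \<partial>lborel)"
      by (intro integral_inv_fourier_at h integrable_cis_mult iaa) measurable
    also have "cnj \<dots> = (\<integral>\<xi>'. cnj (\<integral>x. cis (\<kappa> x \<bullet> \<xi>') * (cis (- (\<kappa> x \<bullet> \<xi>)) * ?aa x) \<partial>lborel) * cnj (h \<xi>') \<partial>lborel)"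
      by (subst Bochner_Integration.integral_cnj[symmetric]) simp
    also have "(\<lambda>\<xi>'. cnj (\<integral>x. cis (\<kappa> x \<bullet> \<xi>') * (cis (- (\<kappa> x \<bullet> \<xi>)) * ?aa x) \<partial>lborel)) = (\<lambda>\<xi>'. kern ?aa 0 (\<xi> - \<xi>'))"
    proof
      fix \<xi>'
      have "cnj (\<integral>x. cis (\<kappa> x \<bullet> \<xi>') * (cis (- (\<kappa> x \<bullet> \<xi>)) * ?aa x) \<partial>lborel) =
        (\<integral>x. cnj (cis (\<kappa> x \<bullet> \<xi>') * (cis (- (\<kappa> x \<bullet> \<xi>)) * ?aa x)) \<partial>lborel)"
        by (rule Bochner_Integration.integral_cnj[symmetric])
      also have "\<dots> = kern ?aa 0 (\<xi> - \<xi>')"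
        unfolding kern_def
      proof (intro Bochner_Integration.integral_cong refl)
        fix x
        have "cnj (cis s * (cis (- t) * w)) = cis (t - s) * cnj w" for s t w
          by (simp add: cis_cnj mult.assoc[symmetric] cis_mult)
        moreover have "cnj (?aa x) = ?aa x" by (simp add: mult.commute)
        moreover have "\<kappa> x \<bullet> (\<xi> - \<xi>') - x \<bullet> 0 = \<kappa> x \<bullet> \<xi> - \<kappa> x \<bullet> \<xi>'" by (simp add: inner_diff_right)
        ultimately show "cnj (cis (\<kappa> x \<bullet> \<xi>') * (cis (- (\<kappa> x \<bullet> \<xi>)) * ?aa x)) = cis (\<kappa> x \<bullet> (\<xi> - \<xi>') - x \<bullet> 0) * ?aa x"
          by (simp only:)
      qed
      finally show "cnj (\<integral>x. cis (\<kappa> x \<bullet> \<xi>') * (cis (- (\<kappa> x \<bullet> \<xi>)) * ?aa x) \<partial>lborel) = kern ?aa 0 (\<xi> - \<xi>')" .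
    qed
    finally show ?thesis .
  qed
  have kb: "norm (kern ?aa 0 \<zeta>) \<le> (\<integral>x. norm (?aa x) \<partial>lborel)" for \<zeta> by (rule norm_kern_le)
  have [measurable]: "kern ?aa 0 \<in> borel_measurable borel" by measurable
  have ik: "integrable lborel (\<lambda>\<xi>'. kern ?aa 0 (\<xi> - \<xi>') * cnj (h \<xi>'))" for \<xi>
  proof (rule Bochner_Integration.integrable_bound)
    show "integrable lborel (\<lambda>\<xi>. (\<integral>x. norm (?aa x) \<partial>lborel) *\<^sub>R h \<xi>)"
      by (intro integrable_scaleR_right rapid_integrable h)
    show "AE \<xi>' in lborel. norm (kern ?aa 0 (\<xi> - \<xi>') * cnj (h \<xi>')) \<le> norm ((\<integral>x. norm (?aa x) \<partial>lborel) *\<^sub>R h \<xi>')"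
      using kb by (intro AE_I2) (auto simp: norm_mult intro!: mult_right_mono)
    show "(\<lambda>\<xi>'. kern ?aa 0 (\<xi> - \<xi>') * cnj (h \<xi>')) \<in> borel_measurable lborel" by measurable
  qed
  have i2: "integrable lborel (\<lambda>\<xi>. (\<integral>x. cis (\<kappa> x \<bullet> \<xi>) * ?c x \<partial>lborel) * h \<xi>)"
  proof (rule Bochner_Integration.integrable_bound)
    show "integrable lborel (\<lambda>\<xi>. (\<integral>x. norm (?c x) \<partial>lborel) *\<^sub>R h \<xi>)"
      by (intro integrable_scaleR_right rapid_integrable h)
    have "norm (\<integral>x. cis (\<kappa> x \<bullet> \<xi>) * ?c x \<partial>lborel) \<le> (\<integral>x. norm (?c x) \<partial>lborel)" for \<xi>
      by (rule order_trans[OF integral_norm_bound]) (simp add: norm_mult)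
    then show "AE \<xi> in lborel. norm ((\<integral>x. cis (\<kappa> x \<bullet> \<xi>) * ?c x \<partial>lborel) * h \<xi>) \<le> norm ((\<integral>x. norm (?c x) \<partial>lborel) *\<^sub>R h \<xi>)"
      by (intro AE_I2) (auto simp only: norm_mult norm_scaleR real_norm_def intro!: mult_right_mono order_trans[OF _ abs_ge_self] norm_ge_zero)
    show "(\<lambda>\<xi>. (\<integral>x. cis (\<kappa> x \<bullet> \<xi>) * ?c x \<partial>lborel) * h \<xi>) \<in> borel_measurable lborel" by measurable
  qed
  have sq: "complex_of_real ((norm (a x * ?f x))\<^sup>2) = ?c x * ?f x" for x
    unfolding complex_norm_square by (simp add: mult_ac)
  have icf: "integrable lborel (\<lambda>x. ?c x * ?f x)" using c h by (rule integrable_mult_inv_fourier_at)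
  have "(\<integral>\<^sup>+x. ennreal ((norm (a x * ?f x))\<^sup>2) \<partial>lborel) = ennreal (\<integral>x. (norm (a x * ?f x))\<^sup>2 \<partial>lborel)"
  proof (rule nn_integral_eq_integral)
    have "integrable lborel (\<lambda>x. complex_of_real ((norm (a x * ?f x))\<^sup>2))" unfolding sq by (rule icf)
    from integrable_Re[OF this] show "integrable lborel (\<lambda>x. (norm (a x * ?f x))\<^sup>2)"
      by (simp only: Re_complex_of_real)
  qed simp
  also have "(\<integral>x. (norm (a x * ?f x))\<^sup>2 \<partial>lborel) = Re (\<integral>x. ?c x * ?f x \<partial>lborel)"
    unfolding sq[symmetric] by (simp only: integral_complex_of_real Re_complex_of_real)
  also have "(\<integral>x. ?c x * ?f x \<partial>lborel) = (\<integral>\<xi>. (\<integral>x. cis (\<kappa> x \<bullet> \<xi>) * ?c x \<partial>lborel) * h \<xi> \<partial>lborel)"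
    by (rule integral_inv_fourier_at[OF c h])
  also have "ennreal (Re \<dots>) \<le> ennreal (norm \<dots>)" by (intro ennreal_leI complex_Re_le_cmod)
  also have "\<dots> \<le> (\<integral>\<^sup>+\<xi>. norm ((\<integral>x. cis (\<kappa> x \<bullet> \<xi>) * ?c x \<partial>lborel) * h \<xi>) \<partial>lborel)"
    by (rule integral_norm_bound_ennreal[OF i2])
  also have "\<dots> \<le> (\<integral>\<^sup>+\<xi>. (\<integral>\<^sup>+\<xi>'. ennreal (norm (h \<xi>) * norm (h \<xi>') * norm (kern ?aa 0 (\<xi> - \<xi>'))) \<partial>lborel) \<partial>lborel)"
  proof (intro nn_integral_mono)
    fix \<xi>
    have "ennreal (norm ((\<integral>x. cis (\<kappa> x \<bullet> \<xi>) * ?c x \<partial>lborel) * h \<xi>)) =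
      ennreal (norm (h \<xi>)) * ennreal (norm (\<integral>\<xi>'. kern ?aa 0 (\<xi> - \<xi>') * cnj (h \<xi>') \<partial>lborel))"
      unfolding P by (simp add: norm_mult ennreal_mult mult.commute)
    also have "\<dots> \<le> ennreal (norm (h \<xi>)) * (\<integral>\<^sup>+\<xi>'. norm (kern ?aa 0 (\<xi> - \<xi>') * cnj (h \<xi>')) \<partial>lborel)"
      by (intro mult_left_mono integral_norm_bound_ennreal ik) simp
    also have "\<dots> = (\<integral>\<^sup>+\<xi>'. ennreal (norm (h \<xi>) * norm (h \<xi>') * norm (kern ?aa 0 (\<xi> - \<xi>'))) \<partial>lborel)"
      by (subst nn_integral_cmult[symmetric])
        (auto simp: norm_mult ennreal_mult[symmetric] mult_ac intro!: nn_integral_cong)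
    finally show "ennreal (norm ((\<integral>x. cis (\<kappa> x \<bullet> \<xi>) * ?c x \<partial>lborel) * h \<xi>)) \<le>
       (\<integral>\<^sup>+\<xi>'. ennreal (norm (h \<xi>) * norm (h \<xi>') * norm (kern ?aa 0 (\<xi> - \<xi>'))) \<partial>lborel)" .
  qed
  also have "\<dots> \<le> (\<integral>\<^sup>+\<zeta>. ennreal (norm (kern ?aa 0 \<zeta>)) \<partial>lborel) * (\<integral>\<^sup>+\<xi>. ennreal ((norm (h \<xi>))\<^sup>2) \<partial>lborel)"
    by (rule schur_le) auto
  finally show ?thesis .
qed

end

subsection \<open>Weighted bounds\<close>

text \<open>\<open>T\<close> may be any nonnegative, possibly nonlinear expression in
  \<open>h\<close>, so that sums of norms of several operators are treated as one. In
  \<open>ennreal\<close> an infinite right-hand side is harmless.\<close>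

definition weighted_bound ::
    "('a::euclidean_space \<Rightarrow> real) \<Rightarrow> ('a \<Rightarrow> real) \<Rightarrow> (('a \<Rightarrow> complex) \<Rightarrow> 'a \<Rightarrow> real) \<Rightarrow> bool" where
  "weighted_bound W W' T \<longleftrightarrow> (\<forall>h. rapid h \<longrightarrow> T h \<in> borel_measurable borel \<and> (\<forall>\<eta>. 0 \<le> T h \<eta>)) \<and>
     (\<exists>C::real. 0 \<le> C \<and> (\<forall>h. rapid h \<longrightarrow>
       (\<integral>\<^sup>+\<eta>. ennreal (W \<eta> * (T h \<eta>)\<^sup>2) \<partial>lborel) \<le> ennreal C * (\<integral>\<^sup>+\<xi>. ennreal (W' \<xi> * (norm (h \<xi>))\<^sup>2) \<partial>lborel)))"

lemma weighted_boundD: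
  assumes "weighted_bound W W' T"
  shows "\<And>h. rapid h \<Longrightarrow> T h \<in> borel_measurable borel" "\<And>h \<eta>. rapid h \<Longrightarrow> 0 \<le> T h \<eta>"
  using assms by (auto simp: weighted_bound_def)

lemma weighted_boundE:
  assumes "weighted_bound W W' T"
  obtains C where "0 \<le> C" "\<forall>h. rapid h \<longrightarrow>
       (\<integral>\<^sup>+\<eta>. ennreal (W \<eta> * (T h \<eta>)\<^sup>2) \<partial>lborel) \<le> ennreal C * (\<integral>\<^sup>+\<xi>. ennreal (W' \<xi> * (norm (h \<xi>))\<^sup>2) \<partial>lborel)"
  using assms unfolding weighted_bound_def by (elim conjE exE) (intro that)

lemma weighted_bound_mono:
  assumes T: "weighted_bound W W' T"
    and S: "\<And>h. rapid h \<Longrightarrow> S h \<in> borel_measurable borel" "\<And>h \<eta>. rapid h \<Longrightarrow> 0 \<le> S h \<eta>"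
    and le: "\<And>h \<eta>. rapid h \<Longrightarrow> W2 \<eta> * (S h \<eta>)\<^sup>2 \<le> W \<eta> * (T h \<eta>)\<^sup>2"
  shows "weighted_bound W2 W' S"
proof -
  obtain C where C: "0 \<le> C" "\<forall>h. rapid h \<longrightarrow>
       (\<integral>\<^sup>+\<eta>. ennreal (W \<eta> * (T h \<eta>)\<^sup>2) \<partial>lborel) \<le> ennreal C * (\<integral>\<^sup>+\<xi>. ennreal (W' \<xi> * (norm (h \<xi>))\<^sup>2) \<partial>lborel)"
    using T by (rule weighted_boundE)
  have "(\<integral>\<^sup>+\<eta>. ennreal (W2 \<eta> * (S h \<eta>)\<^sup>2) \<partial>lborel) \<le> ennreal C * (\<integral>\<^sup>+\<xi>. ennreal (W' \<xi> * (norm (h \<xi>))\<^sup>2) \<partial>lborel)"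
    if "rapid h" for h
    by (rule order_trans[OF nn_integral_mono C(2)[rule_format, OF that]]) (intro ennreal_leI le that)
  then show ?thesis unfolding weighted_bound_def using S C(1) by blast
qed

lemma weighted_bound_zero: "weighted_bound W W' (\<lambda>h \<eta>. 0)"
  unfolding weighted_bound_def by (intro conjI allI impI exI[of _ 0]) auto

lemma weighted_bound_add:
  assumes S: "weighted_bound W W' S" and T: "weighted_bound W W' T"
    and W: "W \<in> borel_measurable borel" "\<And>\<eta>. 0 \<le> W \<eta>"
  shows "weighted_bound W W' (\<lambda>h \<eta>. S h \<eta> + T h \<eta>)"
proof -
  obtain C where C: "0 \<le> C" "\<forall>h. rapid h \<longrightarrow>
       (\<integral>\<^sup>+\<eta>. ennreal (W \<eta> * (S h \<eta>)\<^sup>2) \<partial>lborel) \<le> ennreal C * (\<integral>\<^sup>+\<xi>. ennreal (W' \<xi> * (norm (h \<xi>))\<^sup>2) \<partial>lborel)"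
    using S by (rule weighted_boundE)
  obtain D where D: "0 \<le> D" "\<forall>h. rapid h \<longrightarrow>
       (\<integral>\<^sup>+\<eta>. ennreal (W \<eta> * (T h \<eta>)\<^sup>2) \<partial>lborel) \<le> ennreal D * (\<integral>\<^sup>+\<xi>. ennreal (W' \<xi> * (norm (h \<xi>))\<^sup>2) \<partial>lborel)"
    using T by (rule weighted_boundE)
  have "(\<integral>\<^sup>+\<eta>. ennreal (W \<eta> * (S h \<eta> + T h \<eta>)\<^sup>2) \<partial>lborel) \<le>
     ennreal (2 * C + 2 * D) * (\<integral>\<^sup>+\<xi>. ennreal (W' \<xi> * (norm (h \<xi>))\<^sup>2) \<partial>lborel)" if h: "rapid h" for h
  proof -
    have [measurable]: "W \<in> borel_measurable borel" "S h \<in> borel_measurable borel" "T h \<in> borel_measurable borel"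
      using W weighted_boundD(1)[OF S h] weighted_boundD(1)[OF T h] by auto
    have "(\<integral>\<^sup>+\<eta>. ennreal (W \<eta> * (S h \<eta> + T h \<eta>)\<^sup>2) \<partial>lborel) \<le>
      (\<integral>\<^sup>+\<eta>. ennreal 2 * ennreal (W \<eta> * (S h \<eta>)\<^sup>2) + ennreal 2 * ennreal (W \<eta> * (T h \<eta>)\<^sup>2) \<partial>lborel)"
    proof (intro nn_integral_mono)
      fix \<eta>
      have "(S h \<eta> + T h \<eta>)\<^sup>2 \<le> 2 * (S h \<eta>)\<^sup>2 + 2 * (T h \<eta>)\<^sup>2"
        using zero_le_power2[of "S h \<eta> - T h \<eta>"] by (simp add: power2_sum power2_diff)
      then have "W \<eta> * (S h \<eta> + T h \<eta>)\<^sup>2 \<le> W \<eta> * (2 * (S h \<eta>)\<^sup>2 + 2 * (T h \<eta>)\<^sup>2)"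
        by (rule mult_left_mono) (rule W)
      also have "\<dots> = 2 * (W \<eta> * (S h \<eta>)\<^sup>2) + 2 * (W \<eta> * (T h \<eta>)\<^sup>2)" by (simp add: algebra_simps)
      finally show "ennreal (W \<eta> * (S h \<eta> + T h \<eta>)\<^sup>2) \<le> ennreal 2 * ennreal (W \<eta> * (S h \<eta>)\<^sup>2) + ennreal 2 * ennreal (W \<eta> * (T h \<eta>)\<^sup>2)"
        using W(2)[of \<eta>] by (subst (1 2) ennreal_mult[symmetric], simp_all del: ennreal_numeral)
          (subst ennreal_plus[symmetric], simp_all del: ennreal_plus ennreal_numeral add: ennreal_leI)
    qed
    also have "\<dots> = ennreal 2 * (\<integral>\<^sup>+\<eta>. ennreal (W \<eta> * (S h \<eta>)\<^sup>2) \<partial>lborel) + ennreal 2 * (\<integral>\<^sup>+\<eta>. ennreal (W \<eta> * (T h \<eta>)\<^sup>2) \<partial>lborel)"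
      by (simp add: nn_integral_add nn_integral_cmult)
    also have "\<dots> \<le> ennreal 2 * (ennreal C * (\<integral>\<^sup>+\<xi>. ennreal (W' \<xi> * (norm (h \<xi>))\<^sup>2) \<partial>lborel)) +
      ennreal 2 * (ennreal D * (\<integral>\<^sup>+\<xi>. ennreal (W' \<xi> * (norm (h \<xi>))\<^sup>2) \<partial>lborel))"
      using C(2) D(2) h by (intro add_mono mult_left_mono) auto
    also have "\<dots> = ennreal (2 * C + 2 * D) * (\<integral>\<^sup>+\<xi>. ennreal (W' \<xi> * (norm (h \<xi>))\<^sup>2) \<partial>lborel)"
      using C(1) D(1) by (simp add: ennreal_plus ennreal_mult distrib_right mult.assoc)
    finally show ?thesis .
  qed
  moreover have "0 \<le> 2 * C + 2 * D" using C(1) D(1) by simp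
  ultimately show ?thesis
    unfolding weighted_bound_def
    using weighted_boundD[OF S] weighted_boundD[OF T] by (intro conjI allI impI exI[of _ "2 * C + 2 * D"]) auto
qed

lemma weighted_bound_sum:
  assumes "\<And>i. i \<in> I \<Longrightarrow> weighted_bound W W' (T i)"
    and W: "W \<in> borel_measurable borel" "\<And>\<eta>. 0 \<le> W \<eta>"
  shows "weighted_bound W W' (\<lambda>h \<eta>. \<Sum>i\<in>I. T i h \<eta>)"
  using assms(1)
  by (induction I rule: infinite_finite_induct) (simp_all add: weighted_bound_zero weighted_bound_add[OF _ _ W])

text \<open>A multiplier on the input is absorbed by the weight; in this way a coordinate of \<xi>
  costs one squared bracket on the right.\<close>

lemma weighted_bound_precompose:
  assumes T: "weighted_bound W W' T"
    and g: "\<And>h. rapid h \<Longrightarrow> rapid (\<lambda>\<xi>. g \<xi> * h \<xi>)"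
    and le: "\<And>\<xi>. W' \<xi> * (norm (g \<xi>))\<^sup>2 \<le> W2 \<xi>"
  shows "weighted_bound W W2 (\<lambda>h. T (\<lambda>\<xi>. g \<xi> * h \<xi>))"
proof -
  obtain C where C: "0 \<le> C" "\<forall>h. rapid h \<longrightarrow>
       (\<integral>\<^sup>+\<eta>. ennreal (W \<eta> * (T h \<eta>)\<^sup>2) \<partial>lborel) \<le> ennreal C * (\<integral>\<^sup>+\<xi>. ennreal (W' \<xi> * (norm (h \<xi>))\<^sup>2) \<partial>lborel)"
    using T by (rule weighted_boundE)
  have "(\<integral>\<^sup>+\<eta>. ennreal (W \<eta> * (T (\<lambda>\<xi>. g \<xi> * h \<xi>) \<eta>)\<^sup>2) \<partial>lborel) \<le> ennreal C * (\<integral>\<^sup>+\<xi>. ennreal (W2 \<xi> * (norm (h \<xi>))\<^sup>2) \<partial>lborel)"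
    if "rapid h" for h
  proof (rule order_trans[OF C(2)[rule_format, OF g[OF that]]], intro mult_left_mono nn_integral_mono ennreal_leI)
    fix \<xi>
    show "W' \<xi> * (norm (g \<xi> * h \<xi>))\<^sup>2 \<le> W2 \<xi> * (norm (h \<xi>))\<^sup>2"
      using mult_right_mono[OF le[of \<xi>], of "(norm (h \<xi>))\<^sup>2"] by (simp add: norm_mult power_mult_distrib mult.assoc)
  qed simp
  then show ?thesis
    unfolding weighted_bound_def using weighted_boundD[OF T] g C(1) by blast
qed

lemma rapid_mult_inner: "rapid h \<Longrightarrow> l \<in> Basis \<Longrightarrow> rapid (\<lambda>\<xi>. complex_of_real (\<xi> \<bullet> l) * h \<xi>)"
  by (rule rapid_mult_bounded[where B=1 and M=1]) (auto simp: inner_le_japanese_bracket)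

lemma japanese_bracket_neq_0 [simp]: "japanese_bracket \<xi> \<noteq> 0"
  using japanese_bracket_pos[of \<xi>] by (rule less_imp_neq[THEN not_sym])

lemma one_le_japanese_bracket_power: "1 \<le> japanese_bracket \<xi> ^ n"
  by (rule one_le_power) (rule japanese_bracket_ge_1)

lemma rapid_sum: "(\<And>i. i \<in> I \<Longrightarrow> rapid (g i)) \<Longrightarrow> rapid (\<lambda>\<xi>. \<Sum>i\<in>I. g i \<xi>)"
proof (induction I rule: infinite_finite_induct)
  case (insert i I)
  then show ?case by (simp add: rapid_add)
qed (auto simp: rapid_def)

section \<open>Bounds for integer power weights\<close>

context change_of_variables
begin

lemma osc_output_frequency:
  assumes a: "test_on U a" and h: "rapid h"
  shows "complex_of_real (\<eta> \<bullet> b) * osc a h \<eta> =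
    - \<i> * osc (\<lambda>x. frechet_derivative a (at x) b) h \<eta> +
    (\<Sum>l\<in>Basis. osc (\<lambda>x. a x * jac b l x) (\<lambda>\<xi>. complex_of_real (\<xi> \<bullet> l) * h \<xi>) \<eta>)"
proof -
  note i1 = osc_integrable[OF test_on_frechet_derivative[OF a] h]
  have i2: "integrable lborel (\<lambda>\<xi>. kern (\<lambda>x. a x * jac b l x) \<eta> \<xi> * (complex_of_real (\<xi> \<bullet> l) * h \<xi>))" if "l \<in> Basis" for l
    by (rule osc_integrable[OF test_on_jac[OF a] rapid_mult_inner[OF h that]])
  have "complex_of_real (\<eta> \<bullet> b) * osc a h \<eta> = (\<integral>\<xi>. (complex_of_real (\<eta> \<bullet> b) * kern a \<eta> \<xi>) * h \<xi> \<partial>lborel)"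
    by (simp add: osc_def mult.assoc)
  also have "\<dots> = (\<integral>\<xi>. - \<i> * (kern (\<lambda>x. frechet_derivative a (at x) b) \<eta> \<xi> * h \<xi>) +
    (\<Sum>l\<in>Basis. kern (\<lambda>x. a x * jac b l x) \<eta> \<xi> * (complex_of_real (\<xi> \<bullet> l) * h \<xi>)) \<partial>lborel)"
    unfolding kern_output_frequency[OF a]
    by (intro Bochner_Integration.integral_cong refl)
      (simp add: distrib_right sum_distrib_right left_diff_distrib mult_ac distrib_left sum_distrib_left right_diff_distrib)
  also have "\<dots> = - \<i> * osc (\<lambda>x. frechet_derivative a (at x) b) h \<eta> +
    (\<Sum>l\<in>Basis. osc (\<lambda>x. a x * jac b l x) (\<lambda>\<xi>. complex_of_real (\<xi> \<bullet> l) * h \<xi>) \<eta>)"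
    unfolding osc_def using i1 i2
    by (subst Bochner_Integration.integral_add) (auto simp: Bochner_Integration.integral_sum)
  finally show ?thesis .
qed

lemma osc_input_frequency:
  assumes a: "test_on U a" and h: "rapid h" and l: "l \<in> Basis"
  shows "osc a (\<lambda>\<xi>. complex_of_real (\<xi> \<bullet> l) * h \<xi>) \<eta> =
    (\<Sum>b\<in>Basis. complex_of_real (\<eta> \<bullet> b) * osc (\<lambda>x. a x * jac_inv l b x) h \<eta> +
      \<i> * osc (\<lambda>x. frechet_derivative (\<lambda>x. a x * jac_inv l b x) (at x) b) h \<eta>)"
proof -
  note i1 = osc_integrable[OF test_on_jac_inv[OF a] h]
  note i2 = osc_integrable[OF test_on_frechet_derivative[OF test_on_jac_inv[OF a]] h]
  have "osc a (\<lambda>\<xi>. complex_of_real (\<xi> \<bullet> l) * h \<xi>) \<eta> = (\<integral>\<xi>. (complex_of_real (\<xi> \<bullet> l) * kern a \<eta> \<xi>) * h \<xi> \<partial>lborel)"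
    by (simp add: osc_def mult_ac)
  also have "\<dots> = (\<integral>\<xi>. (\<Sum>b\<in>Basis. complex_of_real (\<eta> \<bullet> b) * (kern (\<lambda>x. a x * jac_inv l b x) \<eta> \<xi> * h \<xi>) +
      \<i> * (kern (\<lambda>x. frechet_derivative (\<lambda>x. a x * jac_inv l b x) (at x) b) \<eta> \<xi> * h \<xi>)) \<partial>lborel)"
    unfolding kern_input_frequency[OF a l]
    by (intro Bochner_Integration.integral_cong refl)
      (simp add: distrib_right sum_distrib_right left_diff_distrib mult_ac distrib_left sum_distrib_left right_diff_distrib)
  also have "\<dots> = (\<Sum>b\<in>Basis. (\<integral>\<xi>. complex_of_real (\<eta> \<bullet> b) * (kern (\<lambda>x. a x * jac_inv l b x) \<eta> \<xi> * h \<xi>) +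
      \<i> * (kern (\<lambda>x. frechet_derivative (\<lambda>x. a x * jac_inv l b x) (at x) b) \<eta> \<xi> * h \<xi>) \<partial>lborel))"
    by (intro Bochner_Integration.integral_sum Bochner_Integration.integrable_add integrable_mult_right i1 i2)
  also have "\<dots> = (\<Sum>b\<in>Basis. complex_of_real (\<eta> \<bullet> b) * osc (\<lambda>x. a x * jac_inv l b x) h \<eta> +
      \<i> * osc (\<lambda>x. frechet_derivative (\<lambda>x. a x * jac_inv l b x) (at x) b) h \<eta>)"
    unfolding osc_def using i1 i2 by (intro sum.cong refl) simp
  finally show ?thesis .
qed

text \<open>The kernel in Schur's test is integrable by \<open>rapid_kern_0\<close>; its mass times
  the (2 pi)^n of Bessel's inequality is the constant.\<close>

lemma osc_bound_0:
  assumes a: "test_on U a"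
  shows "weighted_bound (\<lambda>_. 1) (\<lambda>_. 1) (\<lambda>h \<eta>. norm (osc a h \<eta>))"
proof -
  have [measurable]: "a \<in> borel_measurable borel" using a by auto
  let ?aa = "\<lambda>x. a x * cnj (a x)"
  have "smooth_on UNIV (\<lambda>x. cnj (a x))"
    using a by (intro smooth_on_bounded_linear[OF bounded_linear_cnj]) (auto simp: test_on_def)
  then have aa: "test_on U ?aa" by (intro test_on_mult_smooth[OF a open_U]) (rule smooth_on_subset, auto)
  have ik: "integrable lborel (kern ?aa 0)" by (rule rapid_integrable[OF rapid_kern_0[OF aa]])
  define C where "C = (\<integral>\<zeta>. norm (kern ?aa 0 \<zeta>) \<partial>lborel)"
  have C: "(\<integral>\<^sup>+\<zeta>. ennreal (norm (kern ?aa 0 \<zeta>)) \<partial>lborel) = ennreal C" "0 \<le> C"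
    unfolding C_def using ik by (auto intro: nn_integral_eq_integral integrable_norm)
  have "(\<integral>\<^sup>+\<eta>. ennreal ((norm (osc a h \<eta>))\<^sup>2) \<partial>lborel) \<le>
    ennreal ((2 * pi) ^ DIM('a) * C) * (\<integral>\<^sup>+\<xi>. ennreal ((norm (h \<xi>))\<^sup>2) \<partial>lborel)" if h: "rapid h" for h
  proof -
    have "(\<integral>\<^sup>+\<eta>. ennreal ((norm (osc a h \<eta>))\<^sup>2) \<partial>lborel) \<le>
      ennreal ((2 * pi) ^ DIM('a)) * (\<integral>\<^sup>+x. ennreal ((norm (a x * inv_fourier_at h x))\<^sup>2) \<partial>lborel)"
      unfolding osc_eq_fourier[OF a h]
      by (rule fourier_bessel[OF integrable_mult_inv_fourier_at[OF test_on_integrable[OF a] h]])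
    also have "\<dots> \<le> ennreal ((2 * pi) ^ DIM('a)) * (ennreal C * (\<integral>\<^sup>+\<xi>. ennreal ((norm (h \<xi>))\<^sup>2) \<partial>lborel))"
      using nn_integral_mult_inv_fourier_at_le[OF a h] unfolding C(1) by (rule mult_left_mono) simp
    finally show ?thesis using C(2) by (simp add: ennreal_mult mult.assoc)
  qed
  then show ?thesis
    unfolding weighted_bound_def using C(2)
    by (intro conjI allI impI exI[of _ "(2 * pi) ^ DIM('a) * C"]) auto
qed

text \<open>Induction over all amplitudes: one bracket of \<eta> is at most 1 plus the sum of the
  moduli of the coordinates, and each coordinate becomes a derivative of the amplitude or a
  coordinate of \<xi> on the input, which the higher weight on the right absorbs.\<close>

lemma osc_bound_pos:
  assumes "test_on U a"
  shows "weighted_bound (\<lambda>\<eta>. japanese_bracket \<eta> ^ (2 * m)) (\<lambda>\<xi>. japanese_bracket \<xi> ^ (2 * m)) (\<lambda>h \<eta>. norm (osc a h \<eta>))"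
  using assms
proof (induction m arbitrary: a)
  case 0
  then show ?case using osc_bound_0 by simp
next
  case (Suc m)
  note a = Suc.prems
  have [measurable]: "a \<in> borel_measurable borel" using a by auto
  let ?W = "\<lambda>\<eta>::'a. japanese_bracket \<eta> ^ (2 * m)" and ?W1 = "\<lambda>\<eta>::'a. japanese_bracket \<eta> ^ (2 * Suc m)"
  have W: "?W \<in> borel_measurable borel" "\<And>\<eta>. 0 \<le> ?W \<eta>"
  proof -
    show "?W \<in> borel_measurable borel" by measurable
  qed (simp add: less_imp_le)
  have id: "weighted_bound ?W ?W1 (\<lambda>h \<eta>. norm (osc c h \<eta>))" if c: "test_on U c" for c
  proof -
    have "weighted_bound ?W ?W1 (\<lambda>h \<eta>. norm (osc c (\<lambda>\<xi>. 1 * h \<xi>) \<eta>))"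
    proof (rule weighted_bound_precompose[OF Suc.IH[OF c]])
      fix \<xi> :: 'a
      have "?W \<xi> \<le> ?W1 \<xi>" by (intro power_increasing japanese_bracket_ge_1) simp
      then show "?W \<xi> * (norm (1::complex))\<^sup>2 \<le> ?W1 \<xi>" by simp
    qed simp
    then show ?thesis by simp
  qed
  have mul: "weighted_bound ?W ?W1 (\<lambda>h \<eta>. norm (osc c (\<lambda>\<xi>. complex_of_real (\<xi> \<bullet> l) * h \<xi>) \<eta>))"
    if c: "test_on U c" and l: "l \<in> Basis" for c l
  proof (rule weighted_bound_precompose[OF Suc.IH[OF c]])
    fix \<xi> :: 'a
    have "(\<xi> \<bullet> l)\<^sup>2 \<le> (japanese_bracket \<xi>)\<^sup>2"
      using inner_le_japanese_bracket[OF l, of \<xi>] by (simp add: power2_le_iff_abs_le less_imp_le)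
    then have "?W \<xi> * (\<xi> \<bullet> l)\<^sup>2 \<le> ?W \<xi> * (japanese_bracket \<xi>)\<^sup>2" using W(2) by (rule mult_left_mono)
    then show "?W \<xi> * (norm (complex_of_real (\<xi> \<bullet> l)))\<^sup>2 \<le> ?W1 \<xi>"
      by (simp add: power_add[symmetric] power2_eq_square)
  qed (rule rapid_mult_inner[OF _ l])
  let ?T = "\<lambda>h \<eta>. norm (osc a h \<eta>) + (\<Sum>b\<in>Basis. norm (osc (\<lambda>x. frechet_derivative a (at x) b) h \<eta>) +
       (\<Sum>l\<in>Basis. norm (osc (\<lambda>x. a x * jac b l x) (\<lambda>\<xi>. complex_of_real (\<xi> \<bullet> l) * h \<xi>) \<eta>)))"
  have "weighted_bound ?W ?W1 ?T"
    by (intro weighted_bound_add weighted_bound_sum W id mul a test_on_frechet_derivative test_on_jac)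
  then show ?case
  proof (rule weighted_bound_mono)
    fix h :: "'a \<Rightarrow> complex" and \<eta> :: 'a assume h: "rapid h"
    have [measurable]: "h \<in> borel_measurable borel" using h by auto
    show "(\<lambda>\<eta>. norm (osc a h \<eta>)) \<in> borel_measurable borel" by measurable
    show "0 \<le> norm (osc a h \<eta>)" by simp
    have "japanese_bracket \<eta> * norm (osc a h \<eta>) \<le> (1 + (\<Sum>b\<in>Basis. \<bar>\<eta> \<bullet> b\<bar>)) * norm (osc a h \<eta>)"
      by (intro mult_right_mono japanese_bracket_le_sum) simp
    also have "\<dots> = norm (osc a h \<eta>) + (\<Sum>b\<in>Basis. norm (complex_of_real (\<eta> \<bullet> b) * osc a h \<eta>))"
      by (simp add: norm_mult distrib_right sum_distrib_right)
    also have "\<dots> \<le> ?T h \<eta>"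
      unfolding osc_output_frequency[OF a h]
      by (intro add_mono order_refl sum_mono order_trans[OF norm_triangle_ineq] norm_sum) (auto simp: norm_mult)
    finally have "japanese_bracket \<eta> * norm (osc a h \<eta>) \<le> ?T h \<eta>" .
    then have "(japanese_bracket \<eta> * norm (osc a h \<eta>))\<^sup>2 \<le> (?T h \<eta>)\<^sup>2"
      by (intro power_mono) (auto simp: less_imp_le)
    then have "?W \<eta> * (japanese_bracket \<eta> * norm (osc a h \<eta>))\<^sup>2 \<le> ?W \<eta> * (?T h \<eta>)\<^sup>2"
      using W(2) by (rule mult_left_mono)
    then show "?W1 \<eta> * (norm (osc a h \<eta>))\<^sup>2 \<le> ?W \<eta> * (?T h \<eta>)\<^sup>2"
      by (simp add: power_mult_distrib power2_eq_square mult_ac)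
  qed
qed

lemma osc_add:
  assumes a: "test_on U a" and g: "rapid g" and h: "rapid h"
  shows "osc a (\<lambda>\<xi>. g \<xi> + h \<xi>) \<eta> = osc a g \<eta> + osc a h \<eta>"
  unfolding osc_def distrib_left
  by (rule Bochner_Integration.integral_add[OF osc_integrable[OF a g] osc_integrable[OF a h]])

lemma osc_sum:
  assumes a: "test_on U a" and g: "\<And>i. i \<in> I \<Longrightarrow> rapid (g i)"
  shows "osc a (\<lambda>\<xi>. \<Sum>i\<in>I. g i \<xi>) \<eta> = (\<Sum>i\<in>I. osc a (g i) \<eta>)"
  unfolding osc_def sum_distrib_left
  by (rule Bochner_Integration.integral_sum) (rule osc_integrable[OF a g])

text \<open>Here a bracket is gained on the input side. With \<open>h\<close> expanded as (1 + sum
  of (\<xi> . l)^2) h over the squared bracket, one factor \<open>\<xi> \<bullet> l\<close> of each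
  summand is moved out of the operator at the price of one bracket of \<eta>; the other stays on the
  input beside the inverse square.\<close>

lemma osc_bound_neg:
  assumes "test_on U a"
  shows "weighted_bound (\<lambda>\<eta>. 1 / japanese_bracket \<eta> ^ (2 * m)) (\<lambda>\<xi>. 1 / japanese_bracket \<xi> ^ (2 * m)) (\<lambda>h \<eta>. norm (osc a h \<eta>))"
  using assms
proof (induction m arbitrary: a)
  case 0
  then show ?case using osc_bound_0 by simp
next
  case (Suc m)
  note a = Suc.prems
  have [measurable]: "a \<in> borel_measurable borel" using a by auto
  let ?W = "\<lambda>\<eta>::'a. 1 / japanese_bracket \<eta> ^ (2 * m)" and ?W1 = "\<lambda>\<eta>::'a. 1 / japanese_bracket \<eta> ^ (2 * Suc m)"
  have W: "?W \<in> borel_measurable borel" "\<And>\<eta>. 0 \<le> ?W \<eta>"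
  proof -
    show "?W \<in> borel_measurable borel" by measurable
  qed (simp add: less_imp_le)
  let ?j = "\<lambda>\<xi>::'a. complex_of_real (1 / (japanese_bracket \<xi>)\<^sup>2)"
  have jle: "1 / (japanese_bracket \<xi>)\<^sup>2 \<le> 1" for \<xi> :: 'a
    using one_le_japanese_bracket_power[of \<xi> 2] by (subst divide_le_eq_1_pos) simp_all
  have rj: "rapid (\<lambda>\<xi>. ?j \<xi> * h \<xi>)" if "rapid h" for h
    using that jle by (intro rapid_mult_bounded[where B=1 and M=0]) (auto simp: norm_divide norm_power)
  have rjl: "rapid (\<lambda>\<xi>. (complex_of_real (\<xi> \<bullet> l) * ?j \<xi>) * h \<xi>)" if "rapid h" "l \<in> Basis" for h l
    using rapid_mult_inner[OF rj[OF that(1)] that(2)] by (simp add: mult.assoc)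
  have id: "weighted_bound ?W ?W1 (\<lambda>h \<eta>. norm (osc c (\<lambda>\<xi>. ?j \<xi> * h \<xi>) \<eta>))" if c: "test_on U c" for c
  proof (rule weighted_bound_precompose[OF Suc.IH[OF c] rj])
    fix \<xi> :: 'a
    have "?W \<xi> * (norm (?j \<xi>))\<^sup>2 = ?W1 \<xi> * (1 / (japanese_bracket \<xi>)\<^sup>2)"
      by (simp add: power2_eq_square norm_divide norm_mult)
    also have "\<dots> \<le> ?W1 \<xi> * 1" by (intro mult_left_mono jle) (simp add: less_imp_le)
    finally show "?W \<xi> * (norm (?j \<xi>))\<^sup>2 \<le> ?W1 \<xi>" by simp
  qed
  have mul: "weighted_bound ?W ?W1 (\<lambda>h \<eta>. norm (osc c (\<lambda>\<xi>. (complex_of_real (\<xi> \<bullet> l) * ?j \<xi>) * h \<xi>) \<eta>))"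
    if c: "test_on U c" and l: "l \<in> Basis" for c l
  proof (rule weighted_bound_precompose[OF Suc.IH[OF c] rjl[OF _ l]])
    fix \<xi> :: 'a
    have "(\<xi> \<bullet> l)\<^sup>2 \<le> (japanese_bracket \<xi>)\<^sup>2"
      using inner_le_japanese_bracket[OF l, of \<xi>] by (simp add: power2_le_iff_abs_le less_imp_le)
    then have "?W \<xi> * ((\<xi> \<bullet> l)\<^sup>2 * (1 / (japanese_bracket \<xi>)\<^sup>2)\<^sup>2) \<le> ?W \<xi> * ((japanese_bracket \<xi>)\<^sup>2 * (1 / (japanese_bracket \<xi>)\<^sup>2)\<^sup>2)"
      by (intro mult_left_mono mult_right_mono W(2)) auto
    also have "\<dots> = ?W1 \<xi>" using japanese_bracket_pos[of \<xi>] by (simp add: power2_eq_square)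
    finally show "?W \<xi> * (norm (complex_of_real (\<xi> \<bullet> l) * ?j \<xi>))\<^sup>2 \<le> ?W1 \<xi>"
      by (simp add: norm_mult power_mult_distrib norm_power power_divide norm_divide)
  qed
  let ?m = "\<lambda>l b x. a x * jac_inv l b x"
  let ?d = "\<lambda>l b x. frechet_derivative (\<lambda>x. a x * jac_inv l b x) (at x) b"
  let ?g = "\<lambda>l h \<xi>. (complex_of_real (\<xi> \<bullet> l) * ?j \<xi>) * h \<xi>"
  let ?T = "\<lambda>h \<eta>. norm (osc a (\<lambda>\<xi>. ?j \<xi> * h \<xi>) \<eta>) +
     (\<Sum>l\<in>Basis. \<Sum>b\<in>Basis. norm (osc (?m l b) (?g l h) \<eta>) + norm (osc (?d l b) (?g l h) \<eta>))"
  have "weighted_bound ?W ?W1 ?T"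
    by (intro weighted_bound_add weighted_bound_sum W id mul a test_on_frechet_derivative test_on_jac_inv)
  then show ?case
  proof (rule weighted_bound_mono)
    fix h :: "'a \<Rightarrow> complex" and \<eta> :: 'a assume h: "rapid h"
    have [measurable]: "h \<in> borel_measurable borel" using h by auto
    show "(\<lambda>\<eta>. norm (osc a h \<eta>)) \<in> borel_measurable borel" by measurable
    show "0 \<le> norm (osc a h \<eta>)" by simp
    \<comment> \<open>The squared bracket is written out by \<open>japanese_bracket_sq\<close>, and
      \<open>?j\<close> is its reciprocal.\<close>
    have dec: "h \<xi> = ?j \<xi> * h \<xi> + (\<Sum>l\<in>Basis. complex_of_real (\<xi> \<bullet> l) * ?g l h \<xi>)" for \<xi>
    proof -
      have "?j \<xi> * h \<xi> + (\<Sum>l\<in>Basis. complex_of_real (\<xi> \<bullet> l) * ?g l h \<xi>) =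
        complex_of_real (1 + (\<Sum>l\<in>Basis. (\<xi> \<bullet> l)\<^sup>2)) * (?j \<xi> * h \<xi>)"
        by (simp add: distrib_right sum_distrib_right power2_eq_square mult_ac
            distrib_left sum_distrib_left sum_divide_distrib add_divide_distrib)
      also have "\<dots> = h \<xi>"
        unfolding japanese_bracket_sq[symmetric] using japanese_bracket_pos[of \<xi>] by simp
      finally show ?thesis by simp
    qed
    have rg: "rapid (\<lambda>\<xi>. complex_of_real (\<xi> \<bullet> l) * ?g l h \<xi>)" if "l \<in> Basis" for l
      by (rule rapid_mult_inner[OF rjl[OF h that] that])
    have "osc a h \<eta> = osc a (\<lambda>\<xi>. ?j \<xi> * h \<xi> + (\<Sum>l\<in>Basis. complex_of_real (\<xi> \<bullet> l) * ?g l h \<xi>)) \<eta>"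
      using dec by simp
    also have "\<dots> = osc a (\<lambda>\<xi>. ?j \<xi> * h \<xi>) \<eta> + (\<Sum>l\<in>Basis. osc a (\<lambda>\<xi>. complex_of_real (\<xi> \<bullet> l) * ?g l h \<xi>) \<eta>)"
      by (subst osc_add[OF a rj[OF h] rapid_sum[OF rg]], assumption) (subst osc_sum[OF a rg], auto)
    finally have eq: "osc a h \<eta> = osc a (\<lambda>\<xi>. ?j \<xi> * h \<xi>) \<eta> +
      (\<Sum>l\<in>Basis. osc a (\<lambda>\<xi>. complex_of_real (\<xi> \<bullet> l) * ?g l h \<xi>) \<eta>)" .
    have "norm (osc a (\<lambda>\<xi>. complex_of_real (\<xi> \<bullet> l) * ?g l h \<xi>) \<eta>) \<le>
      japanese_bracket \<eta> * (\<Sum>b\<in>Basis. norm (osc (?m l b) (?g l h) \<eta>) + norm (osc (?d l b) (?g l h) \<eta>))" if l: "l \<in> Basis" for l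
      unfolding osc_input_frequency[OF a rjl[OF h l] l] sum_distrib_left
    proof (rule order_trans[OF norm_sum], rule sum_mono)
      fix b :: 'a assume b: "b \<in> Basis"
      have "norm (complex_of_real (\<eta> \<bullet> b) * osc (?m l b) (?g l h) \<eta> + \<i> * osc (?d l b) (?g l h) \<eta>) \<le>
         \<bar>\<eta> \<bullet> b\<bar> * norm (osc (?m l b) (?g l h) \<eta>) + 1 * norm (osc (?d l b) (?g l h) \<eta>)"
        by (rule order_trans[OF norm_triangle_ineq]) (simp add: norm_mult)
      also have "\<dots> \<le> japanese_bracket \<eta> * norm (osc (?m l b) (?g l h) \<eta>) + japanese_bracket \<eta> * norm (osc (?d l b) (?g l h) \<eta>)"
        by (intro add_mono mult_right_mono inner_le_japanese_bracket b japanese_bracket_ge_1) auto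
      finally show "norm (complex_of_real (\<eta> \<bullet> b) * osc (?m l b) (?g l h) \<eta> + \<i> * osc (?d l b) (?g l h) \<eta>) \<le>
         japanese_bracket \<eta> * (norm (osc (?m l b) (?g l h) \<eta>) + norm (osc (?d l b) (?g l h) \<eta>))"
        by (simp add: distrib_left)
    qed
    then have "norm (\<Sum>l\<in>Basis. osc a (\<lambda>\<xi>. complex_of_real (\<xi> \<bullet> l) * ?g l h \<xi>) \<eta>) \<le>
      japanese_bracket \<eta> * (\<Sum>l\<in>Basis. \<Sum>b\<in>Basis. norm (osc (?m l b) (?g l h) \<eta>) + norm (osc (?d l b) (?g l h) \<eta>))"
      unfolding sum_distrib_left[of "japanese_bracket \<eta>" _ "Basis"] by (intro order_trans[OF norm_sum] sum_mono) (simp add: sum_distrib_left)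
    moreover have "norm (osc a (\<lambda>\<xi>. ?j \<xi> * h \<xi>) \<eta>) \<le> japanese_bracket \<eta> * norm (osc a (\<lambda>\<xi>. ?j \<xi> * h \<xi>) \<eta>)"
      using mult_right_mono[OF japanese_bracket_ge_1[of \<eta>], of "norm (osc a (\<lambda>\<xi>. ?j \<xi> * h \<xi>) \<eta>)"] by simp
    ultimately have "norm (osc a h \<eta>) \<le> japanese_bracket \<eta> * ?T h \<eta>"
      unfolding eq distrib_left by (intro order_trans[OF norm_triangle_ineq] add_mono)
    then have "(norm (osc a h \<eta>))\<^sup>2 \<le> (japanese_bracket \<eta> * ?T h \<eta>)\<^sup>2"
      by (intro power_mono) auto
    then have "?W1 \<eta> * (norm (osc a h \<eta>))\<^sup>2 \<le> ?W1 \<eta> * (japanese_bracket \<eta> * ?T h \<eta>)\<^sup>2"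
      by (rule mult_left_mono) (simp add: less_imp_le)
    also have "\<dots> = ?W \<eta> * (?T h \<eta>)\<^sup>2"
      using japanese_bracket_pos[of \<eta>] by (simp add: power_mult_distrib power2_eq_square)
    finally show "?W1 \<eta> * (norm (osc a h \<eta>))\<^sup>2 \<le> ?W \<eta> * (?T h \<eta>)\<^sup>2" .
  qed
qed

end

section \<open>Moderately varying weights\<close>

text \<open>The ratio sum is symmetric, so growth and decay are controlled alike; it is also the
  quantity in which the shell estimate below decays.\<close>

definition moderate :: "(real \<Rightarrow> real) \<Rightarrow> bool" where
  "moderate \<omega> \<longleftrightarrow> (\<forall>t\<ge>1. 0 \<le> \<omega> t) \<and>
     (\<exists>C M. 0 \<le> C \<and> (\<forall>s\<ge>1. \<forall>t\<ge>1. \<omega> s \<le> C * (s / t + t / s) ^ M * \<omega> t))"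

text \<open>The terms are dominated by a growing geometric series up to 2^k = t and by a decaying
  one afterwards; each of the two sums to at most 2.\<close>

lemma dyadic_sum_le:
  fixes t :: real assumes t: "t \<ge> 1"
  shows "(\<Sum>k<n. 1 / (t / 2 ^ k + 2 ^ k / t)) \<le> 4"
proof -
  have le: "1 / (t / 2 ^ k + 2 ^ k / t) \<le> 2 ^ k / t" "1 / (t / 2 ^ k + 2 ^ k / t) \<le> t / 2 ^ k" for k
  proof -
    have x: "0 < t / 2 ^ k" "0 < 2 ^ k / t" using t by auto
    have "1 / (t / 2 ^ k + 2 ^ k / t) \<le> 1 / (t / 2 ^ k)" "1 / (t / 2 ^ k + 2 ^ k / t) \<le> 1 / (2 ^ k / t)"
      using x by (intro divide_left_mono mult_pos_pos; simp)+
    then show "1 / (t / 2 ^ k + 2 ^ k / t) \<le> 2 ^ k / t" "1 / (t / 2 ^ k + 2 ^ k / t) \<le> t / 2 ^ k" by simp_all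
  qed
  \<comment> \<open>The bound is strengthened to make the induction work: 2^n / t as long as the
    terms grow, afterwards 4 minus the tail 2 t / 2^n of the decaying series.\<close>
  have "(\<Sum>k<n. 1 / (t / 2 ^ k + 2 ^ k / t)) \<le> (if 2 ^ n \<le> t then 2 ^ n / t else 4 - 2 * t / 2 ^ n)"
  proof (induction n)
    case 0
    then show ?case using t by simp
  next
    case (Suc n)
    consider "2 ^ Suc n \<le> t" | "2 ^ n \<le> t" "\<not> 2 ^ Suc n \<le> t" | "\<not> 2 ^ n \<le> t" by blast
    then show ?case
    proof cases
      case 1
      moreover have "(2::real) ^ n \<le> t" by (rule order_trans[OF _ 1]) simp
      ultimately show ?thesis using Suc le(1)[of n] by simp
    next
      case 2
      define y where "y = 2 ^ Suc n / t"
      have y: "1 \<le> y" "y \<le> 2" using 2 t by (auto simp: y_def field_simps)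
      have "(\<Sum>k<Suc n. 1 / (t / 2 ^ k + 2 ^ k / t)) \<le> y" using Suc 2 le(1)[of n] by (simp add: y_def)
      also have "y \<le> 4 - 2 / y"
      proof -
        have "0 \<le> (2 - y) * (y - 1) + y" using y by (intro add_nonneg_nonneg mult_nonneg_nonneg) auto
        then have "y * y + 2 \<le> 4 * y" by (simp add: algebra_simps)
        then show ?thesis using y by (simp add: field_simps)
      qed
      also have "4 - 2 / y = 4 - 2 * t / 2 ^ Suc n" by (simp add: y_def)
      finally show ?thesis using 2 by simp
    next
      case 3
      moreover have "(2::real) ^ n \<le> 2 ^ Suc n" by simp
      ultimately have "\<not> (2::real) ^ Suc n \<le> t" by linarith
      with 3 Suc le(2)[of n] show ?thesis by (simp add: field_simps)
    qed
  qed
  also have "\<dots> \<le> 4" using t by (auto simp: pos_divide_le_eq)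
  finally show ?thesis .
qed

lemma dyadic_suminf_le:
  fixes t :: real assumes t: "t \<ge> 1"
  shows "(\<Sum>k. ennreal (1 / (t / 2 ^ k + 2 ^ k / t))) \<le> ennreal 4"
proof (rule suminf_le_const)
  fix n
  have "(\<Sum>k<n. ennreal (1 / (t / 2 ^ k + 2 ^ k / t))) = ennreal (\<Sum>k<n. 1 / (t / 2 ^ k + 2 ^ k / t))"
    using t by (intro sum_ennreal) auto
  then show "(\<Sum>k<n. ennreal (1 / (t / 2 ^ k + 2 ^ k / t))) \<le> ennreal 4"
    using dyadic_sum_le[OF t, of n] by (simp add: ennreal_leI del: ennreal_numeral)
qed simp

lemma dyadic_index_exists:
  fixes t :: real assumes "t \<ge> 1"
  shows "\<exists>k. 2 ^ k \<le> t \<and> t < 2 ^ Suc k"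
proof -
  obtain n where n: "t < 2 ^ n" using real_arch_pow[of 2 t] by auto
  define k where "k = (LEAST n. t < 2 ^ n)"
  have k: "t < 2 ^ k" unfolding k_def using n by (rule LeastI)
  then have "k \<noteq> 0" using assms by (intro notI) simp
  then obtain j where j: "k = Suc j" by (cases k) auto
  have "\<not> t < 2 ^ j" using not_less_Least[of j "\<lambda>n. t < 2 ^ n"] j k_def by simp
  then show ?thesis using k j by (intro exI[of _ j]) auto
qed

lemma ratio_sum_ge_2:
  fixes r :: real assumes "r > 0" shows "2 \<le> r + 1 / r"
proof -
  have "0 \<le> (r - 1)\<^sup>2" by simp
  then have "2 * r \<le> r * r + 1" by (simp add: power2_eq_square algebra_simps)
  then show ?thesis using assms by (simp add: field_simps)
qed

context change_of_variables
begin

text \<open>On the dyadic shell \<open>japanese_bracket \<eta> \<approx> 2 ^ k\<close> the part of \<open>h\<close> of frequency below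
  \<open>2 ^ k\<close> is controlled by a positive and the rest by a negative power weight.\<close>

lemma osc_shell_bound:
  assumes a: "test_on U a"
  obtains D where "0 \<le> D" "\<forall>k h. rapid h \<longrightarrow>
     (\<integral>\<^sup>+\<eta>. ennreal (indicator {\<eta>. 2 ^ k \<le> japanese_bracket \<eta> \<and> japanese_bracket \<eta> < 2 ^ Suc k} \<eta> * (norm (osc a h \<eta>))\<^sup>2) \<partial>lborel) \<le>
     ennreal D * (\<integral>\<^sup>+\<xi>. ennreal (1 / (japanese_bracket \<xi> / 2 ^ k + 2 ^ k / japanese_bracket \<xi>) ^ (2 * m) * (norm (h \<xi>))\<^sup>2) \<partial>lborel)"
proof -
  have [measurable]: "a \<in> borel_measurable borel" using a by auto
  obtain P where P: "0 \<le> P" "\<forall>h. rapid h \<longrightarrow>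
     (\<integral>\<^sup>+\<eta>. ennreal (japanese_bracket \<eta> ^ (2 * m) * (norm (osc a h \<eta>))\<^sup>2) \<partial>lborel) \<le>
     ennreal P * (\<integral>\<^sup>+\<xi>. ennreal (japanese_bracket \<xi> ^ (2 * m) * (norm (h \<xi>))\<^sup>2) \<partial>lborel)"
    by (rule weighted_boundE[OF osc_bound_pos[OF a]])
  obtain N where N: "0 \<le> N" "\<forall>h. rapid h \<longrightarrow>
     (\<integral>\<^sup>+\<eta>. ennreal (1 / japanese_bracket \<eta> ^ (2 * m) * (norm (osc a h \<eta>))\<^sup>2) \<partial>lborel) \<le>
     ennreal N * (\<integral>\<^sup>+\<xi>. ennreal (1 / japanese_bracket \<xi> ^ (2 * m) * (norm (h \<xi>))\<^sup>2) \<partial>lborel)"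
    by (rule weighted_boundE[OF osc_bound_neg[OF a]])
  define D where "D = 2 * P * 2 ^ (2 * m) + 2 * 2 ^ (2 * m) * N * 2 ^ (2 * m)"
  have D0: "0 \<le> D" using P(1) N(1) by (simp add: D_def)
  have "(\<integral>\<^sup>+\<eta>. ennreal (indicator {\<eta>. 2 ^ k \<le> japanese_bracket \<eta> \<and> japanese_bracket \<eta> < 2 ^ Suc k} \<eta> * (norm (osc a h \<eta>))\<^sup>2) \<partial>lborel) \<le>
     ennreal D * (\<integral>\<^sup>+\<xi>. ennreal (1 / (japanese_bracket \<xi> / 2 ^ k + 2 ^ k / japanese_bracket \<xi>) ^ (2 * m) * (norm (h \<xi>))\<^sup>2) \<partial>lborel)"
    if h: "rapid h" for k h
  proof -
    have [measurable]: "h \<in> borel_measurable borel" using h by auto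
    define c :: real where "c = 2 ^ k"
    have c: "c > 0" by (simp add: c_def)
    define l where "l \<xi> = indicator {\<xi>. japanese_bracket \<xi> < c} \<xi> * h \<xi>" for \<xi>
    define u where "u \<xi> = indicator {\<xi>. c \<le> japanese_bracket \<xi>} \<xi> * h \<xi>" for \<xi>
    have rl: "rapid l" unfolding l_def
      by (rule rapid_mult_bounded[OF h, where B=1 and M=0]) (measurable, auto split: split_indicator)
    have ru: "rapid u" unfolding u_def
      by (rule rapid_mult_bounded[OF h, where B=1 and M=0]) (measurable, auto split: split_indicator)
    have [measurable]: "l \<in> borel_measurable borel" "u \<in> borel_measurable borel" using rl ru by auto
    have hlu: "h = (\<lambda>\<xi>. l \<xi> + u \<xi>)" by (auto simp: l_def u_def fun_eq_iff split: split_indicator)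
    let ?q = "\<lambda>\<xi>::'a. 1 / (japanese_bracket \<xi> / c + c / japanese_bracket \<xi>) ^ (2 * m)"
    let ?I = "\<integral>\<^sup>+\<xi>. ennreal (?q \<xi> * (norm (h \<xi>))\<^sup>2) \<partial>lborel"
    let ?A = "{\<eta>::'a. c \<le> japanese_bracket \<eta> \<and> japanese_bracket \<eta> < 2 * c}"
    \<comment> \<open>The constants make each power weight at least 2 on the shell, where the
      bracket is at least \<open>c\<close> (low part) and below \<open>2 * c\<close> (high part).
      The 2 pays for (x + y)^2 <= 2 x^2 + 2 y^2.\<close>
    let ?\<alpha> = "2 / c ^ (2 * m)" and ?\<beta> = "2 * (2 * c) ^ (2 * m)"
    have q0: "0 \<le> ?q \<xi>" for \<xi> using c by (simp add: less_imp_le)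
    have "(\<integral>\<^sup>+\<eta>. ennreal (indicator ?A \<eta> * (norm (osc a h \<eta>))\<^sup>2) \<partial>lborel) \<le>
      (\<integral>\<^sup>+\<eta>. ennreal ?\<alpha> * ennreal (japanese_bracket \<eta> ^ (2 * m) * (norm (osc a l \<eta>))\<^sup>2) +
         ennreal ?\<beta> * ennreal (1 / japanese_bracket \<eta> ^ (2 * m) * (norm (osc a u \<eta>))\<^sup>2) \<partial>lborel)"
    proof (intro nn_integral_mono)
      fix \<eta> :: 'a
      let ?j = "japanese_bracket \<eta>"
      have "indicator ?A \<eta> * (norm (osc a h \<eta>))\<^sup>2 \<le>
         ?\<alpha> * (?j ^ (2 * m) * (norm (osc a l \<eta>))\<^sup>2) + ?\<beta> * (1 / ?j ^ (2 * m) * (norm (osc a u \<eta>))\<^sup>2)"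
      proof (cases "\<eta> \<in> ?A")
        case True
        have 1: "1 \<le> (?j / c) ^ (2 * m)" and 2: "1 \<le> (2 * c / ?j) ^ (2 * m)"
          using True c by (auto intro!: one_le_power)
        have "osc a h \<eta> = osc a l \<eta> + osc a u \<eta>" unfolding hlu by (rule osc_add[OF a rl ru])
        then have "norm (osc a h \<eta>) \<le> norm (osc a l \<eta>) + norm (osc a u \<eta>)" by (simp add: norm_triangle_ineq)
        then have "(norm (osc a h \<eta>))\<^sup>2 \<le> (norm (osc a l \<eta>) + norm (osc a u \<eta>))\<^sup>2" by (rule power_mono) simp
        also have "\<dots> \<le> 2 * (norm (osc a l \<eta>))\<^sup>2 + 2 * (norm (osc a u \<eta>))\<^sup>2"
          using zero_le_power2[of "norm (osc a l \<eta>) - norm (osc a u \<eta>)"] by (simp add: power2_sum power2_diff)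
        also have "\<dots> \<le> (?j / c) ^ (2 * m) * (2 * (norm (osc a l \<eta>))\<^sup>2) + (2 * c / ?j) ^ (2 * m) * (2 * (norm (osc a u \<eta>))\<^sup>2)"
          using mult_right_mono[OF 1, of "2 * (norm (osc a l \<eta>))\<^sup>2"] mult_right_mono[OF 2, of "2 * (norm (osc a u \<eta>))\<^sup>2"] by simp
        also have "\<dots> = ?\<alpha> * (?j ^ (2 * m) * (norm (osc a l \<eta>))\<^sup>2) + ?\<beta> * (1 / ?j ^ (2 * m) * (norm (osc a u \<eta>))\<^sup>2)"
          by (simp add: power_divide power_mult_distrib mult_ac)
        finally show ?thesis using True by simp
      qed (use c in \<open>simp add: less_imp_le\<close>)
      then have "ennreal (indicator ?A \<eta> * (norm (osc a h \<eta>))\<^sup>2) \<le>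
         ennreal (?\<alpha> * (?j ^ (2 * m) * (norm (osc a l \<eta>))\<^sup>2) + ?\<beta> * (1 / ?j ^ (2 * m) * (norm (osc a u \<eta>))\<^sup>2))"
        by (rule ennreal_leI)
      also have "\<dots> = ennreal ?\<alpha> * ennreal (?j ^ (2 * m) * (norm (osc a l \<eta>))\<^sup>2) + ennreal ?\<beta> * ennreal (1 / ?j ^ (2 * m) * (norm (osc a u \<eta>))\<^sup>2)"
        using c by (subst (1 2) ennreal_mult[symmetric]) (auto simp: less_imp_le intro!: ennreal_plus)
      finally show "ennreal (indicator ?A \<eta> * (norm (osc a h \<eta>))\<^sup>2) \<le> ennreal ?\<alpha> * ennreal (?j ^ (2 * m) * (norm (osc a l \<eta>))\<^sup>2) +
         ennreal ?\<beta> * ennreal (1 / ?j ^ (2 * m) * (norm (osc a u \<eta>))\<^sup>2)" .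
    qed
    also have "\<dots> = ennreal ?\<alpha> * (\<integral>\<^sup>+\<eta>. ennreal (japanese_bracket \<eta> ^ (2 * m) * (norm (osc a l \<eta>))\<^sup>2) \<partial>lborel) +
         ennreal ?\<beta> * (\<integral>\<^sup>+\<eta>. ennreal (1 / japanese_bracket \<eta> ^ (2 * m) * (norm (osc a u \<eta>))\<^sup>2) \<partial>lborel)"
      by (subst nn_integral_add) (simp_all add: nn_integral_cmult)
    also have "\<dots> \<le> ennreal ?\<alpha> * (ennreal P * (\<integral>\<^sup>+\<xi>. ennreal (japanese_bracket \<xi> ^ (2 * m) * (norm (l \<xi>))\<^sup>2) \<partial>lborel)) +
         ennreal ?\<beta> * (ennreal N * (\<integral>\<^sup>+\<xi>. ennreal (1 / japanese_bracket \<xi> ^ (2 * m) * (norm (u \<xi>))\<^sup>2) \<partial>lborel))"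
      by (intro add_mono mult_left_mono P(2)[rule_format] N(2)[rule_format] rl ru) auto
    also have "\<dots> = ennreal P * (\<integral>\<^sup>+\<xi>. ennreal (?\<alpha> * (japanese_bracket \<xi> ^ (2 * m) * (norm (l \<xi>))\<^sup>2)) \<partial>lborel) +
         ennreal N * (\<integral>\<^sup>+\<xi>. ennreal (?\<beta> * (1 / japanese_bracket \<xi> ^ (2 * m) * (norm (u \<xi>))\<^sup>2)) \<partial>lborel)"
      using c by (subst (1 2) ennreal_mult) (auto simp: less_imp_le nn_integral_cmult mult.left_commute)
    also have "\<dots> \<le> ennreal P * (\<integral>\<^sup>+\<xi>. ennreal (2 * 2 ^ (2 * m)) * ennreal (?q \<xi> * (norm (h \<xi>))\<^sup>2) \<partial>lborel) +
         ennreal N * (\<integral>\<^sup>+\<xi>. ennreal (2 * 2 ^ (2 * m) * 2 ^ (2 * m)) * ennreal (?q \<xi> * (norm (h \<xi>))\<^sup>2) \<partial>lborel)"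
    proof (intro add_mono mult_left_mono nn_integral_mono)
      fix \<xi> :: 'a
      let ?j = "japanese_bracket \<xi>"
      let ?s = "?j / c + c / ?j"
      have s: "?s > 0" using c by (intro add_pos_pos) auto
      have "?\<alpha> * (?j ^ (2 * m) * (norm (l \<xi>))\<^sup>2) \<le> (2 * 2 ^ (2 * m)) * (?q \<xi> * (norm (h \<xi>))\<^sup>2)"
      proof (cases "?j < c")
        case True
        \<comment> \<open>For r = \<open>?j / c\<close> at most 1, r (r + 1/r) = r^2 + 1 <= 2, so r
          is at most twice the reciprocal of the ratio sum. The high part uses the same with r
          inverted.\<close>
        have "?j / c * ?s = (?j / c)\<^sup>2 + 1" using c by (simp add: power2_eq_square distrib_left)
        also have "\<dots> \<le> 2" using True c power_le_one[of "?j / c" 2] by (simp add: less_imp_le)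
        finally have "?j / c \<le> 2 / ?s" using s by (simp add: pos_le_divide_eq)
        then have "(?j / c) ^ (2 * m) \<le> (2 / ?s) ^ (2 * m)" using c by (intro power_mono) (auto simp: less_imp_le)
        then have "2 * (?j / c) ^ (2 * m) * (norm (h \<xi>))\<^sup>2 \<le> 2 * (2 / ?s) ^ (2 * m) * (norm (h \<xi>))\<^sup>2"
          by (intro mult_right_mono mult_left_mono) auto
        then show ?thesis using True by (simp add: l_def power_divide mult_ac)
      qed (use q0[of \<xi>] in \<open>simp add: l_def\<close>)
      then show "ennreal (?\<alpha> * (?j ^ (2 * m) * (norm (l \<xi>))\<^sup>2)) \<le> ennreal (2 * 2 ^ (2 * m)) * ennreal (?q \<xi> * (norm (h \<xi>))\<^sup>2)"
        using q0[of \<xi>] by (subst ennreal_mult[symmetric]) (auto intro: ennreal_leI)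
      have "?\<beta> * (1 / ?j ^ (2 * m) * (norm (u \<xi>))\<^sup>2) \<le> (2 * 2 ^ (2 * m) * 2 ^ (2 * m)) * (?q \<xi> * (norm (h \<xi>))\<^sup>2)"
      proof (cases "c \<le> ?j")
        case True
        have "c / ?j * ?s = (c / ?j)\<^sup>2 + 1" using c by (simp add: power2_eq_square distrib_left)
        also have "\<dots> \<le> 2" using True c power_le_one[of "c / ?j" 2] by (simp add: less_imp_le)
        finally have "c / ?j \<le> 2 / ?s" using s by (simp add: pos_le_divide_eq)
        then have "(c / ?j) ^ (2 * m) \<le> (2 / ?s) ^ (2 * m)" using c by (intro power_mono) (auto simp: less_imp_le)
        then have "(2 * 2 ^ (2 * m)) * (c / ?j) ^ (2 * m) * (norm (h \<xi>))\<^sup>2 \<le> (2 * 2 ^ (2 * m)) * (2 / ?s) ^ (2 * m) * (norm (h \<xi>))\<^sup>2"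
          by (intro mult_right_mono mult_left_mono) auto
        then show ?thesis using True by (simp add: u_def power_divide power_mult_distrib mult_ac)
      qed (use q0[of \<xi>] in \<open>simp add: u_def\<close>)
      then show "ennreal (?\<beta> * (1 / ?j ^ (2 * m) * (norm (u \<xi>))\<^sup>2)) \<le> ennreal (2 * 2 ^ (2 * m) * 2 ^ (2 * m)) * ennreal (?q \<xi> * (norm (h \<xi>))\<^sup>2)"
        using q0[of \<xi>] by (subst ennreal_mult[symmetric]) (auto intro: ennreal_leI)
    qed auto
    also have "\<dots> = ennreal P * (ennreal (2 * 2 ^ (2 * m)) * ?I) + ennreal N * (ennreal (2 * 2 ^ (2 * m) * 2 ^ (2 * m)) * ?I)"
      by (simp add: nn_integral_cmult)
    also have "\<dots> = ennreal (P * (2 * 2 ^ (2 * m))) * ?I + ennreal (N * (2 * 2 ^ (2 * m) * 2 ^ (2 * m))) * ?I"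
      by (simp only: ennreal_mult'[OF P(1)] ennreal_mult'[OF N(1)] mult.assoc)
    also have "\<dots> = (ennreal (P * (2 * 2 ^ (2 * m))) + ennreal (N * (2 * 2 ^ (2 * m) * 2 ^ (2 * m)))) * ?I"
      by (rule distrib_right[symmetric])
    also have "ennreal (P * (2 * 2 ^ (2 * m))) + ennreal (N * (2 * 2 ^ (2 * m) * 2 ^ (2 * m))) = ennreal D"
      using P(1) N(1) by (subst ennreal_plus[symmetric]) (auto simp: D_def mult_ac)
    finally show ?thesis by (simp add: c_def)
  qed
  with D0 show ?thesis by (intro that) auto
qed

text \<open>The shell estimate is taken with exponent \<open>2 * Suc M\<close>: comparing
  \<open>\<omega> (2 ^ k)\<close> with the weight at the input frequency loses the power
  \<open>M\<close> of the ratio sum, and the power \<open>M + 2\<close> left in the denominator is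
  more than the first power, for which the dyadic sum is at most 4.\<close>

theorem osc_bound_moderate:
  assumes a: "test_on U a" and \<omega>: "moderate \<omega>"
    and m\<omega> [measurable]: "(\<lambda>\<xi>::'a. \<omega> (japanese_bracket \<xi>)) \<in> borel_measurable borel"
  shows "weighted_bound (\<lambda>\<eta>. \<omega> (japanese_bracket \<eta>)) (\<lambda>\<xi>. \<omega> (japanese_bracket \<xi>)) (\<lambda>h \<eta>. norm (osc a h \<eta>))"
proof -
  have [measurable]: "a \<in> borel_measurable borel" using a by auto
  have \<omega>0: "0 \<le> \<omega> t" if "t \<ge> 1" for t using \<omega> that by (simp add: moderate_def)
  obtain C M where C: "0 \<le> C" and CM: "\<forall>s\<ge>1. \<forall>t\<ge>1. \<omega> s \<le> C * (s / t + t / s) ^ M * \<omega> t"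
    using \<omega> unfolding moderate_def by (elim conjE exE)
  let ?q = "\<lambda>k (\<xi>::'a). 1 / (japanese_bracket \<xi> / 2 ^ k + 2 ^ k / japanese_bracket \<xi>) ^ (2 * Suc M)"
  let ?A = "\<lambda>k. {\<eta>::'a. 2 ^ k \<le> japanese_bracket \<eta> \<and> japanese_bracket \<eta> < 2 ^ Suc k}"
  obtain D where D: "0 \<le> D" "\<forall>k h. rapid h \<longrightarrow>
     (\<integral>\<^sup>+\<eta>. ennreal (indicator (?A k) \<eta> * (norm (osc a h \<eta>))\<^sup>2) \<partial>lborel) \<le>
     ennreal D * (\<integral>\<^sup>+\<xi>. ennreal (?q k \<xi> * (norm (h \<xi>))\<^sup>2) \<partial>lborel)"
    by (rule osc_shell_bound[OF a, where m="Suc M"])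
  \<comment> \<open>On the k-th shell the ratio sum of the bracket and 2^k is at most 2 + 1 =
    3.\<close>
  let ?E = "C * 3 ^ M"
  have E: "0 \<le> ?E" using C by simp
  have p1: "(1::real) \<le> 2 ^ k" for k by simp
  have main: "(\<integral>\<^sup>+\<eta>. ennreal (\<omega> (japanese_bracket \<eta>) * (norm (osc a h \<eta>))\<^sup>2) \<partial>lborel) \<le>
     ennreal (?E * D * C * 4) * (\<integral>\<^sup>+\<xi>. ennreal (\<omega> (japanese_bracket \<xi>) * (norm (h \<xi>))\<^sup>2) \<partial>lborel)" if h: "rapid h" for h
  proof -
    have [measurable]: "h \<in> borel_measurable borel" using h by auto
    have "(\<integral>\<^sup>+\<eta>. ennreal (\<omega> (japanese_bracket \<eta>) * (norm (osc a h \<eta>))\<^sup>2) \<partial>lborel) \<le>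
      (\<integral>\<^sup>+\<eta>. (\<Sum>k. ennreal (?E * \<omega> (2 ^ k)) * ennreal (indicator (?A k) \<eta> * (norm (osc a h \<eta>))\<^sup>2)) \<partial>lborel)"
    proof (intro nn_integral_mono)
      fix \<eta> :: 'a
      obtain k where k: "2 ^ k \<le> japanese_bracket \<eta>" "japanese_bracket \<eta> < 2 ^ Suc k"
        using dyadic_index_exists[OF japanese_bracket_ge_1[of \<eta>]] by blast
      have "japanese_bracket \<eta> / 2 ^ k + 2 ^ k / japanese_bracket \<eta> \<le> 2 + 1"
        using k by (intro add_mono) (auto simp: pos_divide_le_eq)
      then have "(japanese_bracket \<eta> / 2 ^ k + 2 ^ k / japanese_bracket \<eta>) ^ M \<le> 3 ^ M"
        by (intro power_mono) (auto simp: less_imp_le)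
      then have "C * (japanese_bracket \<eta> / 2 ^ k + 2 ^ k / japanese_bracket \<eta>) ^ M * \<omega> (2 ^ k) \<le> ?E * \<omega> (2 ^ k)"
        using C \<omega>0[OF p1] by (intro mult_right_mono mult_left_mono)
      then have "\<omega> (japanese_bracket \<eta>) \<le> ?E * \<omega> (2 ^ k)"
        using CM[rule_format, OF japanese_bracket_ge_1[of \<eta>] p1[of k]] by linarith
      then have "\<omega> (japanese_bracket \<eta>) * (norm (osc a h \<eta>))\<^sup>2 \<le> (?E * \<omega> (2 ^ k)) * (indicator (?A k) \<eta> * (norm (osc a h \<eta>))\<^sup>2)"
        using k by (simp add: mult_right_mono)
      then have "ennreal (\<omega> (japanese_bracket \<eta>) * (norm (osc a h \<eta>))\<^sup>2) \<le>
        ennreal (?E * \<omega> (2 ^ k)) * ennreal (indicator (?A k) \<eta> * (norm (osc a h \<eta>))\<^sup>2)"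
        using E \<omega>0[OF p1] by (subst ennreal_mult[symmetric]) (auto intro: ennreal_leI)
      also have "\<dots> = (\<Sum>k\<in>{k}. ennreal (?E * \<omega> (2 ^ k)) * ennreal (indicator (?A k) \<eta> * (norm (osc a h \<eta>))\<^sup>2))" by simp
      also have "\<dots> \<le> (\<Sum>k. ennreal (?E * \<omega> (2 ^ k)) * ennreal (indicator (?A k) \<eta> * (norm (osc a h \<eta>))\<^sup>2))"
        by (rule sum_le_suminf) auto
      finally show "ennreal (\<omega> (japanese_bracket \<eta>) * (norm (osc a h \<eta>))\<^sup>2) \<le>
        (\<Sum>k. ennreal (?E * \<omega> (2 ^ k)) * ennreal (indicator (?A k) \<eta> * (norm (osc a h \<eta>))\<^sup>2))" .
    qed
    also have "\<dots> = (\<Sum>k. ennreal (?E * \<omega> (2 ^ k)) * (\<integral>\<^sup>+\<eta>. ennreal (indicator (?A k) \<eta> * (norm (osc a h \<eta>))\<^sup>2) \<partial>lborel))"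
      by (subst nn_integral_suminf) (simp_all add: nn_integral_cmult)
    also have "\<dots> \<le> (\<Sum>k. ennreal (?E * \<omega> (2 ^ k)) * (ennreal D * (\<integral>\<^sup>+\<xi>. ennreal (?q k \<xi> * (norm (h \<xi>))\<^sup>2) \<partial>lborel)))"
      using D(2) h by (intro suminf_le mult_left_mono) auto
    also have "\<dots> = (\<integral>\<^sup>+\<xi>. (\<Sum>k. ennreal (?E * \<omega> (2 ^ k)) * (ennreal D * ennreal (?q k \<xi> * (norm (h \<xi>))\<^sup>2))) \<partial>lborel)"
      by (subst nn_integral_suminf) (simp_all add: nn_integral_cmult)
    also have "\<dots> \<le> (\<integral>\<^sup>+\<xi>. ennreal (?E * D * C * 4) * ennreal (\<omega> (japanese_bracket \<xi>) * (norm (h \<xi>))\<^sup>2) \<partial>lborel)"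
    proof (intro nn_integral_mono)
      fix \<xi> :: 'a
      let ?j = "japanese_bracket \<xi>"
      let ?s = "\<lambda>k. ?j / 2 ^ k + 2 ^ k / ?j"
      let ?G = "?E * D * C * (\<omega> ?j * (norm (h \<xi>))\<^sup>2)"
      have G: "0 \<le> ?G" using E D(1) C \<omega>0[OF japanese_bracket_ge_1[of \<xi>]] by simp
      have "(\<Sum>k. ennreal (?E * \<omega> (2 ^ k)) * (ennreal D * ennreal (?q k \<xi> * (norm (h \<xi>))\<^sup>2))) \<le>
        (\<Sum>k. ennreal ?G * ennreal (1 / ?s k))"
      proof (intro suminf_le)
        fix k :: nat
        have s1: "1 \<le> ?s k" using ratio_sum_ge_2[of "?j / 2 ^ k"] by simp
        then have s0: "0 < ?s k" by linarith
        have "\<omega> (2 ^ k) \<le> C * (2 ^ k / ?j + ?j / 2 ^ k) ^ M * \<omega> ?j"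
          by (rule CM[rule_format, OF p1 japanese_bracket_ge_1])
        then have "\<omega> (2 ^ k) * ?q k \<xi> \<le> C * (?s k) ^ M * \<omega> ?j * ?q k \<xi>"
          by (intro mult_right_mono) (auto simp: add.commute less_imp_le)
        also have "\<dots> = C * \<omega> ?j * ((?s k) ^ M / (?s k) ^ (2 * Suc M))" by simp
        also have "(?s k) ^ M / (?s k) ^ (2 * Suc M) = 1 / (?s k) ^ (M + 2)"
        proof -
          have "(?s k) ^ (2 * Suc M) = (?s k) ^ M * (?s k) ^ (M + 2)"
            by (simp only: power_add[symmetric]) (rule arg_cong[of _ _ "power (?s k)"], simp)
          then show ?thesis using s0 by simp
        qed
        also have "C * \<omega> ?j * (1 / (?s k) ^ (M + 2)) \<le> C * \<omega> ?j * (1 / ?s k)"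
          using s1 s0 C \<omega>0[OF japanese_bracket_ge_1[of \<xi>]] power_increasing[of 1 "M + 2" "?s k"]
          by (intro mult_left_mono divide_left_mono mult_nonneg_nonneg mult_pos_pos zero_less_power) auto
        finally have "?E * D * (norm (h \<xi>))\<^sup>2 * (\<omega> (2 ^ k) * ?q k \<xi>) \<le> ?E * D * (norm (h \<xi>))\<^sup>2 * (C * \<omega> ?j * (1 / ?s k))"
          using C D(1) by (intro mult_left_mono mult_nonneg_nonneg) auto
        then have "(?E * \<omega> (2 ^ k)) * (D * (?q k \<xi> * (norm (h \<xi>))\<^sup>2)) \<le> ?G * (1 / ?s k)"
          by (simp add: mult_ac)
        moreover have "ennreal (?E * \<omega> (2 ^ k)) * (ennreal D * ennreal (?q k \<xi> * (norm (h \<xi>))\<^sup>2)) =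
          ennreal ((?E * \<omega> (2 ^ k)) * (D * (?q k \<xi> * (norm (h \<xi>))\<^sup>2)))"
          using E D(1) s0 \<omega>0[OF p1[of k]] by (subst (1 2) ennreal_mult) (auto simp: less_imp_le)
        moreover have "ennreal ?G * ennreal (1 / ?s k) = ennreal (?G * (1 / ?s k))"
          using G s0 by (subst ennreal_mult) (auto simp: less_imp_le)
        ultimately show "ennreal (?E * \<omega> (2 ^ k)) * (ennreal D * ennreal (?q k \<xi> * (norm (h \<xi>))\<^sup>2)) \<le> ennreal ?G * ennreal (1 / ?s k)"
          by (simp only: ennreal_leI)
      qed auto
      also have "\<dots> = ennreal ?G * (\<Sum>k. ennreal (1 / ?s k))" by (rule ennreal_suminf_cmult)
      also have "\<dots> \<le> ennreal ?G * ennreal 4"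
        by (intro mult_left_mono dyadic_suminf_le japanese_bracket_ge_1) simp
      also have "\<dots> = ennreal (?G * 4)" using G by (subst ennreal_mult) auto
      also have "?G * 4 = (?E * D * C * 4) * (\<omega> ?j * (norm (h \<xi>))\<^sup>2)" by (simp add: mult_ac)
      also have "ennreal \<dots> = ennreal (?E * D * C * 4) * ennreal (\<omega> ?j * (norm (h \<xi>))\<^sup>2)"
        using E D(1) C \<omega>0[OF japanese_bracket_ge_1[of \<xi>]] by (intro ennreal_mult) auto
      finally show "(\<Sum>k. ennreal (?E * \<omega> (2 ^ k)) * (ennreal D * ennreal (?q k \<xi> * (norm (h \<xi>))\<^sup>2))) \<le>
        ennreal (?E * D * C * 4) * ennreal (\<omega> ?j * (norm (h \<xi>))\<^sup>2)" .
    qed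
    also have "\<dots> = ennreal (?E * D * C * 4) * (\<integral>\<^sup>+\<xi>. ennreal (\<omega> (japanese_bracket \<xi>) * (norm (h \<xi>))\<^sup>2) \<partial>lborel)"
      by (rule nn_integral_cmult) measurable
    finally show ?thesis .
  qed
  have "0 \<le> ?E * D * C * 4" using E D(1) C by simp
  with main show ?thesis
    unfolding weighted_bound_def by (intro conjI allI impI exI[of _ "?E * D * C * 4"]) auto
qed

end

subsection \<open>Regularly varying weights are moderate\<close>

context
  fixes \<phi> :: "real \<Rightarrow> real"
  assumes \<phi>: "\<phi> \<in> class_M"
begin

text \<open>In logarithmic coordinates slow variation becomes a statement about increments. The
  maximum with 0 keeps the argument of \<phi> at least 1, so the function is Borel on the whole
  line.\<close>

definition log_phi :: "real \<Rightarrow> real" where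
  "log_phi x = ln (\<phi> (exp (max x 0)))"

lemma class_M_pos: "t \<ge> 1 \<Longrightarrow> 0 < \<phi> t"
  using \<phi> by (simp add: class_M_def)

lemma log_phi_measurable [measurable]: "log_phi \<in> borel_measurable borel"
proof -
  have p: "\<phi> \<in> borel_measurable (restrict_space borel {1..})" using \<phi> by (simp add: class_M_def)
  have "(\<lambda>x. exp (max x 0)) \<in> borel \<rightarrow>\<^sub>M restrict_space borel {1::real..}"
    by (rule measurable_restrict_space2) auto
  then have [measurable]: "(\<lambda>x. \<phi> (exp (max x 0))) \<in> borel_measurable borel"
    using p by (rule measurable_compose)
  show ?thesis unfolding log_phi_def[abs_def] by measurable
qed

lemma log_phi_slowly_varying:
  assumes "u \<ge> 0"
  shows "((\<lambda>x. log_phi (x + u) - log_phi x) \<longlongrightarrow> 0) at_top"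
proof -
  have "((\<lambda>t. \<phi> (exp u * t) / \<phi> t) \<longlongrightarrow> 1) at_top" using \<phi> by (simp add: class_M_def)
  then have "((\<lambda>x. \<phi> (exp u * exp x) / \<phi> (exp x)) \<longlongrightarrow> 1) at_top"
    by (rule filterlim_compose) (rule exp_at_top)
  then have "((\<lambda>x. ln (\<phi> (exp u * exp x) / \<phi> (exp x))) \<longlongrightarrow> ln 1) at_top"
    by (intro tendsto_ln) auto
  moreover have "\<forall>\<^sub>F x in at_top. ln (\<phi> (exp u * exp x) / \<phi> (exp x)) = log_phi (x + u) - log_phi x"
    using eventually_ge_at_top[of 0]
  proof eventually_elim
    case (elim x)
    have "exp u * exp x = exp (x + u)" by (simp add: exp_add mult.commute)
    moreover have "0 < \<phi> (exp (x + u))" "0 < \<phi> (exp x)"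
      using elim assms by (auto intro!: class_M_pos)
    ultimately show ?case using elim assms by (simp add: log_phi_def max_absorb1 ln_div)
  qed
  ultimately show ?thesis by (auto elim: Lim_transform_eventually)
qed

text \<open>The set of shifts \<open>\<lambda>\<close> in \<open>{0..2}\<close> for which \<open>log_phi\<close> oscillates by more than \<open>1\<close> has
  small measure far out. So some \<open>\<lambda>\<close> is good for \<open>x\<close> and, relative to \<open>x + u\<close>, good too.\<close>

lemma log_phi_increment_far:
  obtains X where "0 \<le> X" "\<forall>x\<ge>X. \<forall>u\<in>{0..1}. \<bar>log_phi (x + u) - log_phi x\<bar> \<le> 2"
proof -
  define bad where "bad x = (indicator {l. 0 \<le> l \<and> l \<le> 2 \<and> 1 < \<bar>log_phi (x + l) - log_phi x\<bar>} :: real \<Rightarrow> real)" for x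
  have [measurable]: "bad x \<in> borel_measurable borel" for x unfolding bad_def by measurable
  have bad01: "0 \<le> bad x l" "bad x l \<le> indicator {0..2} l" for x l
    by (auto simp: bad_def split: split_indicator)
  have i2: "integrable lborel (indicator {0..2::real} :: real \<Rightarrow> real)"
    by (simp add: integrable_real_indicator)
  have ib: "integrable lborel (bad x)" for x
    by (rule Bochner_Integration.integrable_bound[OF i2]) (use bad01 in auto)
  have "((\<lambda>x. \<integral>l. bad x l \<partial>lborel) \<longlongrightarrow> integral\<^sup>L lborel (\<lambda>l::real. 0)) at_top"
  proof (rule integral_dominated_convergence_at_top[OF _ _ i2])
    show "AE l in lborel. ((\<lambda>x. bad x l) \<longlongrightarrow> 0) at_top"
    proof (intro AE_I2)
      fix l :: real
      show "((\<lambda>x. bad x l) \<longlongrightarrow> 0) at_top"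
      proof (cases "0 \<le> l")
        case True
        have "\<forall>\<^sub>F x in at_top. dist (log_phi (x + l) - log_phi x) 0 < 1"
          using log_phi_slowly_varying[OF True] by (rule tendstoD) simp
        then have "\<forall>\<^sub>F x in at_top. 0 = bad x l"
          by eventually_elim (auto simp: bad_def)
        then show ?thesis by (rule Lim_transform_eventually[OF tendsto_const])
      qed (simp add: bad_def)
    qed
  qed (use bad01 in auto)
  then have "\<forall>\<^sub>F x in at_top. dist (\<integral>l. bad x l \<partial>lborel) 0 < 1/2" by (intro tendstoD) simp_all
  then obtain X0 where X0: "\<And>x. x \<ge> X0 \<Longrightarrow> \<bar>\<integral>l. bad x l \<partial>lborel\<bar> < 1/2"
    by (auto simp: eventually_at_top_linorder)
  have "\<bar>log_phi (x + u) - log_phi x\<bar> \<le> 2" if x: "x \<ge> max X0 0" and u: "u \<in> {0..1}" for x u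
  proof (rule ccontr)
    assume neg: "\<not> \<bar>log_phi (x + u) - log_phi x\<bar> \<le> 2"
    \<comment> \<open>If the increment from \<open>x\<close> to \<open>x + u\<close> exceeds 2,
      every \<open>l\<close> in [1,2] is bad for \<open>x\<close>, or its remainder
      \<open>l - u\<close> is bad for \<open>x + u\<close>; that remainder lies in [0,2], which
      fixes the range of shifts. Two sets of measure below 1/2 cannot cover an interval of length
      1.\<close>
    have cov: "indicator {1..2} l \<le> bad x l + bad (x + u) (l - u)" for l :: real
    proof (cases "l \<in> {1..2}")
      case True
      have eq: "x + u + (l - u) = x + l" by simp
      have "1 < \<bar>log_phi (x + l) - log_phi x\<bar> \<or> 1 < \<bar>log_phi (x + l) - log_phi (x + u)\<bar>"
        using neg by linarith
      then have "bad x l = 1 \<or> bad (x + u) (l - u) = 1"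
        unfolding bad_def eq using True u by auto
      then show ?thesis using bad01(1)[of x l] bad01(1)[of "x + u" "l - u"] True by auto
    next
      case False
      then show ?thesis using bad01(1)[of x l] bad01(1)[of "x + u" "l - u"] by simp
    qed
    have i3: "integrable lborel (\<lambda>l. bad (x + u) (l - u))"
      using lborel_integrable_real_affine[OF ib[of "x + u"], of 1 "-u"] by simp
    have "(1::real) = (\<integral>l. indicator {1..2::real} l \<partial>lborel)" by simp
    also have "\<dots> \<le> (\<integral>l. bad x l + bad (x + u) (l - u) \<partial>lborel)"
      by (rule integral_mono) (auto intro: ib i3 cov Bochner_Integration.integrable_add)
    also have "\<dots> = (\<integral>l. bad x l \<partial>lborel) + (\<integral>l. bad (x + u) (l - u) \<partial>lborel)"
      by (rule Bochner_Integration.integral_add[OF ib i3])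
    also have "(\<integral>l. bad (x + u) (l - u) \<partial>lborel) = (\<integral>l. bad (x + u) l \<partial>lborel)"
      using lborel_integral_real_affine[of 1 "bad (x + u)" "-u"] by simp
    finally show False using X0[of x] X0[of "x + u"] x u by (auto simp: abs_less_iff)
  qed
  then show ?thesis by (intro that[of "max X0 0"]) auto
qed

text \<open>Local boundedness of \<phi> bounds the logarithm from above, that of 1/\<phi> from
  below. The interval ends at exp |X| + 1 to have an endpoint larger than 1.\<close>

lemma log_phi_bounded:
  obtains L where "0 \<le> L" "\<forall>x\<in>{0..X}. \<bar>log_phi x\<bar> \<le> L"
proof -
  have "exp \<bar>X\<bar> + 1 > 1" by (simp add: add_pos_nonneg)
  then have "bounded (\<phi> ` {1..exp \<bar>X\<bar> + 1})" "bounded ((\<lambda>t. 1 / \<phi> t) ` {1..exp \<bar>X\<bar> + 1})"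
    using \<phi> unfolding class_M_def by blast+
  then obtain b c where b: "b > 0" "\<forall>t\<in>{1..exp \<bar>X\<bar> + 1}. norm (\<phi> t) \<le> b"
    and c: "c > 0" "\<forall>t\<in>{1..exp \<bar>X\<bar> + 1}. norm (1 / \<phi> t) \<le> c"
    unfolding bounded_pos by auto
  have "\<bar>log_phi x\<bar> \<le> \<bar>ln b\<bar> + \<bar>ln c\<bar>" if "x \<in> {0..X}" for x
  proof -
    have e: "exp x \<in> {1..exp \<bar>X\<bar> + 1}" using that by (auto intro: order_trans[of _ "exp X"] order_trans[of _ "exp \<bar>X\<bar>"])
    have p: "0 < \<phi> (exp x)" using that by (intro class_M_pos) auto
    have "\<phi> (exp x) \<le> b" using b(2)[rule_format, OF e] by simp
    then have 1: "ln (\<phi> (exp x)) \<le> ln b" using b(1) p by (intro ln_mono)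
    have "1 / \<phi> (exp x) \<le> c" using c(2) e p by fastforce
    then have "ln (1 / \<phi> (exp x)) \<le> ln c" using c(1) p by (intro ln_mono) auto
    then have 2: "- ln (\<phi> (exp x)) \<le> ln c" using p by (simp add: ln_div)
    have "log_phi x = ln (\<phi> (exp x))" using that by (simp add: log_phi_def)
    then show ?thesis using 1 2 by linarith
  qed
  then show ?thesis by (intro that[of "\<bar>ln b\<bar> + \<bar>ln c\<bar>"]) auto
qed

text \<open>Increments over unit steps are at most 2 far out and at most \<open>2 * L\<close> near
  0; chaining unit steps makes the increment grow at most linearly with the distance.\<close>

lemma log_phi_increment:
  obtains B where "0 \<le> B" "\<forall>x\<ge>0. \<forall>y\<ge>x. \<bar>log_phi y - log_phi x\<bar> \<le> B * (y - x + 1)"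
proof -
  obtain X where X: "0 \<le> X" "\<forall>x\<ge>X. \<forall>u\<in>{0..1}. \<bar>log_phi (x + u) - log_phi x\<bar> \<le> 2"
    by (rule log_phi_increment_far)
  \<comment> \<open>The bound reaches to \<open>X + 1\<close> because a unit step starting below
    \<open>X\<close> may end beyond it.\<close>
  obtain L where L: "0 \<le> L" "\<forall>x\<in>{0..X+1}. \<bar>log_phi x\<bar> \<le> L" by (rule log_phi_bounded)
  define B where "B = 2 + 2 * L"
  have B: "0 \<le> B" using L by (simp add: B_def)
  have step: "\<bar>log_phi (x + u) - log_phi x\<bar> \<le> B" if "x \<ge> 0" "0 \<le> u" "u \<le> 1" for x u
  proof (cases "x \<ge> X")
    case True
    then show ?thesis using X(2)[rule_format, of x u] L(1) that by (simp add: B_def)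
  next
    case False
    then have "\<bar>log_phi x\<bar> \<le> L" "\<bar>log_phi (x + u)\<bar> \<le> L" using L(2) that by auto
    then show ?thesis by (simp add: B_def)
  qed
  have it: "\<bar>log_phi y - log_phi x\<bar> \<le> B * real n" if "0 \<le> x" "x \<le> y" "y \<le> x + real n" for x y n
    using that
  proof (induction n arbitrary: x)
    case 0
    then show ?case by simp
  next
    case (Suc n)
    show ?case
    proof (cases "y \<le> x + 1")
      case True
      have "\<bar>log_phi y - log_phi x\<bar> \<le> B" using step[of x "y - x"] Suc.prems True by simp
      also have "\<dots> \<le> B * real (Suc n)" using B by (simp add: mult_left_mono mult_le_cancel_left1)
      finally show ?thesis .
    next
      case False
      then have "\<bar>log_phi y - log_phi (x + 1)\<bar> \<le> B * real n" using Suc.prems by (intro Suc.IH) auto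
      moreover have "\<bar>log_phi (x + 1) - log_phi x\<bar> \<le> B" using step[of x 1] Suc.prems by simp
      ultimately show ?thesis by (simp add: distrib_left)
    qed
  qed
  have "\<bar>log_phi y - log_phi x\<bar> \<le> B * (y - x + 1)" if "0 \<le> x" "x \<le> y" for x y
  proof -
    define n where "n = nat \<lceil>y - x\<rceil>"
    have n: "y - x \<le> real n" "real n \<le> y - x + 1" unfolding n_def using that by linarith+
    have "\<bar>log_phi y - log_phi x\<bar> \<le> B * real n" using that n by (intro it) auto
    also have "\<dots> \<le> B * (y - x + 1)" using n(2) B by (rule mult_left_mono)
    finally show ?thesis .
  qed
  with B show ?thesis by (intro that[of B]) auto
qed

text \<open>The linear bound on increments is exponentiated: with d = ln p - ln q, exp |d| is at
  most p/q + q/p. The exponent \<open>M\<close> collects the contribution of the square of \<phi>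
  and that of the power of order \<open>2 * s\<close>.\<close>

lemma moderate_class_M: "moderate (\<lambda>t. t powr (2 * s) * (\<phi> t)\<^sup>2)"
proof -
  obtain B where B: "0 \<le> B" "\<forall>x\<ge>0. \<forall>y\<ge>x. \<bar>log_phi y - log_phi x\<bar> \<le> B * (y - x + 1)"
    by (rule log_phi_increment)
  define M where "M = nat \<lceil>2 * B + 2 * \<bar>s\<bar>\<rceil>"
  have M: "2 * B + 2 * \<bar>s\<bar> \<le> real M" unfolding M_def by linarith
  have sym: "\<bar>log_phi x - log_phi y\<bar> \<le> B * (\<bar>x - y\<bar> + 1)" if "x \<ge> 0" "y \<ge> 0" for x y
    using B(2)[rule_format, of x y] B(2)[rule_format, of y x] that by (cases "x \<le> y") (auto simp: abs_minus_commute)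
  have "p powr (2 * s) * (\<phi> p)\<^sup>2 \<le> exp (2 * B) * (p / q + q / p) ^ M * (q powr (2 * s) * (\<phi> q)\<^sup>2)"
    if pq: "p \<ge> 1" "q \<ge> 1" for p q
  proof -
    define d where "d = ln p - ln q"
    have \<phi>e: "(\<phi> t)\<^sup>2 = exp (2 * log_phi (ln t))" if "t \<ge> 1" for t
    proof -
      have "log_phi (ln t) = ln (\<phi> t)" using that by (simp add: log_phi_def)
      then show ?thesis using class_M_pos[OF that] by (simp add: exp_double)
    qed
    have e: "t powr (2 * s) * (\<phi> t)\<^sup>2 = exp (2 * s * ln t + 2 * log_phi (ln t))" if "t \<ge> 1" for t
      using that by (simp add: \<phi>e powr_def exp_add)
    have "2 * s * ln p + 2 * log_phi (ln p) - (2 * s * ln q + 2 * log_phi (ln q)) = 2 * (s * d) + 2 * (log_phi (ln p) - log_phi (ln q))"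
      by (simp add: d_def algebra_simps)
    also have "\<dots> \<le> 2 * (\<bar>s\<bar> * \<bar>d\<bar>) + 2 * (B * (\<bar>d\<bar> + 1))"
    proof -
      have "s * d \<le> \<bar>s\<bar> * \<bar>d\<bar>" using abs_ge_self[of "s * d"] by (simp add: abs_mult)
      moreover have "log_phi (ln p) - log_phi (ln q) \<le> B * (\<bar>d\<bar> + 1)"
        using sym[of "ln p" "ln q"] pq by (simp add: d_def)
      ultimately show ?thesis by (intro add_mono mult_left_mono) auto
    qed
    also have "\<dots> = 2 * B + (2 * B + 2 * \<bar>s\<bar>) * \<bar>d\<bar>" by (simp add: algebra_simps)
    also have "\<dots> \<le> 2 * B + real M * \<bar>d\<bar>" using M by (intro add_left_mono mult_right_mono) auto
    finally have "2 * s * ln p + 2 * log_phi (ln p) \<le> 2 * B + real M * \<bar>d\<bar> + (2 * s * ln q + 2 * log_phi (ln q))" by simp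
    then have "exp (2 * s * ln p + 2 * log_phi (ln p)) \<le> exp (2 * B + real M * \<bar>d\<bar> + (2 * s * ln q + 2 * log_phi (ln q)))"
      by simp
    also have "\<dots> = exp (2 * B) * exp \<bar>d\<bar> ^ M * exp (2 * s * ln q + 2 * log_phi (ln q))"
      by (simp add: exp_add exp_of_nat_mult)
    also have "\<dots> \<le> exp (2 * B) * (p / q + q / p) ^ M * exp (2 * s * ln q + 2 * log_phi (ln q))"
    proof (intro mult_right_mono mult_left_mono power_mono)
      have "exp d = p / q" "exp (- d) = q / p" using pq by (auto simp: d_def exp_diff)
      then show "exp \<bar>d\<bar> \<le> p / q + q / p" using pq by (auto simp: abs_if)
    qed auto
    finally show ?thesis by (simp add: e pq)
  qed
  then show ?thesis unfolding moderate_def by (intro conjI allI impI exI[of _ "exp (2 * B)"] exI[of _ M]) auto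
qed

end

section \<open>Invariance of the Sobolev norm of test functions\<close>

lemma sobolev_weight_eq: "sobolev_weight s \<phi> = (\<lambda>\<xi>. (\<lambda>t. t powr (2 * s) * (\<phi> t)\<^sup>2) (japanese_bracket \<xi>))"
  by (simp add: sobolev_weight_def fun_eq_iff)

text \<open>Comparison with the weight at 1 shows that a moderate weight grows at most polynomially,
  and rapid decay beats it.\<close>

lemma sobolev_weight_rapid_integrable:
  fixes h :: "'a::euclidean_space \<Rightarrow> complex"
  assumes \<phi>: "\<phi> \<in> class_M" and h: "rapid h"
  shows "integrable lborel (\<lambda>\<xi>. sobolev_weight s \<phi> \<xi> * (norm (h \<xi>))\<^sup>2)"
proof -
  have [measurable]: "h \<in> borel_measurable borel" "sobolev_weight s \<phi> \<in> borel_measurable (borel :: 'a measure)"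
    using h borel_measurable_sobolev_weight[OF \<phi>] by auto
  let ?\<omega> = "\<lambda>t. t powr (2 * s) * (\<phi> t)\<^sup>2"
  obtain C M where C: "0 \<le> C" and CM: "\<forall>s\<ge>1. \<forall>t\<ge>1. ?\<omega> s \<le> C * (s / t + t / s) ^ M * ?\<omega> t"
    using moderate_class_M[OF \<phi>, of s] unfolding moderate_def by (elim conjE exE)
  obtain B where B: "B > 0" "\<forall>\<xi>. japanese_bracket \<xi> ^ 0 * norm (h \<xi>) \<le> B" using h by (rule rapidE)
  let ?c = "C * 2 ^ M * ?\<omega> 1 * B"
  have c: "0 \<le> C * 2 ^ M * ?\<omega> 1" using C by simp
  have rM: "rapid (\<lambda>\<xi>. complex_of_real (japanese_bracket \<xi> ^ M) * h \<xi>)"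
    by (rule rapid_mult_bounded[OF h, where B=1 and M=M]) (measurable, simp add: norm_power less_imp_le)
  show ?thesis
  proof (rule Bochner_Integration.integrable_bound)
    show "integrable lborel (\<lambda>\<xi>. ?c *\<^sub>R (complex_of_real (japanese_bracket \<xi> ^ M) * h \<xi>))"
      by (intro integrable_scaleR_right rapid_integrable rM)
    show "AE \<xi> in lborel. norm (sobolev_weight s \<phi> \<xi> * (norm (h \<xi>))\<^sup>2) \<le> norm (?c *\<^sub>R (complex_of_real (japanese_bracket \<xi> ^ M) * h \<xi>))"
    proof (intro AE_I2)
      fix \<xi> :: 'a
      let ?j = "japanese_bracket \<xi>"
      have j1: "1 / ?j \<le> ?j" using japanese_bracket_ge_1[of \<xi>] mult_mono[OF japanese_bracket_ge_1[of \<xi>] japanese_bracket_ge_1[of \<xi>]]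
        by (simp add: pos_divide_le_eq)
      have "sobolev_weight s \<phi> \<xi> \<le> C * (?j / 1 + 1 / ?j) ^ M * ?\<omega> 1"
        unfolding sobolev_weight_eq using CM[rule_format, OF japanese_bracket_ge_1[of \<xi>], of 1] by simp
      also have "\<dots> \<le> C * (2 * ?j) ^ M * ?\<omega> 1"
        using C j1 by (intro mult_right_mono mult_left_mono power_mono) (auto simp: less_imp_le)
      finally have w: "sobolev_weight s \<phi> \<xi> \<le> C * 2 ^ M * ?\<omega> 1 * ?j ^ M" by (simp add: power_mult_distrib mult_ac)
      have "sobolev_weight s \<phi> \<xi> * (norm (h \<xi>))\<^sup>2 \<le> (C * 2 ^ M * ?\<omega> 1 * ?j ^ M) * (B * norm (h \<xi>))"
      proof (rule mult_mono[OF w])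
        show "(norm (h \<xi>))\<^sup>2 \<le> B * norm (h \<xi>)"
          using B(2)[rule_format, of \<xi>] by (simp add: power2_eq_square mult_right_mono)
        show "0 \<le> C * 2 ^ M * ?\<omega> 1 * ?j ^ M" using c by (intro mult_nonneg_nonneg[OF c]) (simp add: less_imp_le)
      qed simp
      then show "norm (sobolev_weight s \<phi> \<xi> * (norm (h \<xi>))\<^sup>2) \<le> norm (?c *\<^sub>R (complex_of_real (?j ^ M) * h \<xi>))"
        using c C B(1) by (simp add: norm_mult norm_power abs_mult mult_ac less_imp_le)
    qed
  qed measurable
qed

section \<open>The norm on test functions\<close>

definition test_norm :: "real \<Rightarrow> (real \<Rightarrow> real) \<Rightarrow> ('a::euclidean_space \<Rightarrow> complex) \<Rightarrow> real" where
  "test_norm s \<phi> f = sobolev_norm s \<phi> (regular_distribution f)"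

text \<open>Finiteness for test functions excludes the default value of \<open>enn2real\<close>;
  from here on the Bochner and the extended form of the integral are both available.\<close>

lemma test_norm_sq:
  assumes f: "test_on UNIV f" and \<phi>: "\<phi> \<in> class_M"
  shows "(test_norm s \<phi> f)\<^sup>2 = (\<integral>\<xi>. sobolev_weight s \<phi> \<xi> * (norm (fourier f \<xi>))\<^sup>2 \<partial>lborel)"
    and "(\<integral>\<^sup>+\<xi>. ennreal (sobolev_weight s \<phi> \<xi> * (norm (fourier f \<xi>))\<^sup>2) \<partial>lborel) = ennreal ((test_norm s \<phi> f)\<^sup>2)"
proof -
  note i = sobolev_weight_rapid_integrable[OF \<phi> fourier_test_on_rapid[OF f], of s]
  have nn: "(\<integral>\<^sup>+\<xi>. ennreal (sobolev_weight s \<phi> \<xi> * (norm (fourier f \<xi>))\<^sup>2) \<partial>lborel) =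
    ennreal (\<integral>\<xi>. sobolev_weight s \<phi> \<xi> * (norm (fourier f \<xi>))\<^sup>2 \<partial>lborel)"
    by (rule nn_integral_eq_integral[OF i]) simp
  show 1: "(test_norm s \<phi> f)\<^sup>2 = (\<integral>\<xi>. sobolev_weight s \<phi> \<xi> * (norm (fourier f \<xi>))\<^sup>2 \<partial>lborel)"
    unfolding test_norm_def sobolev_norm_regular_distribution[OF f \<phi>] nn
    by (rule enn2real_ennreal) (intro integral_nonneg_AE, simp)
  show "(\<integral>\<^sup>+\<xi>. ennreal (sobolev_weight s \<phi> \<xi> * (norm (fourier f \<xi>))\<^sup>2) \<partial>lborel) = ennreal ((test_norm s \<phi> f)\<^sup>2)"
    unfolding nn 1 ..
qed

lemma test_norm_nonneg [simp]: "0 \<le> test_norm s \<phi> f"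
  unfolding test_norm_def sobolev_norm_def by (simp add: sobolev_integrand_def integral_nonneg_AE)

text \<open>The infimum of e A + B / e over e > 0 is 2 sqrt(A) sqrt(B), so the family of hypotheses
  amounts to Minkowski's inequality.\<close>

lemma sqrt_le_add_sqrt:
  fixes A B X :: real
  assumes "0 \<le> A" "0 \<le> B" and X: "\<And>e. e > 0 \<Longrightarrow> X \<le> (1 + e) * A + (1 + 1 / e) * B"
  shows "sqrt X \<le> sqrt A + sqrt B"
proof (rule real_le_lsqrt)
  let ?a = "sqrt A" and ?b = "sqrt B"
  have ab: "0 \<le> ?a" "0 \<le> ?b" "?a * ?a = A" "?b * ?b = B" using assms by auto
  have ?thesis if "X \<le> (?a + ?b)\<^sup>2" using that ab by (simp add: real_le_lsqrt)
  show "X \<le> (?a + ?b)\<^sup>2"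
  proof (rule field_le_epsilon)
    fix d :: real assume d: "0 < d"
    \<comment> \<open>The optimal \<open>e\<close> would be sqrt(B) / sqrt(A). Adding
      \<open>r\<close> to both roots keeps it positive and finite when a root vanishes, at a total
      cost of at most \<open>d\<close>.\<close>
    define r where "r = d / (?a + ?b + 1)"
    have ab1: "0 < ?a + ?b + 1" using ab(1,2) by linarith
    have r0: "0 < r" using d ab1 by (simp add: r_def)
    have "r * (?a + ?b) \<le> r * (?a + ?b + 1)" using r0 by simp
    also have "\<dots> = d" using ab1 by (simp add: r_def)
    finally have r: "0 < r" "r * (?a + ?b) \<le> d" using r0 by auto
    define e where "e = (?b + r) / (?a + r)"
    have pos: "0 < ?a + r" "0 < ?b + r" using ab(1,2) r(1) by linarith+
    have fa: "?a / (?a + r) \<le> 1" and fb: "?b / (?b + r) \<le> 1"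
      using pos r(1) by (simp_all only: divide_le_eq_1_pos)
    have e: "e > 0" using pos by (simp add: e_def)
    have "e * A \<le> (?b + r) * ?a"
    proof -
      have "e * (?a * ?a) = (?b + r) * ?a * (?a / (?a + r))" by (simp only: e_def times_divide_eq_left times_divide_eq_right mult.assoc)
      also have "\<dots> \<le> (?b + r) * ?a * 1"
        by (intro mult_left_mono[OF fa] mult_nonneg_nonneg less_imp_le[OF pos(2)] ab(1))
      finally show ?thesis unfolding ab(3) by simp
    qed
    moreover have "1 / e * B \<le> (?a + r) * ?b"
    proof -
      have "1 / e * (?b * ?b) = (?a + r) * ?b * (?b / (?b + r))" by (simp only: e_def divide_divide_eq_right times_divide_eq_left times_divide_eq_right mult.assoc mult_1)
      also have "\<dots> \<le> (?a + r) * ?b * 1"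
        by (intro mult_left_mono[OF fb] mult_nonneg_nonneg less_imp_le[OF pos(1)] ab(2))
      finally show ?thesis unfolding ab(4) by simp
    qed
    moreover have "X \<le> A + B + e * A + 1 / e * B" using X[OF e] by (simp add: distrib_right)
    moreover have "(?b + r) * ?a + (?a + r) * ?b = 2 * (?a * ?b) + r * (?a + ?b)" by (simp add: algebra_simps)
    moreover have "(?a + ?b)\<^sup>2 = ?a * ?a + ?b * ?b + 2 * (?a * ?b)" by algebra
    then have "(?a + ?b)\<^sup>2 = A + B + 2 * (?a * ?b)" unfolding ab(3,4) .
    ultimately show "X \<le> (?a + ?b)\<^sup>2 + d" using r(2) by linarith
  qed
qed (use assms in auto)

lemma fourier_add:
  assumes "integrable lborel f" "integrable lborel g"
  shows "fourier (\<lambda>x. f x + g x) \<xi> = fourier f \<xi> + fourier g \<xi>"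
  unfolding fourier_def distrib_left
  by (intro Bochner_Integration.integral_add integrable_cis_mult assms) measurable

text \<open>The pointwise bound (p + q)^2 <= (1 + e) p^2 + (1 + 1/e) q^2 is integrated against the
  weight for each e > 0.\<close>

lemma test_norm_triangle:
  assumes f: "test_on UNIV f" and g: "test_on UNIV g" and \<phi>: "\<phi> \<in> class_M"
  shows "test_norm s \<phi> (\<lambda>x. f x + g x) \<le> test_norm s \<phi> f + test_norm s \<phi> g"
proof -
  have fg: "test_on UNIV (\<lambda>x. f x + g x)" by (rule test_on_add[OF f g])
  note i = sobolev_weight_rapid_integrable[OF \<phi> fourier_test_on_rapid]
  have "sqrt ((test_norm s \<phi> (\<lambda>x. f x + g x))\<^sup>2) \<le> sqrt ((test_norm s \<phi> f)\<^sup>2) + sqrt ((test_norm s \<phi> g)\<^sup>2)"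
  proof (rule sqrt_le_add_sqrt)
    fix e :: real assume e: "e > 0"
    have "(test_norm s \<phi> (\<lambda>x. f x + g x))\<^sup>2 \<le>
      (\<integral>\<xi>. (1 + e) * (sobolev_weight s \<phi> \<xi> * (norm (fourier f \<xi>))\<^sup>2) + (1 + 1 / e) * (sobolev_weight s \<phi> \<xi> * (norm (fourier g \<xi>))\<^sup>2) \<partial>lborel)"
      unfolding test_norm_sq(1)[OF fg \<phi>]
    proof (rule integral_mono)
      fix \<xi>
      let ?p = "norm (fourier f \<xi>)" and ?q = "norm (fourier g \<xi>)"
      have "(norm (fourier (\<lambda>x. f x + g x) \<xi>))\<^sup>2 \<le> (?p + ?q)\<^sup>2"
        unfolding fourier_add[OF test_on_integrable[OF f] test_on_integrable[OF g]]
        by (intro power_mono norm_triangle_ineq) simp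
      also have "\<dots> \<le> (1 + e) * ?p\<^sup>2 + (1 + 1 / e) * ?q\<^sup>2"
      proof -
        have "0 \<le> (e * ?p - ?q)\<^sup>2 / e" using e by simp
        also have "\<dots> = e * ?p\<^sup>2 + ?q\<^sup>2 / e - 2 * ?p * ?q"
          using e by (simp add: power2_eq_square field_simps)
        finally show ?thesis by (simp add: power2_sum distrib_right)
      qed
      finally show "sobolev_weight s \<phi> \<xi> * (norm (fourier (\<lambda>x. f x + g x) \<xi>))\<^sup>2 \<le>
        (1 + e) * (sobolev_weight s \<phi> \<xi> * ?p\<^sup>2) + (1 + 1 / e) * (sobolev_weight s \<phi> \<xi> * ?q\<^sup>2)"
        using mult_left_mono[of "(norm (fourier (\<lambda>x. f x + g x) \<xi>))\<^sup>2" "(1 + e) * ?p\<^sup>2 + (1 + 1 / e) * ?q\<^sup>2" "sobolev_weight s \<phi> \<xi>"]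
        by (simp add: distrib_left mult_ac)
    next
      show "integrable lborel (\<lambda>\<xi>. sobolev_weight s \<phi> \<xi> * (norm (fourier (\<lambda>x. f x + g x) \<xi>))\<^sup>2)" by (rule i[OF fg])
      show "integrable lborel (\<lambda>\<xi>. (1 + e) * (sobolev_weight s \<phi> \<xi> * (norm (fourier f \<xi>))\<^sup>2) + (1 + 1 / e) * (sobolev_weight s \<phi> \<xi> * (norm (fourier g \<xi>))\<^sup>2))"
        by (intro Bochner_Integration.integrable_add integrable_mult_right i f g)
    qed
    also have "\<dots> = (1 + e) * (test_norm s \<phi> f)\<^sup>2 + (1 + 1 / e) * (test_norm s \<phi> g)\<^sup>2"
      unfolding test_norm_sq(1)[OF f \<phi>] test_norm_sq(1)[OF g \<phi>]
      by (subst Bochner_Integration.integral_add) (intro integrable_mult_right i f g, intro integrable_mult_right i f g, simp)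
    finally show "(test_norm s \<phi> (\<lambda>x. f x + g x))\<^sup>2 \<le> (1 + e) * (test_norm s \<phi> f)\<^sup>2 + (1 + 1 / e) * (test_norm s \<phi> g)\<^sup>2" .
  qed auto
  then show ?thesis by simp
qed

lemma test_norm_zero:
  assumes "\<phi> \<in> class_M"
  shows "test_norm s \<phi> (\<lambda>x. 0) = 0"
proof -
  have "test_on UNIV (\<lambda>x::'a. 0::complex)"
    unfolding test_on_def by (intro conjI exI[of _ "{}"] smooth_on_const) auto
  from test_norm_sq(1)[OF this assms, of s] show ?thesis by (simp add: fourier_def)
qed

lemma test_norm_minus: "test_norm s \<phi> (\<lambda>x. - f x) = test_norm s \<phi> f"
  if f: "test_on UNIV f" and \<phi>: "\<phi> \<in> class_M"
proof -
  have "test_on UNIV (\<lambda>x. - f x)" using test_on_cmult[OF f, of "-1"] by simp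
  from test_norm_sq(1)[OF this \<phi>, of s] test_norm_sq(1)[OF f \<phi>, of s]
  have "(test_norm s \<phi> (\<lambda>x. - f x))\<^sup>2 = (test_norm s \<phi> f)\<^sup>2" by (simp add: fourier_def)
  then show ?thesis by simp
qed

lemma test_norm_sum:
  assumes "\<phi> \<in> class_M" "\<And>i. i \<in> I \<Longrightarrow> test_on UNIV (f i)"
  shows "test_norm s \<phi> (\<lambda>x. \<Sum>i\<in>I. f i x) \<le> (\<Sum>i\<in>I. test_norm s \<phi> (f i))"
  using assms(2)
proof (induction I rule: infinite_finite_induct)
  case (insert i I)
  have "test_norm s \<phi> (\<lambda>x. f i x + (\<Sum>i\<in>I. f i x)) \<le> test_norm s \<phi> (f i) + test_norm s \<phi> (\<lambda>x. \<Sum>i\<in>I. f i x)"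
    using insert.prems by (intro test_norm_triangle test_on_sum assms(1)) auto
  then show ?case using insert by simp
qed (simp_all add: test_norm_zero[OF assms(1)])

context change_of_variables
begin

lemma test_on_pullback:
  assumes a: "test_on U a" and f: "test_on UNIV f"
  shows "test_on U (\<lambda>x. a x * f (\<kappa> x))"
  by (intro test_on_mult_smooth[OF a open_U] smooth_on_compose[OF open_U open_UNIV _ smooth_\<kappa> test_on_smooth[OF f]]) simp

text \<open>Fourier inversion turns \<open>osc a (fourier f)\<close> into (2 pi)^n times the
  transform of the pulled-back function, so the operator bound becomes a norm bound whose constant
  does not depend on \<open>f\<close>.\<close>

theorem test_norm_pullback:
  assumes a: "test_on U a" and \<phi>: "\<phi> \<in> class_M"
  obtains C where "0 \<le> C" "\<forall>f. test_on UNIV f \<longrightarrow> test_norm s \<phi> (\<lambda>x. a x * f (\<kappa> x)) \<le> C * test_norm s \<phi> f"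
proof -
  let ?\<omega> = "\<lambda>t. t powr (2 * s) * (\<phi> t)\<^sup>2"
  have "weighted_bound (sobolev_weight s \<phi>) (sobolev_weight s \<phi>) (\<lambda>h \<eta>. norm (osc a h \<eta>))"
    using osc_bound_moderate[OF a moderate_class_M[OF \<phi>, of s]] borel_measurable_sobolev_weight[OF \<phi>, of s, where 'a='a]
    by (simp add: sobolev_weight_eq)
  then obtain C where C: "0 \<le> C" "\<forall>h. rapid h \<longrightarrow>
       (\<integral>\<^sup>+\<eta>. ennreal (sobolev_weight s \<phi> \<eta> * (norm (osc a h \<eta>))\<^sup>2) \<partial>lborel) \<le>
       ennreal C * (\<integral>\<^sup>+\<xi>. ennreal (sobolev_weight s \<phi> \<xi> * (norm (h \<xi>))\<^sup>2) \<partial>lborel)"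
    by (rule weighted_boundE)
  let ?p = "(2 * pi) ^ DIM('a)"
  have p: "?p > 0" by simp
  have "test_norm s \<phi> (\<lambda>x. a x * f (\<kappa> x)) \<le> (sqrt C / ?p) * test_norm s \<phi> f" if f: "test_on UNIV f" for f
  proof -
    note r = fourier_test_on_rapid[OF f]
    obtain B where B: "\<forall>x. norm (f x) \<le> B" using f by (rule test_on_bounded)
    have inv: "inv_fourier_at (fourier f) x = ?p *\<^sub>R f (\<kappa> x)" for x
      unfolding inv_fourier_at_def
      by (rule fourier_inversion[OF test_on_integrable[OF f] test_on_continuous[OF f] _ rapid_integrable[OF r]]) (use B in auto)
    let ?g = "\<lambda>x. a x * f (\<kappa> x)"
    have g: "test_on UNIV ?g" by (rule test_on_mono[OF test_on_pullback[OF a f]]) simp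
    have osc: "osc a (fourier f) \<eta> = ?p *\<^sub>R fourier ?g \<eta>" for \<eta>
      unfolding osc_eq_fourier[OF a r] inv fourier_def
      by (simp only: mult_scaleR_right integral_scaleR_right)
    have "ennreal ((?p * test_norm s \<phi> ?g)\<^sup>2) = ennreal (?p\<^sup>2) * ennreal ((test_norm s \<phi> ?g)\<^sup>2)"
      by (simp add: power_mult_distrib ennreal_mult)
    also have "\<dots> = ennreal (?p\<^sup>2) * (\<integral>\<^sup>+\<eta>. ennreal (sobolev_weight s \<phi> \<eta> * (norm (fourier ?g \<eta>))\<^sup>2) \<partial>lborel)"
      unfolding test_norm_sq(2)[OF g \<phi>] ..
    also have "\<dots> = (\<integral>\<^sup>+\<eta>. ennreal (sobolev_weight s \<phi> \<eta> * (norm (osc a (fourier f) \<eta>))\<^sup>2) \<partial>lborel)"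
    proof (subst nn_integral_cmult[symmetric])
      have [measurable]: "?g \<in> borel_measurable borel" using g by auto
      have [measurable]: "sobolev_weight s \<phi> \<in> borel_measurable (borel :: 'a measure)"
        by (rule borel_measurable_sobolev_weight[OF \<phi>])
      show "(\<lambda>\<eta>. ennreal (sobolev_weight s \<phi> \<eta> * (norm (fourier ?g \<eta>))\<^sup>2)) \<in> borel_measurable lborel" by measurable
    qed (intro nn_integral_cong, simp add: osc power_mult_distrib ennreal_mult[symmetric] mult_ac)
    also have "\<dots> \<le> ennreal C * ennreal ((test_norm s \<phi> f)\<^sup>2)"
      using C(2)[rule_format, OF r] unfolding test_norm_sq(2)[OF f \<phi>] .
    also have "\<dots> = ennreal (C * (test_norm s \<phi> f)\<^sup>2)" using C(1) by (simp add: ennreal_mult)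
    finally have "(?p * test_norm s \<phi> ?g)\<^sup>2 \<le> C * (test_norm s \<phi> f)\<^sup>2"
      using C(1) by (simp add: ennreal_le_iff)
    then have "sqrt ((?p * test_norm s \<phi> ?g)\<^sup>2) \<le> sqrt (C * (test_norm s \<phi> f)\<^sup>2)" by (rule real_sqrt_le_mono)
    then have "?p * test_norm s \<phi> ?g \<le> sqrt C * test_norm s \<phi> f" by (simp add: real_sqrt_mult)
    then show ?thesis using p by (simp add: field_simps)
  qed
  then show ?thesis using C(1) by (intro that[of "sqrt C / ?p"]) auto
qed

end

section \<open>Smooth maps between manifolds\<close>

text \<open>The conditions of \<open>smooth_atlas\<close> on single charts. Composing smooth maps
  asks for a chart with open image around each point, and these conditions pass directly to product
  atlases.\<close>

definition chart_cover :: "('m::topological_space, 'e::euclidean_space) atlas \<Rightarrow> bool" where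
  "chart_cover A \<longleftrightarrow> (\<Union>(U, x)\<in>A. U) = UNIV \<and>
     (\<forall>(U, x)\<in>A. open U \<and> open (x ` U) \<and> (\<exists>y. homeomorphism U (x ` U) x y))"

lemma smooth_atlas_chart_cover: "smooth_atlas A \<Longrightarrow> chart_cover A"
  by (simp add: smooth_atlas_def chart_cover_def)

lemma chart_coverD:
  assumes "chart_cover A" "(U, x) \<in> A"
  shows "open U" "open (x ` U)" "\<exists>y. homeomorphism U (x ` U) x y" "inj_on x U"
proof -
  show 1: "open U" "open (x ` U)" "\<exists>y. homeomorphism U (x ` U) x y"
    using assms by (auto simp: chart_cover_def)
  then show "inj_on x U" by (metis homeomorphism_apply1 inj_onI)
qed

lemma chart_cover_at:
  assumes "chart_cover A"
  obtains U x where "(U, x) \<in> A" "q \<in> U"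
proof -
  have "q \<in> (\<Union>(U, x)\<in>A. U)" using assms by (simp add: chart_cover_def)
  then show ?thesis using that by auto
qed

lemma chart_image_open:
  assumes "chart_cover A" "(U, x) \<in> A" "open O'" "O' \<subseteq> U"
  shows "open (x ` O')"
proof -
  obtain y where h: "homeomorphism U (x ` U) x y" using chart_coverD(3)[OF assms(1,2)] by blast
  have "openin (top_of_set U) O'" using assms(3,4) chart_coverD(1)[OF assms(1,2)] by (simp add: openin_open_eq)
  then have "openin (top_of_set (x ` U)) (x ` O')" by (rule homeomorphism_imp_open_map[OF h])
  then show ?thesis using chart_coverD(2)[OF assms(1,2)] by (simp add: openin_open_eq)
qed

lemma smooth_map_continuous: "smooth_map A S B f \<Longrightarrow> continuous_on S f"
  by (simp add: smooth_map_def)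

text \<open>Near a point the composition passes through a chart around its image under
  \<open>f\<close>; all sets are shrunk to open ones on which both local representatives are
  defined.\<close>

lemma smooth_map_compose:
  assumes A: "chart_cover A" and B: "chart_cover B" and C: "chart_cover C"
    and f: "smooth_map A S B f" and g: "smooth_map B T C g"
    and ST: "f ` S \<subseteq> T" "open S" "open T"
  shows "smooth_map A S C (\<lambda>q. g (f q))"
  unfolding smooth_map_def
proof (intro conjI ballI, safe)
  have cf: "continuous_on S f" and cg: "continuous_on T g" using f g by (auto intro: smooth_map_continuous)
  show "continuous_on S (\<lambda>q. g (f q))" by (rule continuous_on_compose2[OF cg cf ST(1)])
  fix U x W z assume Ux: "(U, x) \<in> A" and Wz: "(W, z) \<in> C"
  show "smooth_on (x ` (U \<inter> S \<inter> (\<lambda>q. g (f q)) -` W)) (z \<circ> (\<lambda>q. g (f q)) \<circ> inv_into U x)"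
  proof (rule smooth_on_local)
    fix p assume "p \<in> x ` (U \<inter> S \<inter> (\<lambda>q. g (f q)) -` W)"
    then obtain q where q: "q \<in> U" "q \<in> S" "g (f q) \<in> W" "p = x q" by auto
    obtain V y where Vy: "(V, y) \<in> B" "f q \<in> V" by (rule chart_cover_at[OF B])
    let ?M = "V \<inter> (T \<inter> g -` W)"
    let ?O = "U \<inter> (S \<inter> f -` ?M)"
    have oM: "open ?M"
      by (intro open_Int chart_coverD(1)[OF B Vy(1)] continuous_open_preimage[OF cg ST(3) chart_coverD(1)[OF C Wz]])
    have oO: "open ?O"
      by (intro open_Int chart_coverD(1)[OF A Ux] continuous_open_preimage[OF cf ST(2) oM])
    have oN: "open (x ` ?O)" by (rule chart_image_open[OF A Ux oO]) auto
    have oyM: "open (y ` ?M)" by (rule chart_image_open[OF B Vy(1) oM]) auto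
    have sf: "smooth_on (x ` ?O) (y \<circ> f \<circ> inv_into U x)"
    proof (rule smooth_on_subset)
      show "smooth_on (x ` (U \<inter> S \<inter> f -` V)) (y \<circ> f \<circ> inv_into U x)"
        using f Ux Vy(1) by (auto simp: smooth_map_def)
    qed auto
    have sg: "smooth_on (y ` ?M) (z \<circ> g \<circ> inv_into V y)"
    proof (rule smooth_on_subset)
      show "smooth_on (y ` (V \<inter> T \<inter> g -` W)) (z \<circ> g \<circ> inv_into V y)"
        using g Wz Vy(1) by (auto simp: smooth_map_def)
    qed auto
    have ix: "inv_into U x (x r) = r" if "r \<in> U" for r
      by (rule inv_into_f_f[OF chart_coverD(4)[OF A Ux] that])
    have iy: "inv_into V y (y r) = r" if "r \<in> V" for r
      by (rule inv_into_f_f[OF chart_coverD(4)[OF B Vy(1)] that])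
    have "smooth_on (x ` ?O) (\<lambda>p. (z \<circ> g \<circ> inv_into V y) ((y \<circ> f \<circ> inv_into U x) p))"
      by (rule smooth_on_compose[OF oN oyM _ sf sg]) (auto simp: ix)
    then have "smooth_on (x ` ?O) (z \<circ> (\<lambda>q. g (f q)) \<circ> inv_into U x)"
      by (rule smooth_on_cong[OF oN, rotated]) (auto simp: ix iy)
    moreover have "p \<in> x ` ?O" using q Vy(2) ST(1) by auto
    ultimately show "\<exists>T. open T \<and> p \<in> T \<and> smooth_on T (z \<circ> (\<lambda>q. g (f q)) \<circ> inv_into U x)"
      using oN by blast
  qed
qed

lemma smooth_map_subset:
  assumes A: "chart_cover A" and f: "smooth_map A S B f" and T: "T \<subseteq> S"
  shows "smooth_map A T B f"
  unfolding smooth_map_def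
proof (intro conjI ballI, safe)
  show "continuous_on T f" using f T by (auto simp: smooth_map_def intro: continuous_on_subset)
  fix U x W z assume Ux: "(U, x) \<in> A" and Wz: "(W, z) \<in> B"
  show "smooth_on (x ` (U \<inter> T \<inter> f -` W)) (z \<circ> f \<circ> inv_into U x)"
  proof (rule smooth_on_subset)
    show "smooth_on (x ` (U \<inter> S \<inter> f -` W)) (z \<circ> f \<circ> inv_into U x)"
      using f Ux Wz by (auto simp: smooth_map_def)
  qed (use T in auto)
qed

lemma chart_cover_euclidean: "chart_cover euclidean_atlas"
  by (auto simp: chart_cover_def euclidean_atlas_def homeomorphism_def intro!: exI[of _ id])

lemma smooth_map_euclidean: "smooth_map euclidean_atlas S euclidean_atlas f \<Longrightarrow> smooth_on S f"
  by (simp add: smooth_map_def euclidean_atlas_def inv_id comp_def id_def)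

lemma chart_cover_product:
  assumes A: "chart_cover A" and B: "chart_cover B"
  shows "chart_cover (product_atlas A B)"
  unfolding chart_cover_def
proof (intro conjI ballI, safe)
  fix p :: 'a and q :: 'c
  obtain U x where Ux: "(U, x) \<in> A" "p \<in> U" by (rule chart_cover_at[OF A])
  obtain W y where Wy: "(W, y) \<in> B" "q \<in> W" by (rule chart_cover_at[OF B])
  have "(U \<times> W, map_prod x y) \<in> product_atlas A B"
    unfolding product_atlas_def using Ux(1) Wy(1) by blast
  then show "(p, q) \<in> (\<Union>(U, x)\<in>product_atlas A B. U)"
    by (rule UN_I) (simp add: Ux Wy)
next
  fix O' z assume "(O', z) \<in> product_atlas A B"
  then obtain U x W y where Oz: "O' = U \<times> W" "z = map_prod x y" and Ux: "(U, x) \<in> A" and Wy: "(W, y) \<in> B"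
    by (auto simp: product_atlas_def)
  have im: "z ` O' = x ` U \<times> y ` W" by (auto simp: Oz)
  show "open O'" unfolding Oz by (intro open_Times chart_coverD(1)[OF A Ux] chart_coverD(1)[OF B Wy])
  show "open (z ` O')" unfolding im by (intro open_Times chart_coverD(2)[OF A Ux] chart_coverD(2)[OF B Wy])
  obtain x' where x': "homeomorphism U (x ` U) x x'" using chart_coverD(3)[OF A Ux] by blast
  obtain y' where y': "homeomorphism W (y ` W) y y'" using chart_coverD(3)[OF B Wy] by blast
  have c: "continuous_on U x" "continuous_on W y" "continuous_on (x ` U) x'" "continuous_on (y ` W) y'"
    and i: "\<And>p. p \<in> U \<Longrightarrow> x' (x p) = p" "\<And>q. q \<in> W \<Longrightarrow> y' (y q) = q"
    using x' y' unfolding homeomorphism_def by auto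
  have "homeomorphism O' (z ` O') z (map_prod x' y')"
    unfolding im unfolding Oz
  proof (rule homeomorphismI)
    show "continuous_on (U \<times> W) (map_prod x y)"
      unfolding map_prod_def case_prod_beta'
      by (intro continuous_on_Pair continuous_on_compose2[OF c(1)] continuous_on_compose2[OF c(2)] continuous_intros) auto
    show "continuous_on (x ` U \<times> y ` W) (map_prod x' y')"
      unfolding map_prod_def case_prod_beta'
      by (intro continuous_on_Pair continuous_on_compose2[OF c(3)] continuous_on_compose2[OF c(4)] continuous_intros) auto
  qed (auto simp: i)
  then show "\<exists>y. homeomorphism O' (z ` O') z y" by blast
qed auto

text \<open>With the next rule this lets a local trivialization be used in both directions: reading
  off fibre coordinates and inserting constant ones.\<close>

lemma smooth_map_snd:
  fixes A :: "('m::topological_space, 'd::euclidean_space) atlas"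
  assumes A: "chart_cover A"
  shows "smooth_map (product_atlas A (euclidean_atlas :: ('e::euclidean_space, 'e) atlas)) UNIV euclidean_atlas snd"
  unfolding smooth_map_def
proof (intro conjI ballI, safe)
  show "continuous_on UNIV snd" by (intro continuous_intros)
  fix O' z V w assume Oz: "(O', z) \<in> product_atlas A (euclidean_atlas :: ('e, 'e) atlas)"
    and Vw: "(V, w) \<in> (euclidean_atlas :: ('e, 'e) atlas)"
  then obtain U x where O': "O' = U \<times> UNIV" "z = map_prod x id" and Ux: "(U, x) \<in> A"
    by (auto simp: product_atlas_def euclidean_atlas_def)
  have w: "V = UNIV" "w = id" using Vw by (auto simp: euclidean_atlas_def)
  note P = chart_cover_product[OF A chart_cover_euclidean]
  have o: "open (z ` O')" by (rule chart_coverD(2)[OF P Oz])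
  have "smooth_on (z ` O') snd"
    by (rule smooth_on_subset[OF smooth_on_linear[OF bounded_linear_snd]]) simp
  then have "smooth_on (z ` O') (w \<circ> snd \<circ> inv_into O' z)"
  proof (rule smooth_on_cong[OF o, rotated])
    fix p assume "p \<in> z ` O'"
    then obtain q where q: "q \<in> O'" "p = z q" by auto
    then have "inv_into O' z p = q" using inv_into_f_f[OF chart_coverD(4)[OF P Oz]] by simp
    then show "snd p = (w \<circ> snd \<circ> inv_into O' z) p" using q by (cases q) (simp add: O'(2) w)
  qed
  then show "smooth_on (z ` (O' \<inter> UNIV \<inter> snd -` V)) (w \<circ> snd \<circ> inv_into O' z)"
    by (simp add: w)
qed

lemma smooth_map_Pair_const:
  fixes B :: "('m::topological_space, 'd::euclidean_space) atlas" and S :: "'s::euclidean_space set"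
    and c :: "'e::euclidean_space"
  assumes B: "chart_cover B" and f: "smooth_map euclidean_atlas S B f" and S: "open S"
  shows "smooth_map euclidean_atlas S (product_atlas B euclidean_atlas) (\<lambda>y. (f y, c))"
  unfolding smooth_map_def
proof (intro conjI ballI, safe)
  have cf: "continuous_on S f" using f by (rule smooth_map_continuous)
  then show "continuous_on S (\<lambda>y. (f y, c))" by (intro continuous_intros)
  fix V w O' z assume Oz: "(O', z) \<in> product_atlas B (euclidean_atlas :: ('e, 'e) atlas)"
    and "(V, w) \<in> (euclidean_atlas :: ('s, 's) atlas)"
  then have w: "V = UNIV" "w = id" by (auto simp: euclidean_atlas_def)
  obtain U x where O': "O' = U \<times> UNIV" "z = map_prod x id" and Ux: "(U, x) \<in> B"
    using Oz by (auto simp: product_atlas_def euclidean_atlas_def)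
  have o: "open (S \<inter> f -` U)" by (rule continuous_open_preimage[OF cf S chart_coverD(1)[OF B Ux]])
  have "smooth_on (w ` (V \<inter> S \<inter> f -` U)) (x \<circ> f \<circ> inv_into V w)"
    using f Ux unfolding smooth_map_def by (auto simp: w euclidean_atlas_def)
  then have "smooth_on (S \<inter> f -` U) (\<lambda>p. (x (f p), c))"
    by (intro smooth_on_Pair[OF o] smooth_on_const) (simp add: w inv_id comp_def id_def)
  then show "smooth_on (w ` (V \<inter> S \<inter> (\<lambda>y. (f y, c)) -` O')) (z \<circ> (\<lambda>y. (f y, c)) \<circ> inv_into V w)"
    by (simp add: w O' inv_id comp_def id_def map_prod_def vimage_def)
qed

section \<open>Local components of sections\<close>

lemma localization_chart:
  assumes L: "is_localization E L" and j: "j < num_charts L"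
  shows "smooth_map euclidean_atlas UNIV (base_atlas E) (chart L j)"
    and "smooth_map (base_atlas E) (range (chart L j)) euclidean_atlas (inv (chart L j))"
    and "open (range (chart L j))" and "inj (chart L j)"
    and "smooth_map (base_atlas E) UNIV euclidean_atlas (cutoff L j)"
    and "closure {x. cutoff L j x \<noteq> 0} \<subseteq> range (chart L j)"
    and "local_trivialization E (range (chart L j)) (triv L j)"
  using L j unfolding is_localization_def diffeo_def bij_betw_def by auto

lemma localization_cutoff_0:
  assumes "is_localization E L" "j < num_charts L" "x \<notin> range (chart L j)"
  shows "cutoff L j x = 0"
proof (rule ccontr)
  assume "cutoff L j x \<noteq> 0"
  then have "x \<in> closure {x. cutoff L j x \<noteq> 0}" using closure_subset[of "{x. cutoff L j x \<noteq> 0}"] by blast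
  then show False using localization_chart(6)[OF assms(1,2)] assms(3) by blast
qed

lemma compact_chart_preimage:
  fixes E :: "('m::t2_space, 'v::t2_space, 'n::finite, 'p::finite) vbundle"
  assumes L: "is_localization E L" and j: "j < num_charts L"
    and K: "compact K" "K \<subseteq> range (chart L j)"
  shows "compact (inv (chart L j) ` K)"
  using smooth_map_continuous[OF localization_chart(2)[OF L j]] K
  by (intro compact_continuous_image) (auto intro: continuous_on_subset)

text \<open>A trivialization is linear on fibres, so the cutoff comes out as a scalar
  factor.\<close>

lemma local_component_eq:
  assumes L: "is_localization E L" and j: "j < num_charts L" and u: "\<And>x. proj E (u x) = x"
  shows "local_component E L u j k y =
    complex_of_real (cutoff L j (chart L j y)) * snd (triv L j (u (chart L j y))) $ k"
proof -
  have "u (chart L j y) \<in> proj E -` range (chart L j)" using u by simp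
  then have "snd (triv L j (fibre_scale E c (u (chart L j y)))) = c *s snd (triv L j (u (chart L j y)))" for c
    using localization_chart(7)[OF L j] by (simp add: local_trivialization_def)
  then show ?thesis by (simp add: local_component_def Let_def)
qed

lemma smooth_sections_proj: "u \<in> smooth_sections E \<Longrightarrow> proj E (u x) = x"
  by (simp add: smooth_sections_def)

lemma smooth_vector_bundle_chart_cover:
  assumes "smooth_vector_bundle E"
  shows "chart_cover (base_atlas E)" "chart_cover (total_atlas E)"
  using assms by (auto simp: smooth_vector_bundle_def intro: smooth_atlas_chart_cover)

lemma local_trivialization_smooth:
  assumes "local_trivialization E U \<beta>"
  shows "smooth_map (total_atlas E) (proj E -` U) (product_atlas (base_atlas E) euclidean_atlas) \<beta>"
    and "smooth_map (product_atlas (base_atlas E) euclidean_atlas) (U \<times> UNIV) (total_atlas E) (inv_into (proj E -` U) \<beta>)"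
    and "open (proj E -` U)" and "open U"
    and "bij_betw \<beta> (proj E -` U) (U \<times> UNIV)"
  using assms by (auto simp: local_trivialization_def diffeo_def)

lemma local_trivialization_fst:
  "local_trivialization E U \<beta> \<Longrightarrow> v \<in> proj E -` U \<Longrightarrow> fst (\<beta> v) = proj E v"
  by (simp add: local_trivialization_def)

lemma smooth_fibre_coordinate:
  fixes E :: "('m::t2_space, 'v::t2_space, 'n::finite, 'p::finite) vbundle" and S :: "'s::euclidean_space set"
  assumes E: "smooth_vector_bundle E" and \<beta>: "local_trivialization E U \<beta>"
    and f: "smooth_map euclidean_atlas S (total_atlas E) f" "f ` S \<subseteq> proj E -` U" and S: "open S"
  shows "smooth_on S (\<lambda>y. snd (\<beta> (f y)) $ k)"
proof -
  note B = smooth_vector_bundle_chart_cover[OF E]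
  note P = chart_cover_product[OF B(1) chart_cover_euclidean]
  have "smooth_map euclidean_atlas S (product_atlas (base_atlas E) euclidean_atlas) (\<lambda>y. \<beta> (f y))"
    by (rule smooth_map_compose[OF chart_cover_euclidean B(2) P f(1) local_trivialization_smooth(1)[OF \<beta>] f(2) S
          local_trivialization_smooth(3)[OF \<beta>]])
  from smooth_map_compose[OF chart_cover_euclidean P chart_cover_euclidean this smooth_map_snd[OF B(1)] _ S open_UNIV]
  have "smooth_map euclidean_atlas S euclidean_atlas (\<lambda>y. snd (\<beta> (f y)))" by simp
  then have "smooth_on S (\<lambda>y. snd (\<beta> (f y)))" by (rule smooth_map_euclidean)
  then show ?thesis by (rule smooth_on_bounded_linear[OF bounded_linear_vec_nth S])
qed

text \<open>Compactness of the base makes the support of the cutoff compact; as it lies inside the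
  range of the chart, it pulls back to a compact set of coordinates.\<close>

lemma local_component_test_on:
  fixes E :: "('m::t2_space, 'v::t2_space, 'n::finite, 'p::finite) vbundle"
  assumes c: "compact (UNIV :: 'm set)" and E: "smooth_vector_bundle E" and L: "is_localization E L"
    and u: "u \<in> smooth_sections E" and j: "j < num_charts L"
  shows "test_on UNIV (local_component E L u j k)"
proof -
  note B = smooth_vector_bundle_chart_cover[OF E]
  note ch = localization_chart[OF L j]
  have su: "smooth_map (base_atlas E) UNIV (total_atlas E) u" using u by (simp add: smooth_sections_def)
  note pu = smooth_sections_proj[OF u]
  have "smooth_map euclidean_atlas UNIV (total_atlas E) (\<lambda>y. u (chart L j y))"
    by (rule smooth_map_compose[OF chart_cover_euclidean B(1,2) ch(1) su]) auto
  then have s: "smooth_on UNIV (\<lambda>y. snd (triv L j (u (chart L j y))) $ k)"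
    by (rule smooth_fibre_coordinate[OF E ch(7)]) (use pu in auto)
  have "smooth_map euclidean_atlas UNIV euclidean_atlas (\<lambda>y. cutoff L j (chart L j y))"
    by (rule smooth_map_compose[OF chart_cover_euclidean B(1) chart_cover_euclidean ch(1) ch(5)]) auto
  then have "smooth_on UNIV (\<lambda>y. cutoff L j (chart L j y))" by (rule smooth_map_euclidean)
  then have "smooth_on UNIV (\<lambda>y. complex_of_real (cutoff L j (chart L j y)))"
    by (rule smooth_on_bounded_linear[OF bounded_linear_of_real open_UNIV])
  from smooth_on_mult[OF open_UNIV this s]
  have sm: "smooth_on UNIV (local_component E L u j k)"
    by (simp add: local_component_eq[OF L j pu, abs_def])
  let ?K = "inv (chart L j) ` closure {x. cutoff L j x \<noteq> 0}"
  have "compact (closure {x. cutoff L j x \<noteq> 0})"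
    using compact_Int_closed[OF c closed_closure, of "{x. cutoff L j x \<noteq> 0}"] by simp
  then have K: "compact ?K" by (rule compact_chart_preimage[OF L j _ ch(6)])
  have "local_component E L u j k y = 0" if "y \<notin> ?K" for y
  proof -
    have "chart L j y \<notin> closure {x. cutoff L j x \<noteq> 0}"
      using that inv_f_f[OF ch(4), of y] by (metis image_eqI)
    then have "cutoff L j (chart L j y) = 0" using closure_subset[of "{x. cutoff L j x \<noteq> 0}"] by blast
    then show ?thesis by (simp add: local_component_eq[OF L j pu])
  qed
  then show ?thesis unfolding test_on_def using sm K by (intro conjI exI[of _ ?K]) auto
qed

text \<open>The transition map of the two trivializations over \<open>x\<close>, from
  \<beta>-coordinates to \<beta>'-coordinates.\<close>

definition frame_transition ::
    "('m, 'v, 'n::finite, 'p::finite) vbundle \<Rightarrow> 'm set \<Rightarrow> ('v \<Rightarrow> 'm \<times> (complex^'p)) \<Rightarrow> ('v \<Rightarrow> 'm \<times> (complex^'p)) \<Rightarrow>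
     'm \<Rightarrow> complex^'p \<Rightarrow> complex^'p" where
  "frame_transition E U \<beta> \<beta>' x c = snd (\<beta>' (inv_into (proj E -` U) \<beta> (x, c)))"

text \<open>The transition map is linear because both trivializations respect the fibre operations.
  Expansion in the standard basis exposes its matrix entries, which later enter the
  amplitudes.\<close>

lemma frame_transition_expansion:
  fixes E :: "('m::t2_space, 'v::t2_space, 'n::finite, 'p::finite) vbundle"
  assumes E: "smooth_vector_bundle E" and \<beta>: "local_trivialization E U \<beta>" and \<beta>': "local_trivialization E U' \<beta>'"
    and x: "x \<in> U" "x \<in> U'" and v: "proj E v = x"
  shows "snd (\<beta>' v) $ k' = (\<Sum>k\<in>UNIV. snd (\<beta> v) $ k * frame_transition E U \<beta> \<beta>' x (axis k 1) $ k')"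
proof -
  let ?s = "\<lambda>c. inv_into (proj E -` U) \<beta> (x, c)" and ?F = "frame_transition E U \<beta> \<beta>' x"
  note bij = local_trivialization_smooth(5)[OF \<beta>]
  have im: "(x, c) \<in> \<beta> ` (proj E -` U)" for c using bij x(1) by (simp add: bij_betw_def)
  have s: "?s c \<in> proj E -` U" "\<beta> (?s c) = (x, c)" for c
    by (rule inv_into_into[OF im], rule f_inv_into_f[OF im])
  have ps: "proj E (?s c) = x" for c
    using local_trivialization_fst[OF \<beta> s(1)[of c]] by (simp only: s(2) fst_conv)
  \<comment> \<open>A point of the total space over \<open>U\<close> is determined by its base point
    and its \<beta>-coordinates; sums and multiples in the fibre are identified in this way.\<close>
  have inj: "w = ?s c" if "proj E w = x" "snd (\<beta> w) = c" for w c
  proof -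
    have w: "w \<in> proj E -` U" using that x by simp
    then have "\<beta> w = (x, c)" using \<beta> that by (auto simp: local_trivialization_def prod_eq_iff)
    then show ?thesis using inv_into_f_f[OF bij_betw_imp_inj_on[OF bij] w] by simp
  qed
  have add: "?F (c + d) = ?F c + ?F d" for c d
  proof -
    let ?w = "fibre_add E (?s c) (?s d)"
    have "proj E ?w = x" using E ps by (simp add: smooth_vector_bundle_def)
    moreover have "snd (\<beta> ?w) = c + d" using \<beta> s ps by (simp add: local_trivialization_def)
    ultimately have "?s (c + d) = ?w" by (rule inj[symmetric])
    moreover have "snd (\<beta>' ?w) = ?F c + ?F d"
      using \<beta>' ps x unfolding frame_transition_def by (simp add: local_trivialization_def)
    ultimately show ?thesis by (simp add: frame_transition_def)
  qed
  have scale: "?F (a *s c) = a *s ?F c" for a c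
  proof -
    let ?w = "fibre_scale E a (?s c)"
    have "proj E ?w = x" using E ps by (simp add: smooth_vector_bundle_def)
    moreover have "snd (\<beta> ?w) = a *s c" using \<beta> s ps by (simp add: local_trivialization_def)
    ultimately have "?s (a *s c) = ?w" by (rule inj[symmetric])
    moreover have "snd (\<beta>' ?w) = a *s ?F c"
      using \<beta>' ps x unfolding frame_transition_def by (simp add: local_trivialization_def)
    ultimately show ?thesis by (simp add: frame_transition_def)
  qed
  have zero: "?F 0 = 0" using scale[of 0 0] by simp
  have sum: "?F (\<Sum>k\<in>I. g k) = (\<Sum>k\<in>I. ?F (g k))" for I and g :: "'p \<Rightarrow> complex^'p"
    by (induction I rule: infinite_finite_induct) (simp_all add: zero add)
  have "snd (\<beta>' v) = ?F (snd (\<beta> v))"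
    unfolding frame_transition_def by (rule arg_cong[OF inj[OF v refl]])
  also have "snd (\<beta> v) = (\<Sum>k\<in>UNIV. (snd (\<beta> v) $ k) *s axis k 1)" by (rule basis_expansion[symmetric])
  also have "?F \<dots> = (\<Sum>k\<in>UNIV. (snd (\<beta> v) $ k) *s ?F (axis k 1))" by (simp add: sum scale)
  finally show ?thesis by (simp add: sum_component)
qed

text \<open>Insert a constant coordinate vector, invert \<beta>, read off a \<beta>'-coordinate:
  each step is smooth.\<close>

lemma smooth_frame_transition:
  fixes E :: "('m::t2_space, 'v::t2_space, 'n::finite, 'p::finite) vbundle" and S :: "'s::euclidean_space set"
  assumes E: "smooth_vector_bundle E" and \<beta>: "local_trivialization E U \<beta>" and \<beta>': "local_trivialization E U' \<beta>'"
    and f: "smooth_map euclidean_atlas S (base_atlas E) f" "f ` S \<subseteq> U \<inter> U'" and S: "open S"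
  shows "smooth_on S (\<lambda>y. frame_transition E U \<beta> \<beta>' (f y) c $ k)"
proof -
  note B = smooth_vector_bundle_chart_cover[OF E]
  note P = chart_cover_product[OF B(1) chart_cover_euclidean]
  note tr = local_trivialization_smooth[OF \<beta>]
  have 1: "smooth_map euclidean_atlas S (product_atlas (base_atlas E) euclidean_atlas) (\<lambda>y. (f y, c))"
    by (rule smooth_map_Pair_const[OF B(1) f(1) S])
  have 2: "smooth_map euclidean_atlas S (total_atlas E) (\<lambda>y. inv_into (proj E -` U) \<beta> (f y, c))"
    by (rule smooth_map_compose[OF chart_cover_euclidean P B(2) 1 tr(2) _ S]) (use f(2) tr(4) in \<open>auto intro: open_Times\<close>)
  have "proj E (inv_into (proj E -` U) \<beta> (f y, c)) = f y" if "y \<in> S" for y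
  proof -
    have "f y \<in> U" using that f(2) by auto
    then have im: "(f y, c) \<in> \<beta> ` (proj E -` U)" using tr(5) by (simp add: bij_betw_def)
    show ?thesis
      using local_trivialization_fst[OF \<beta> inv_into_into[OF im]] by (simp only: f_inv_into_f[OF im] fst_conv)
  qed
  then have "(\<lambda>y. inv_into (proj E -` U) \<beta> (f y, c)) ` S \<subseteq> proj E -` U'" using f(2) by auto
  from smooth_fibre_coordinate[OF E \<beta>' 2 this S] show ?thesis by (simp add: frame_transition_def)
qed

section \<open>Coordinate changes between two localizations\<close>

lemma chart_transition:
  fixes E :: "('m::t2_space, 'v::t2_space, 'n::finite, 'p::finite) vbundle"
  assumes E: "smooth_vector_bundle E" and L: "is_localization E L" and j: "j < num_charts L"
    and L': "is_localization E L'" and j': "j' < num_charts L'"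
  shows "open {y. chart L' j' y \<in> range (chart L j)}"
    and "smooth_on {y. chart L' j' y \<in> range (chart L j)} (\<lambda>y. inv (chart L j) (chart L' j' y))"
proof -
  note B = smooth_vector_bundle_chart_cover[OF E]
  note ch = localization_chart[OF L j] and ch' = localization_chart[OF L' j']
  let ?U = "{y. chart L' j' y \<in> range (chart L j)}"
  have "open (UNIV \<inter> chart L' j' -` range (chart L j))"
    by (rule continuous_open_preimage[OF smooth_map_continuous[OF ch'(1)] open_UNIV ch(3)])
  then show o: "open ?U" by (simp add: vimage_def)
  have "smooth_map euclidean_atlas ?U (base_atlas E) (chart L' j')"
    by (rule smooth_map_subset[OF chart_cover_euclidean ch'(1)]) simp
  then have "smooth_map euclidean_atlas ?U euclidean_atlas (\<lambda>y. inv (chart L j) (chart L' j' y))"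
    by (rule smooth_map_compose[OF chart_cover_euclidean B(1) chart_cover_euclidean _ ch(2) _ o ch(3)]) auto
  then show "smooth_on ?U (\<lambda>y. inv (chart L j) (chart L' j' y))" by (rule smooth_map_euclidean)
qed

text \<open>The value 0 off the overlap makes the coordinate change Borel on the whole space; the
  amplitudes vanish there.\<close>

lemma chart_change_of_variables:
  fixes E :: "('m::t2_space, 'v::t2_space, 'n::finite, 'p::finite) vbundle"
  assumes E: "smooth_vector_bundle E" and L: "is_localization E L" and j: "j < num_charts L"
    and L': "is_localization E L'" and j': "j' < num_charts L'"
  shows "change_of_variables {y. chart L' j' y \<in> range (chart L j)} {y. chart L j y \<in> range (chart L' j')}
    (\<lambda>y. if chart L' j' y \<in> range (chart L j) then inv (chart L j) (chart L' j' y) else 0)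
    (\<lambda>y. inv (chart L' j') (chart L j y))"
proof -
  note t = chart_transition[OF E L j L' j'] and t' = chart_transition[OF E L' j' L j]
  note ch = localization_chart[OF L j] and ch' = localization_chart[OF L' j']
  let ?U = "{y. chart L' j' y \<in> range (chart L j)}"
  let ?\<kappa> = "\<lambda>y. if chart L' j' y \<in> range (chart L j) then inv (chart L j) (chart L' j' y) else 0"
  have f: "chart L j (inv (chart L j) x) = x" if "x \<in> range (chart L j)" for x using that by (rule f_inv_into_f)
  have f': "chart L' j' (inv (chart L' j') x) = x" if "x \<in> range (chart L' j')" for x using that by (rule f_inv_into_f)
  show ?thesis
  proof
    show "smooth_on ?U ?\<kappa>" by (rule smooth_on_cong[OF t(1) _ t(2)]) simp
    have "(\<lambda>y. if y \<in> ?U then inv (chart L j) (chart L' j' y) else 0) \<in> borel_measurable borel"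
      by (rule borel_measurable_continuous_on_if)
        (use t smooth_on_imp_continuous_on in \<open>auto simp: continuous_on_const\<close>)
    then show "?\<kappa> \<in> borel_measurable borel" by simp
  qed (use t t' f f' inv_f_f[OF ch(4)] inv_f_f[OF ch'(4)] in auto)
qed

text \<open>Multiplication by a cutoff equal to 1 on \<open>K\<close> leaves \<open>a\<close>
  unchanged and brings it into the form of \<open>test_on_mult_smooth\<close>, which extends
  smoothness across the boundary of \<open>U\<close>.\<close>

lemma test_onI_smooth_on:
  assumes U: "open U" and a: "smooth_on U a" and K: "compact K" "K \<subseteq> U" "\<And>x. x \<notin> K \<Longrightarrow> a x = 0"
  shows "test_on U a"
proof -
  obtain \<psi> C where \<psi>: "smooth_on UNIV (\<psi> :: 'a \<Rightarrow> real)" "\<forall>x\<in>K. \<psi> x = 1" "compact C" "C \<subseteq> U"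
    "\<forall>x. x \<notin> C \<longrightarrow> \<psi> x = 0" "\<forall>x. 0 \<le> \<psi> x \<and> \<psi> x \<le> 1"
    by (rule smooth_urysohn[OF K(1) U K(2)])
  have "test_on U (\<lambda>x. complex_of_real (\<psi> x))"
    unfolding test_on_def using \<psi>
    by (intro conjI exI[of _ C] smooth_on_bounded_linear[OF bounded_linear_of_real]) auto
  from test_on_mult_smooth[OF this U a] have "test_on U (\<lambda>x. complex_of_real (\<psi> x) * a x)" .
  moreover have "(\<lambda>x. complex_of_real (\<psi> x) * a x) = a"
    using \<psi>(2) K(3) by (auto simp: fun_eq_iff)
  ultimately show ?thesis by simp
qed

text \<open>The factor \<open>\<psi>\<close>, which is \<open>1\<close> on the support of the cutoff function of \<open>L\<close>, makes the
  amplitude compactly supported in the domain of the coordinate change.\<close>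

lemma transition_amplitude:
  fixes E :: "('m::t2_space, 'v::t2_space, 'n::finite, 'p::finite) vbundle"
  assumes c: "compact (UNIV :: 'm set)" and E: "smooth_vector_bundle E" and L: "is_localization E L" and j: "j < num_charts L"
    and L': "is_localization E L'" and j': "j' < num_charts L'"
  obtains a where "\<forall>k. test_on {y. chart L' j' y \<in> range (chart L j)} (a k)"
    "\<forall>k y. chart L' j' y \<in> range (chart L j) \<longrightarrow> a k y * complex_of_real (cutoff L j (chart L' j' y)) =
       complex_of_real (cutoff L' j' (chart L' j' y)) * complex_of_real (cutoff L j (chart L' j' y)) *
       frame_transition E (range (chart L j)) (triv L j) (triv L' j') (chart L' j' y) (axis k 1) $ k'"
proof -
  note B = smooth_vector_bundle_chart_cover[OF E]
  note ch = localization_chart[OF L j] and ch' = localization_chart[OF L' j']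
  note t = chart_transition[OF E L j L' j']
  let ?U = "{y. chart L' j' y \<in> range (chart L j)}"
  let ?S = "closure {x. cutoff L j x \<noteq> 0}" and ?S' = "closure {x. cutoff L' j' x \<noteq> 0}"
  let ?\<tau> = "\<lambda>y. inv (chart L j) (chart L' j' y)"
  have cS: "compact ?S" "compact ?S'"
    using compact_Int_closed[OF c closed_closure, of "{x. cutoff L j x \<noteq> 0}"]
      compact_Int_closed[OF c closed_closure, of "{x. cutoff L' j' x \<noteq> 0}"] by simp_all
  have K0: "compact (inv (chart L j) ` ?S)" by (rule compact_chart_preimage[OF L j cS(1) ch(6)])
  obtain \<psi> C where \<psi>: "smooth_on UNIV (\<psi> :: real^'n \<Rightarrow> real)" "\<forall>x\<in>inv (chart L j) ` ?S. \<psi> x = 1"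
    "compact C" "C \<subseteq> UNIV" "\<forall>x. x \<notin> C \<longrightarrow> \<psi> x = 0" "\<forall>x. 0 \<le> \<psi> x \<and> \<psi> x \<le> 1"
    by (rule smooth_urysohn[OF K0 open_UNIV subset_UNIV])
  have cC: "compact (chart L j ` C)"
    using \<psi>(3) smooth_map_continuous[OF ch(1)] by (intro compact_continuous_image) (auto intro: continuous_on_subset)
  \<comment> \<open>The support of the cutoff of \<open>L'\<close> alone may leave the overlap;
    intersected with the image of \<open>C\<close>, off which \<psi> vanishes, it is compact and
    inside both patches.\<close>
  let ?K = "inv (chart L' j') ` (?S' \<inter> chart L j ` C)"
  have K: "compact ?K"
    by (intro compact_chart_preimage[OF L' j'] compact_Int cS cC) (use ch'(6) in auto)
  have KU: "?K \<subseteq> ?U"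
  proof
    fix y assume "y \<in> ?K"
    then obtain x where x: "x \<in> ?S'" "x \<in> chart L j ` C" "y = inv (chart L' j') x" by auto
    then have "chart L' j' y = x" using ch'(6) by (auto intro: f_inv_into_f)
    then show "y \<in> ?U" using x(2) by auto
  qed
  let ?T = "\<lambda>k y. frame_transition E (range (chart L j)) (triv L j) (triv L' j') (chart L' j' y) (axis k 1) $ k'"
  define a where "a k y = (if y \<in> ?U then complex_of_real (cutoff L' j' (chart L' j' y)) * (complex_of_real (\<psi> (?\<tau> y)) * ?T k y) else 0)" for k y
  have s\<chi>: "smooth_on ?U (\<lambda>y. complex_of_real (cutoff L' j' (chart L' j' y)))"
  proof -
    have "smooth_map euclidean_atlas UNIV euclidean_atlas (\<lambda>y. cutoff L' j' (chart L' j' y))"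
      by (rule smooth_map_compose[OF chart_cover_euclidean B(1) chart_cover_euclidean ch'(1) ch'(5)]) auto
    then have "smooth_on ?U (\<lambda>y. cutoff L' j' (chart L' j' y))"
      by (intro smooth_on_subset[OF smooth_map_euclidean]) auto
    then show ?thesis by (rule smooth_on_bounded_linear[OF bounded_linear_of_real t(1)])
  qed
  have s\<psi>: "smooth_on ?U (\<lambda>y. complex_of_real (\<psi> (?\<tau> y)))"
    by (rule smooth_on_bounded_linear[OF bounded_linear_of_real t(1)], rule smooth_on_compose[OF t(1) open_UNIV _ t(2) \<psi>(1)]) simp
  have "smooth_map euclidean_atlas ?U (base_atlas E) (chart L' j')"
    by (rule smooth_map_subset[OF chart_cover_euclidean ch'(1)]) simp
  then have sT: "smooth_on ?U (?T k)" for k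
    by (rule smooth_frame_transition[OF E ch(7) ch'(7) _ _ t(1)]) auto
  have tst: "test_on ?U (a k)" for k
  proof (rule test_onI_smooth_on[OF t(1) _ K KU])
    show "smooth_on ?U (a k)"
      by (rule smooth_on_cong[OF t(1) _ smooth_on_mult[OF t(1) s\<chi> smooth_on_mult[OF t(1) s\<psi> sT[of k]]]]) (simp add: a_def)
    fix y assume y: "y \<notin> ?K"
    show "a k y = 0"
    proof (rule ccontr)
      assume "a k y \<noteq> 0"
      then have yU: "y \<in> ?U" and n: "cutoff L' j' (chart L' j' y) \<noteq> 0" "\<psi> (?\<tau> y) \<noteq> 0" by (auto simp: a_def split: if_splits)
      have 1: "chart L' j' y \<in> ?S'" using n(1) closure_subset[of "{x. cutoff L' j' x \<noteq> 0}"] by blast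
      have "?\<tau> y \<in> C" using n(2) \<psi>(5) by blast
      moreover have "chart L j (?\<tau> y) = chart L' j' y" using yU by (auto intro: f_inv_into_f)
      ultimately have 2: "chart L' j' y \<in> chart L j ` C" by (metis image_eqI)
      have "y = inv (chart L' j') (chart L' j' y)" by (rule inv_f_f[OF ch'(4), symmetric])
      then have "y \<in> ?K" using 1 2 by blast
      then show False using y by blast
    qed
  qed
  show ?thesis
  proof (rule that[of a]; intro allI impI)
    show "test_on ?U (a k)" for k by (rule tst)
    fix k y assume y: "chart L' j' y \<in> range (chart L j)"
    show "a k y * complex_of_real (cutoff L j (chart L' j' y)) =
       complex_of_real (cutoff L' j' (chart L' j' y)) * complex_of_real (cutoff L j (chart L' j' y)) * ?T k y"
    proof (cases "cutoff L j (chart L' j' y) = 0")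
      case False
      then have "chart L' j' y \<in> ?S" using closure_subset[of "{x. cutoff L j x \<noteq> 0}"] by blast
      then have "\<psi> (?\<tau> y) = 1" using \<psi>(2) by blast
      then show ?thesis using y by (simp add: a_def)
    qed simp
  qed
qed

text \<open>In the coordinates of \<open>L'\<close>, the part of \<open>u\<close> cut off by
  \<open>L\<close> is a sum of pullback operators applied to the components of \<open>u\<close> in
  chart \<open>j\<close>: the cutoff of \<open>L\<close> is already contained in those components,
  the cutoff of \<open>L'\<close> and the transition matrix are in the amplitudes. The constant is
  uniform in \<open>u\<close>.\<close>

lemma local_component_piece_bound:
  fixes E :: "('m::t2_space, 'v::t2_space, 'n::finite, 'p::finite) vbundle"
  assumes c: "compact (UNIV :: 'm set)" and E: "smooth_vector_bundle E" and \<phi>: "\<phi> \<in> class_M"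
    and L: "is_localization E L" and j: "j < num_charts L"
    and L': "is_localization E L'" and j': "j' < num_charts L'"
  shows "\<exists>C\<ge>0. \<forall>u. (\<forall>x. proj E (u x) = x) \<longrightarrow> (\<forall>k. test_on UNIV (local_component E L u j k)) \<longrightarrow>
    test_on UNIV (\<lambda>y. complex_of_real (cutoff L j (chart L' j' y)) * local_component E L' u j' k' y) \<and>
    test_norm s \<phi> (\<lambda>y. complex_of_real (cutoff L j (chart L' j' y)) * local_component E L' u j' k' y) \<le>
      C * (\<Sum>k\<in>UNIV. test_norm s \<phi> (local_component E L u j k))"
proof -
  let ?U = "{y. chart L' j' y \<in> range (chart L j)}"
  define \<kappa> where "\<kappa> y = (if chart L' j' y \<in> range (chart L j) then inv (chart L j) (chart L' j' y) else 0)" for y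
  interpret change_of_variables ?U "{y. chart L j y \<in> range (chart L' j')}" \<kappa> "\<lambda>y. inv (chart L' j') (chart L j y)"
    unfolding \<kappa>_def[abs_def] by (rule chart_change_of_variables[OF E L j L' j'])
  note ch = localization_chart[OF L j] and ch' = localization_chart[OF L' j']
  obtain a where a: "\<forall>k. test_on ?U (a k)"
    "\<forall>k y. chart L' j' y \<in> range (chart L j) \<longrightarrow> a k y * complex_of_real (cutoff L j (chart L' j' y)) =
       complex_of_real (cutoff L' j' (chart L' j' y)) * complex_of_real (cutoff L j (chart L' j' y)) *
       frame_transition E (range (chart L j)) (triv L j) (triv L' j') (chart L' j' y) (axis k 1) $ k'"
    by (rule transition_amplitude[OF c E L j L' j'])
  have "\<exists>C. 0 \<le> C \<and> (\<forall>f. test_on UNIV f \<longrightarrow> test_norm s \<phi> (\<lambda>x. a k x * f (\<kappa> x)) \<le> C * test_norm s \<phi> f)" for k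
    by (rule test_norm_pullback[OF a(1)[rule_format, of k] \<phi>, of s]) blast
  then have "\<forall>k. \<exists>C. 0 \<le> C \<and> (\<forall>f. test_on UNIV f \<longrightarrow> test_norm s \<phi> (\<lambda>x. a k x * f (\<kappa> x)) \<le> C * test_norm s \<phi> f)" by blast
  then obtain C where C: "\<forall>k. 0 \<le> C k \<and> (\<forall>f. test_on UNIV f \<longrightarrow> test_norm s \<phi> (\<lambda>x. a k x * f (\<kappa> x)) \<le> C k * test_norm s \<phi> f)"
    unfolding choice_iff by (elim exE)
  let ?C = "\<Sum>k\<in>UNIV. C k"
  have C0: "0 \<le> ?C" using C by (intro sum_nonneg) auto
  have CC: "C k \<le> ?C" for k using C by (intro member_le_sum) auto
  show ?thesis
  proof (intro exI[of _ ?C] conjI C0 allI impI)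
    fix u assume u: "\<forall>x. proj E (u x) = x" and T: "\<forall>k. test_on UNIV (local_component E L u j k)"
    let ?p = "\<lambda>y. complex_of_real (cutoff L j (chart L' j' y)) * local_component E L' u j' k' y"
    let ?f = "\<lambda>k. local_component E L u j k"
    have eq: "?p = (\<lambda>y. \<Sum>k\<in>UNIV. a k y * ?f k (\<kappa> y))"
    proof
      fix y
      let ?x = "chart L' j' y"
      show "?p y = (\<Sum>k\<in>UNIV. a k y * ?f k (\<kappa> y))"
      proof (cases "?x \<in> range (chart L j)")
        case False
        then have "cutoff L j ?x = 0" by (rule localization_cutoff_0[OF L j])
        moreover have "a k y = 0" for k using test_on_outside[OF a(1)[rule_format]] False by blast
        ultimately show ?thesis by simp
      next
        case True
        have cx: "chart L j (\<kappa> y) = ?x" using True by (simp add: \<kappa>_def f_inv_into_f)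
        let ?T = "\<lambda>k. frame_transition E (range (chart L j)) (triv L j) (triv L' j') ?x (axis k 1) $ k'"
        have "(\<Sum>k\<in>UNIV. a k y * ?f k (\<kappa> y)) =
          (\<Sum>k\<in>UNIV. (a k y * complex_of_real (cutoff L j ?x)) * snd (triv L j (u ?x)) $ k)"
          using u by (simp add: local_component_eq[OF L j] cx mult.assoc)
        also have "\<dots> = complex_of_real (cutoff L' j' ?x) * complex_of_real (cutoff L j ?x) *
          (\<Sum>k\<in>UNIV. snd (triv L j (u ?x)) $ k * ?T k)"
          unfolding sum_distrib_left
        proof (rule sum.cong[OF refl])
          fix k
          have e: "a k y * complex_of_real (cutoff L j ?x) =
            complex_of_real (cutoff L' j' ?x) * complex_of_real (cutoff L j ?x) * ?T k"
            using a(2) True by blast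
          show "a k y * complex_of_real (cutoff L j ?x) * snd (triv L j (u ?x)) $ k =
            complex_of_real (cutoff L' j' ?x) * complex_of_real (cutoff L j ?x) * (snd (triv L j (u ?x)) $ k * ?T k)"
            unfolding e by (simp only: mult_ac)
        qed
        also have "(\<Sum>k\<in>UNIV. snd (triv L j (u ?x)) $ k * ?T k) = snd (triv L' j' (u ?x)) $ k'"
          by (rule frame_transition_expansion[OF E ch(7) ch'(7) True _ u[rule_format], symmetric]) simp
        finally show ?thesis using u by (simp add: local_component_eq[OF L' j'] mult_ac)
      qed
    qed
    have tk: "test_on UNIV (\<lambda>y. a k y * ?f k (\<kappa> y))" for k
      by (rule test_on_mono[OF test_on_pullback[OF a(1)[rule_format] T[rule_format]]]) simp
    show "test_on UNIV ?p" unfolding eq by (intro test_on_sum tk)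
    have "test_norm s \<phi> ?p \<le> (\<Sum>k\<in>UNIV. test_norm s \<phi> (\<lambda>y. a k y * ?f k (\<kappa> y)))"
      unfolding eq by (rule test_norm_sum[OF \<phi> tk])
    also have "\<dots> \<le> (\<Sum>k\<in>UNIV. ?C * test_norm s \<phi> (?f k))"
    proof (rule sum_mono)
      fix k
      have "test_norm s \<phi> (\<lambda>y. a k y * ?f k (\<kappa> y)) \<le> C k * test_norm s \<phi> (?f k)" using C T by blast
      also have "\<dots> \<le> ?C * test_norm s \<phi> (?f k)" by (intro mult_right_mono CC) simp
      finally show "test_norm s \<phi> (\<lambda>y. a k y * ?f k (\<kappa> y)) \<le> ?C * test_norm s \<phi> (?f k)" .
    qed
    finally show "test_norm s \<phi> ?p \<le> ?C * (\<Sum>k\<in>UNIV. test_norm s \<phi> (?f k))" by (simp add: sum_distrib_left)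
  qed
qed

section \<open>Equivalence of the norms on sections and of the completions\<close>

text \<open>What the estimates use of a section. It passes to \<open>section_diff\<close> by
  linearity of the trivializations alone, so differences of smooth sections can be estimated without
  first proving them smooth.\<close>

definition good_section ::
    "('m::t2_space, 'v::t2_space, 'n::finite, 'p::finite) vbundle \<Rightarrow> ('m, 'v, 'n, 'p) localization \<Rightarrow> ('m \<Rightarrow> 'v) \<Rightarrow> bool" where
  "good_section E L u \<longleftrightarrow> (\<forall>x. proj E (u x) = x) \<and>
     (\<forall>j<num_charts L. \<forall>k. test_on UNIV (local_component E L u j k))"

text \<open>As an \<open>L2_set\<close> over pairs of indices the norm inherits the triangle
  inequality and monotonicity.\<close>

lemma section_norm_eq:
  "section_norm E L s \<phi> u =
    L2_set (\<lambda>(j, k). test_norm s \<phi> (local_component E L u j k)) ({..<num_charts L} \<times> UNIV)"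
  unfolding section_norm_def L2_set_def test_norm_def
  by (simp add: sum.cartesian_product case_prod_beta')

lemma section_norm_nonneg: "0 \<le> section_norm E L s \<phi> u"
  by (simp add: section_norm_eq L2_set_nonneg)

lemma test_norm_le_section_norm:
  assumes "j < num_charts L"
  shows "test_norm s \<phi> (local_component E L u j k) \<le> section_norm E L s \<phi> u"
  using assms unfolding section_norm_eq
  by (intro order_trans[OF _ member_le_L2_set[of _ "(j, k)"]]) auto

text \<open>The cutoffs of \<open>L\<close> sum to 1 and are inserted; each resulting piece is
  controlled by a single chart of \<open>L\<close>.\<close>

lemma local_component_bound:
  fixes E :: "('m::t2_space, 'v::t2_space, 'n::finite, 'p::finite) vbundle"
  assumes c: "compact (UNIV :: 'm set)" and E: "smooth_vector_bundle E" and \<phi>: "\<phi> \<in> class_M"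
    and L: "is_localization E L" and L': "is_localization E L'" and j': "j' < num_charts L'"
  shows "\<exists>C\<ge>0. \<forall>u. good_section E L u \<longrightarrow> test_on UNIV (local_component E L' u j' k') \<and>
    test_norm s \<phi> (local_component E L' u j' k') \<le> C * section_norm E L s \<phi> u"
proof -
  let ?J = "{..<num_charts L}"
  let ?p = "\<lambda>u j y. complex_of_real (cutoff L j (chart L' j' y)) * local_component E L' u j' k' y"
  have "\<forall>j\<in>?J. \<exists>C. 0 \<le> C \<and> (\<forall>u. (\<forall>x. proj E (u x) = x) \<longrightarrow> (\<forall>k. test_on UNIV (local_component E L u j k)) \<longrightarrow>
    test_on UNIV (?p u j) \<and> test_norm s \<phi> (?p u j) \<le> C * (\<Sum>k\<in>UNIV. test_norm s \<phi> (local_component E L u j k)))"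
    by (intro ballI local_component_piece_bound[OF c E \<phi> L _ L' j']) simp
  then obtain C where C: "\<forall>j\<in>?J. 0 \<le> C j \<and> (\<forall>u. (\<forall>x. proj E (u x) = x) \<longrightarrow> (\<forall>k. test_on UNIV (local_component E L u j k)) \<longrightarrow>
    test_on UNIV (?p u j) \<and> test_norm s \<phi> (?p u j) \<le> C j * (\<Sum>k\<in>UNIV. test_norm s \<phi> (local_component E L u j k)))"
    unfolding bchoice_iff by (elim exE)
  let ?D = "(\<Sum>j\<in>?J. C j) * real CARD('p)"
  show ?thesis
  proof (intro exI[of _ ?D] conjI allI impI)
    show "0 \<le> ?D" using C by (intro mult_nonneg_nonneg sum_nonneg) auto
    fix u assume g: "good_section E L u"
    have t: "test_on UNIV (?p u j)" "test_norm s \<phi> (?p u j) \<le> C j * (\<Sum>k\<in>UNIV. test_norm s \<phi> (local_component E L u j k))"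
      if j: "j \<in> ?J" for j
    proof -
      have "\<forall>x. proj E (u x) = x" "\<forall>k. test_on UNIV (local_component E L u j k)"
        using g j by (simp_all add: good_section_def)
      with bspec[OF C j] show "test_on UNIV (?p u j)"
        "test_norm s \<phi> (?p u j) \<le> C j * (\<Sum>k\<in>UNIV. test_norm s \<phi> (local_component E L u j k))"
        by simp_all
    qed
    have one: "(\<Sum>j<num_charts L. cutoff L j x) = 1" for x using L by (simp add: is_localization_def)
    have eq: "local_component E L' u j' k' = (\<lambda>y. \<Sum>j\<in>?J. ?p u j y)"
    proof
      fix y
      show "local_component E L' u j' k' y = (\<Sum>j\<in>?J. ?p u j y)"
        by (simp only: sum_distrib_right[symmetric] of_real_sum[symmetric] one of_real_1 mult_1)
    qed
    show "test_on UNIV (local_component E L' u j' k')" by (subst eq) (rule test_on_sum, rule t)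
    have "test_norm s \<phi> (local_component E L' u j' k') \<le> (\<Sum>j\<in>?J. test_norm s \<phi> (?p u j))"
      by (subst eq) (rule test_norm_sum[OF \<phi>], rule t)
    also have "\<dots> \<le> (\<Sum>j\<in>?J. C j * (real CARD('p) * section_norm E L s \<phi> u))"
    proof (rule sum_mono)
      fix j assume j: "j \<in> ?J"
      have "(\<Sum>k\<in>(UNIV :: 'p set). test_norm s \<phi> (local_component E L u j k)) \<le> real CARD('p) * section_norm E L s \<phi> u"
        using j by (intro sum_bounded_above test_norm_le_section_norm) auto
      then have "C j * (\<Sum>k\<in>UNIV. test_norm s \<phi> (local_component E L u j k)) \<le> C j * (real CARD('p) * section_norm E L s \<phi> u)"
        using C j by (intro mult_left_mono) auto
      with t(2)[OF j] show "test_norm s \<phi> (?p u j) \<le> C j * (real CARD('p) * section_norm E L s \<phi> u)" by linarith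
    qed
    also have "\<dots> = ?D * section_norm E L s \<phi> u" by (simp add: sum_distrib_right mult.assoc)
    finally show "test_norm s \<phi> (local_component E L' u j' k') \<le> ?D * section_norm E L s \<phi> u" .
  qed
qed

lemma section_norm_bound:
  fixes E :: "('m::t2_space, 'v::t2_space, 'n::finite, 'p::finite) vbundle"
  assumes c: "compact (UNIV :: 'm set)" and E: "smooth_vector_bundle E" and \<phi>: "\<phi> \<in> class_M"
    and L: "is_localization E L" and L': "is_localization E L'"
  obtains C where "0 < C" "\<forall>u. good_section E L u \<longrightarrow> section_norm E L' s \<phi> u \<le> C * section_norm E L s \<phi> u"
proof -
  let ?J = "{..<num_charts L'} \<times> (UNIV :: 'p set)"
  have "\<forall>i\<in>?J. \<exists>C. 0 \<le> C \<and> (\<forall>u. good_section E L u \<longrightarrow>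
    test_norm s \<phi> (local_component E L' u (fst i) (snd i)) \<le> C * section_norm E L s \<phi> u)"
  proof
    fix i assume "i \<in> ?J"
    then have "fst i < num_charts L'" by auto
    from local_component_bound[OF c E \<phi> L L' this, of "snd i" s]
    show "\<exists>C. 0 \<le> C \<and> (\<forall>u. good_section E L u \<longrightarrow>
      test_norm s \<phi> (local_component E L' u (fst i) (snd i)) \<le> C * section_norm E L s \<phi> u)" by blast
  qed
  then obtain C where C: "\<forall>i\<in>?J. 0 \<le> C i \<and> (\<forall>u. good_section E L u \<longrightarrow>
    test_norm s \<phi> (local_component E L' u (fst i) (snd i)) \<le> C i * section_norm E L s \<phi> u)"
    unfolding bchoice_iff by (elim exE)
  \<comment> \<open>The summand 1 makes the constant positive even if all \<open>C i\<close> are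
    0.\<close>
  have "section_norm E L' s \<phi> u \<le> ((\<Sum>i\<in>?J. C i) + 1) * section_norm E L s \<phi> u" if g: "good_section E L u" for u
  proof -
    have "section_norm E L' s \<phi> u \<le> (\<Sum>i\<in>?J. test_norm s \<phi> (local_component E L' u (fst i) (snd i)))"
      unfolding section_norm_eq case_prod_beta' by (rule L2_set_le_sum) simp
    also have "\<dots> \<le> (\<Sum>i\<in>?J. C i * section_norm E L s \<phi> u)" using C g by (intro sum_mono) auto
    also have "\<dots> = (\<Sum>i\<in>?J. C i) * section_norm E L s \<phi> u" by (simp only: sum_distrib_right)
    also have "\<dots> \<le> ((\<Sum>i\<in>?J. C i) + 1) * section_norm E L s \<phi> u"
      by (intro mult_right_mono section_norm_nonneg) simp
    finally show ?thesis .
  qed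
  moreover have "0 \<le> (\<Sum>i\<in>?J. C i)" using C by (intro sum_nonneg) auto
  ultimately show ?thesis by (intro that[of "(\<Sum>i\<in>?J. C i) + 1"]) auto
qed

lemma smooth_section_good:
  fixes E :: "('m::t2_space, 'v::t2_space, 'n::finite, 'p::finite) vbundle"
  assumes "compact (UNIV :: 'm set)" "smooth_vector_bundle E" "is_localization E L" "u \<in> smooth_sections E"
  shows "good_section E L u"
  unfolding good_section_def using local_component_test_on[OF assms] smooth_sections_proj[OF assms(4)] by blast

lemma
  fixes E :: "('m::t2_space, 'v::t2_space, 'n::finite, 'p::finite) vbundle"
  assumes E: "smooth_vector_bundle E" and L: "is_localization E L"
    and u: "good_section E L u" and v: "good_section E L v"
  shows good_section_diff: "good_section E L (section_diff E u v)"
    and local_component_diff: "j < num_charts L \<Longrightarrow> local_component E L (section_diff E u v) j k =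
      (\<lambda>y. local_component E L u j k y + - local_component E L v j k y)"
proof -
  have pu: "proj E (u x) = x" "proj E (v x) = x" for x using u v by (auto simp: good_section_def)
  have ps: "proj E (fibre_scale E (-1) (v x)) = x" for x using E pu by (simp add: smooth_vector_bundle_def)
  have pd: "proj E (section_diff E u v x) = x" for x
    using E pu ps by (simp add: smooth_vector_bundle_def section_diff_def)
  have d: "local_component E L (section_diff E u v) j k = (\<lambda>y. local_component E L u j k y + - local_component E L v j k y)"
    if j: "j < num_charts L" for j k
  proof
    fix y
    let ?x = "chart L j y"
    note tr = localization_chart(7)[OF L j]
    have "snd (triv L j (section_diff E u v ?x)) = snd (triv L j (u ?x)) + snd (triv L j (fibre_scale E (-1) (v ?x)))"
      using tr pu ps unfolding section_diff_def by (simp add: local_trivialization_def)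
    also have "snd (triv L j (fibre_scale E (-1) (v ?x))) = (-1) *s snd (triv L j (v ?x))"
      using tr pu by (simp add: local_trivialization_def)
    finally have "snd (triv L j (section_diff E u v ?x)) $ k = snd (triv L j (u ?x)) $ k - snd (triv L j (v ?x)) $ k" by simp
    then show "local_component E L (section_diff E u v) j k y = local_component E L u j k y + - local_component E L v j k y"
      by (simp add: local_component_eq[OF L j pu(1)] local_component_eq[OF L j pu(2)] local_component_eq[OF L j pd] right_diff_distrib)
  qed
  then show "j < num_charts L \<Longrightarrow> local_component E L (section_diff E u v) j k =
      (\<lambda>y. local_component E L u j k y + - local_component E L v j k y)" .
  show "good_section E L (section_diff E u v)"
    unfolding good_section_def
  proof (intro conjI allI impI)
    show "proj E (section_diff E u v x) = x" for x by (rule pd)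
    fix j k assume j: "j < num_charts L"
    have "test_on UNIV (\<lambda>y. (-1) * local_component E L v j k y)"
      using v j by (intro test_on_cmult) (auto simp: good_section_def)
    then show "test_on UNIV (local_component E L (section_diff E u v) j k)"
      unfolding d[OF j] using u j by (intro test_on_add) (auto simp: good_section_def)
  qed
qed

text \<open>The reverse triangle inequality. It makes the norms along a Cauchy sequence of sections
  a Cauchy sequence of reals.\<close>

lemma section_norm_diff:
  fixes E :: "('m::t2_space, 'v::t2_space, 'n::finite, 'p::finite) vbundle"
  assumes E: "smooth_vector_bundle E" and L: "is_localization E L" and \<phi>: "\<phi> \<in> class_M"
    and u: "good_section E L u" and v: "good_section E L v"
  shows "\<bar>section_norm E L s \<phi> u - section_norm E L s \<phi> v\<bar> \<le> section_norm E L s \<phi> (section_diff E u v)"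
proof -
  let ?d = "section_diff E u v" and ?J = "{..<num_charts L} \<times> (UNIV :: 'p set)"
  have t: "test_on UNIV (local_component E L u j k)" "test_on UNIV (local_component E L v j k)"
    "test_on UNIV (local_component E L ?d j k)" if "j < num_charts L" for j k
    using u v good_section_diff[OF E L u v] that by (auto simp: good_section_def)
  have neg: "test_on UNIV (\<lambda>y. - f y)" if "test_on UNIV f" for f :: "real^'n \<Rightarrow> complex"
    using test_on_cmult[OF that, of "-1"] by simp
  have tri: "test_norm s \<phi> (local_component E L u j k) \<le> test_norm s \<phi> (local_component E L v j k) + test_norm s \<phi> (local_component E L ?d j k)"
    "test_norm s \<phi> (local_component E L v j k) \<le> test_norm s \<phi> (local_component E L u j k) + test_norm s \<phi> (local_component E L ?d j k)"
    if j: "j < num_charts L" for j k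
  proof -
    note eq = local_component_diff[OF E L u v j, of k]
    have 1: "local_component E L u j k = (\<lambda>y. local_component E L v j k y + local_component E L ?d j k y)"
      by (simp add: eq)
    show "test_norm s \<phi> (local_component E L u j k) \<le> test_norm s \<phi> (local_component E L v j k) + test_norm s \<phi> (local_component E L ?d j k)"
      by (subst 1) (rule test_norm_triangle[OF t(2)[OF j] t(3)[OF j] \<phi>])
    have 2: "local_component E L v j k = (\<lambda>y. local_component E L u j k y + - local_component E L ?d j k y)"
      by (simp add: eq)
    have "test_norm s \<phi> (local_component E L v j k) \<le> test_norm s \<phi> (local_component E L u j k) + test_norm s \<phi> (\<lambda>y. - local_component E L ?d j k y)"
      by (subst 2) (rule test_norm_triangle[OF t(1)[OF j] neg[OF t(3)[OF j]] \<phi>])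
    then show "test_norm s \<phi> (local_component E L v j k) \<le> test_norm s \<phi> (local_component E L u j k) + test_norm s \<phi> (local_component E L ?d j k)"
      by (simp add: test_norm_minus[OF t(3)[OF j] \<phi>])
  qed
  have "section_norm E L s \<phi> u \<le> section_norm E L s \<phi> v + section_norm E L s \<phi> ?d"
    unfolding section_norm_eq case_prod_beta'
    by (rule order_trans[OF L2_set_mono L2_set_triangle_ineq]) (auto intro: tri)
  moreover have "section_norm E L s \<phi> v \<le> section_norm E L s \<phi> u + section_norm E L s \<phi> ?d"
    unfolding section_norm_eq case_prod_beta'
    by (rule order_trans[OF L2_set_mono L2_set_triangle_ineq]) (auto intro: tri)
  ultimately show ?thesis by linarith
qed

text \<open>Serves reflexivity of \<open>null_rel\<close>: a Cauchy sequence belongs to its own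
  class.\<close>

lemma section_norm_diff_self:
  fixes E :: "('m::t2_space, 'v::t2_space, 'n::finite, 'p::finite) vbundle"
  assumes E: "smooth_vector_bundle E" and L: "is_localization E L" and \<phi>: "\<phi> \<in> class_M" and u: "good_section E L u"
  shows "section_norm E L s \<phi> (section_diff E u u) = 0"
proof -
  have "test_norm s \<phi> (local_component E L (section_diff E u u) j k) = 0" if "j < num_charts L" for j k
    by (simp add: local_component_diff[OF E L u u that] test_norm_zero[OF \<phi>])
  then show ?thesis
    unfolding section_norm_eq case_prod_beta' L2_set_def by (auto intro!: sum.neutral)
qed

section \<open>Comparison of completions\<close>

lemma cauchy_sequences_subset:
  assumes le: "\<And>u v. u \<in> X \<Longrightarrow> v \<in> X \<Longrightarrow> N' (d u v) \<le> C * N (d u v)" and C: "0 < C"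
  shows "cauchy_sequences d N X \<subseteq> cauchy_sequences d N' X"
proof
  fix S assume "S \<in> cauchy_sequences d N X"
  then have r: "range S \<subseteq> X" and S: "\<forall>e>0. \<exists>M. \<forall>i\<ge>M. \<forall>j\<ge>M. N (d (S i) (S j)) < e" by (auto simp: cauchy_sequences_def)
  have "\<exists>M. \<forall>i\<ge>M. \<forall>j\<ge>M. N' (d (S i) (S j)) < e" if e: "e > 0" for e
  proof -
    obtain M where M: "\<forall>i\<ge>M. \<forall>j\<ge>M. N (d (S i) (S j)) < e / C" using S e C by (meson divide_pos_pos)
    have "N' (d (S i) (S j)) < e" if "i \<ge> M" "j \<ge> M" for i j
    proof -
      have "N' (d (S i) (S j)) \<le> C * N (d (S i) (S j))" using r by (intro le) auto
      also have "\<dots> < C * (e / C)" using M that C by (intro mult_strict_left_mono) auto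
      finally show ?thesis using C by simp
    qed
    then show ?thesis by blast
  qed
  with r show "S \<in> cauchy_sequences d N' X" by (auto simp: cauchy_sequences_def)
qed

lemma null_rel_subset:
  assumes le: "\<And>u v. u \<in> X \<Longrightarrow> v \<in> X \<Longrightarrow> N' (d u v) \<le> C * N (d u v)" and C: "0 < C"
    and nn: "\<And>u. 0 \<le> N' u"
  shows "null_rel d N X \<subseteq> null_rel d N' X"
proof clarify
  fix S T assume "(S, T) \<in> null_rel d N X"
  then have ST: "S \<in> cauchy_sequences d N X" "T \<in> cauchy_sequences d N X" and l: "(\<lambda>i. N (d (S i) (T i))) \<longlonglongrightarrow> 0"
    by (auto simp: null_rel_def)
  have r: "range S \<subseteq> X" "range T \<subseteq> X" using ST by (auto simp: cauchy_sequences_def)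
  have "(\<lambda>i. C * N (d (S i) (T i))) \<longlonglongrightarrow> C * 0" by (intro tendsto_intros l)
  then have u: "(\<lambda>i. C * N (d (S i) (T i))) \<longlonglongrightarrow> 0" by simp
  have "(\<lambda>i. N' (d (S i) (T i))) \<longlonglongrightarrow> 0"
    by (rule tendsto_sandwich[OF _ _ tendsto_const u]) (use r in \<open>auto intro!: always_eventually nn le\<close>)
  moreover have "S \<in> cauchy_sequences d N' X" "T \<in> cauchy_sequences d N' X"
    using cauchy_sequences_subset[of X N' d C N, OF le C] ST by auto
  ultimately show "(S, T) \<in> null_rel d N' X" by (simp add: null_rel_def)
qed

text \<open>\<open>completion_norm\<close> is written with \<open>lim\<close>, which is meaningful
  only for convergent sequences; here the limit is shown to exist.\<close>

lemma cauchy_sequence_norm_converges: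
  assumes diff: "\<And>u v. u \<in> X \<Longrightarrow> v \<in> X \<Longrightarrow> \<bar>N u - N v\<bar> \<le> N (d u v)" and S: "S \<in> cauchy_sequences d N X"
  shows "(\<lambda>i. N (S i)) \<longlonglongrightarrow> lim (\<lambda>i. N (S i))"
proof -
  have "Cauchy (\<lambda>i. N (S i))"
  proof (rule metric_CauchyI)
    fix e :: real assume "e > 0"
    then obtain M where M: "\<forall>i\<ge>M. \<forall>j\<ge>M. N (d (S i) (S j)) < e" using S by (auto simp: cauchy_sequences_def)
    have "dist (N (S i)) (N (S j)) < e" if "i \<ge> M" "j \<ge> M" for i j
    proof -
      have "\<bar>N (S i) - N (S j)\<bar> \<le> N (d (S i) (S j))" using S by (intro diff) (auto simp: cauchy_sequences_def)
      then show ?thesis using M that by (fastforce simp: dist_real_def)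
    qed
    then show "\<exists>M. \<forall>m\<ge>M. \<forall>n\<ge>M. dist (N (S m)) (N (S n)) < e" by blast
  qed
  then show ?thesis using convergent_LIMSEQ_iff[of "\<lambda>i. N (S i)"] Cauchy_convergent_iff by blast
qed

theorem theorem4p2:
  fixes E :: "('m::t2_space, 'v::t2_space, 'n::finite, 'p::finite) vbundle"
    and \<mu> :: "'m measure"
    and s :: real and \<phi> :: "real \<Rightarrow> real"
    and L L' :: "('m, 'v, 'n, 'p) localization"
  assumes "compact (UNIV :: 'm set)"
    and "smooth_vector_bundle E"
    and "smooth_density (base_atlas E) \<mu>"
    and "\<phi> \<in> class_M"
    and "is_localization E L"
    and "is_localization E L'"
  shows "equivalent_norms_on (smooth_sections E) (section_norm E L s \<phi>) (section_norm E L' s \<phi>) \<and>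
    bundle_space E L s \<phi> = bundle_space E L' s \<phi> \<and>
    equivalent_norms_on (bundle_space E L s \<phi>) (bundle_space_norm E L s \<phi>) (bundle_space_norm E L' s \<phi>)"
proof -
  note c = assms(1) and E = assms(2) and \<phi> = assms(4) and L = assms(5) and L' = assms(6)
  let ?X = "smooth_sections E" and ?d = "section_diff E"
  let ?N = "section_norm E L s \<phi>" and ?N' = "section_norm E L' s \<phi>"
  obtain C where C: "0 < C" "\<forall>u. good_section E L u \<longrightarrow> ?N' u \<le> C * ?N u"
    by (rule section_norm_bound[OF c E \<phi> L L'])
  obtain C' where C': "0 < C'" "\<forall>u. good_section E L' u \<longrightarrow> ?N u \<le> C' * ?N' u"
    by (rule section_norm_bound[OF c E \<phi> L' L])
  have good: "good_section E L u" "good_section E L' u" if "u \<in> ?X" for u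
    by (rule smooth_section_good[OF c E L that], rule smooth_section_good[OF c E L' that])
  \<comment> \<open>Differences enter through \<open>good_section\<close>, which is all that the two
    norm bounds ask for.\<close>
  have dN: "?N' (?d u v) \<le> C * ?N (?d u v)" "?N (?d u v) \<le> C' * ?N' (?d u v)" if "u \<in> ?X" "v \<in> ?X" for u v
    using C(2) C'(2) good[OF that(1)] good[OF that(2)]
      good_section_diff[OF E L, of u v] good_section_diff[OF E L', of u v] by blast+
  have lower: "1 / C' * ?N u \<le> ?N' u" if "u \<in> ?X" for u
    using C' good[OF that] by (simp add: pos_divide_le_eq mult.commute)
  have "equivalent_norms_on ?X ?N ?N'"
    unfolding equivalent_norms_on_def using C C'(1) good lower
    by (intro exI[of _ "1 / C'"] conjI exI[of _ C] ballI) auto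
  moreover have cs: "cauchy_sequences ?d ?N ?X = cauchy_sequences ?d ?N' ?X"
    by (intro antisym cauchy_sequences_subset[where d="?d" and N="?N" and N'="?N'", OF dN(1) C(1)]
       cauchy_sequences_subset[where d="?d" and N="?N'" and N'="?N", OF dN(2) C'(1)])
  moreover have "null_rel ?d ?N ?X = null_rel ?d ?N' ?X"
    by (intro antisym null_rel_subset[where d="?d" and N="?N" and N'="?N'", OF dN(1) C(1)]
       null_rel_subset[where d="?d" and N="?N'" and N'="?N", OF dN(2) C'(1)] section_norm_nonneg)
  ultimately have 1: "equivalent_norms_on ?X ?N ?N'" and 2: "bundle_space E L s \<phi> = bundle_space E L' s \<phi>"
    by (simp_all add: bundle_space_def completion_def)
  have "1 / C' * bundle_space_norm E L s \<phi> h \<le> bundle_space_norm E L' s \<phi> h \<and>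
    bundle_space_norm E L' s \<phi> h \<le> C * bundle_space_norm E L s \<phi> h" if h: "h \<in> bundle_space E L s \<phi>" for h
  proof -
    obtain S0 where S0: "S0 \<in> cauchy_sequences ?d ?N ?X" "h = null_rel ?d ?N ?X `` {S0}"
      using h by (auto simp: bundle_space_def completion_def elim: quotientE)
    have "S0 i \<in> ?X" for i using S0(1) by (auto simp: cauchy_sequences_def)
    then have "?N (?d (S0 i) (S0 i)) = 0" for i using good by (intro section_norm_diff_self[OF E L \<phi>]) auto
    then have "S0 \<in> h" using S0 by (simp add: null_rel_def)
    \<comment> \<open>The class \<open>h\<close> is literally the same set for both localizations,
      so both completion norms select this same representative and the two limits are compared term
      by term.\<close>
    define T where "T = (SOME S. S \<in> h)"
    have "T \<in> h" unfolding T_def by (rule someI[of "\<lambda>S. S \<in> h", OF \<open>S0 \<in> h\<close>])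
    then have T: "T \<in> cauchy_sequences ?d ?N ?X" using S0(2) by (auto simp: null_rel_def)
    have TX: "T i \<in> ?X" for i using T by (auto simp: cauchy_sequences_def)
    have l: "(\<lambda>i. ?N (T i)) \<longlonglongrightarrow> bundle_space_norm E L s \<phi> h"
      unfolding bundle_space_norm_def completion_norm_def T_def[symmetric]
      by (rule cauchy_sequence_norm_converges[OF _ T]) (intro section_norm_diff[OF E L \<phi>] good)
    have l': "(\<lambda>i. ?N' (T i)) \<longlonglongrightarrow> bundle_space_norm E L' s \<phi> h"
      unfolding bundle_space_norm_def completion_norm_def T_def[symmetric]
      by (rule cauchy_sequence_norm_converges[OF _ T[unfolded cs]]) (intro section_norm_diff[OF E L' \<phi>] good)
    show ?thesis
    proof
      show "1 / C' * bundle_space_norm E L s \<phi> h \<le> bundle_space_norm E L' s \<phi> h"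
        by (rule LIMSEQ_le[OF tendsto_mult[OF tendsto_const l] l']) (use lower TX in blast)
      show "bundle_space_norm E L' s \<phi> h \<le> C * bundle_space_norm E L s \<phi> h"
        by (rule LIMSEQ_le[OF l' tendsto_mult[OF tendsto_const l]]) (use C(2) good TX in blast)
    qed
  qed
  then have "equivalent_norms_on (bundle_space E L s \<phi>) (bundle_space_norm E L s \<phi>) (bundle_space_norm E L' s \<phi>)"
    unfolding equivalent_norms_on_def using C(1) C'(1)
    by (intro exI[of _ "1 / C'"] conjI exI[of _ C] ballI) auto
  with 1 2 show ?thesis by blast
qed

end
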